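(* The norm of any matrix valued polynomial of degree one in $u_\theta,u_\theta^*,v_\theta,v_\theta^*$ depends Lipschitz continuously on $\theta\in\mathbb{R}$. That is, for every $k\in\mathbb{N}$ and all matrices $B_0,B_1,B_2,B_3,B_4\in M_k(\mathbb{C})$, the function $$\theta\mapsto\|B_0\otimes 1+B_1\otimes u_\theta+B_2\otimes u_\theta^*+B_3\otimes v_\theta+B_4\otimes v_\theta^*\|$$ (norm in $M_k(\mathbb{C})\otimes A_\theta$) is Lipschitz continuous on $\mathbb{R}$. In particular, the norm of the operator $h_\theta=u_\theta+u_\theta^*+v_\theta+v_\theta^*$ depends Lipschitz continuously on $\theta$.
   Context: For $\theta\in\mathbb{R}$, $A_\theta=C^*(u,v \text{ unitary}\mid vu=e^{i\theta}uv)$ denotes the universal C*-algebra generated by two unitaries $u,v$ satisfying $vu=e^{i\theta}uv$; its generators are denoted $u_\theta,v_\theta$. *)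

theory Defs
  imports
    "HOL-Analysis.Abstract_Metric_Spaces"
    "HOL-Analysis.Lipschitz"
    "HOL-Algebra.Module"
    "Jordan_Normal_Form.Matrix"
begin

section \<open>Unital C*-algebras with explicit carrier\<close>

definition complex_ring :: "complex ring" where
  "complex_ring = \<lparr>carrier = UNIV, monoid.mult = (*), one = 1, zero = 0, add = (+)\<rparr>"

record 'a cstar = "(complex, 'a) module" +
  adj :: "'a \<Rightarrow> 'a"
  cnorm :: "'a \<Rightarrow> real"

text \<open>The value outside the carrier is irrelevant; it is set to 0 because
  \<^locale>\<open>Metric_space\<close> demands a nonnegative and symmetric function on the whole type.\<close>

definition cdist :: "'a cstar \<Rightarrow> 'a \<Rightarrow> 'a \<Rightarrow> real" where
  "cdist A x y = (if x \<in> carrier A \<and> y \<in> carrier A then cnorm A (x \<ominus>\<^bsub>A\<^esub> y) else 0)"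

text \<open>The zero algebra (with \<open>1 = 0\<close>) is admitted; this is why \<open>\<parallel>1\<parallel> = 1\<close> is not an axiom
  (it follows from the C*-identity in every nonzero algebra).\<close>

locale unital_cstar_algebra =
  ring A for A :: "'a cstar" (structure) +
  assumes complex_module: "module complex_ring A"
    and smult_mult_left:
      "\<lbrakk>x \<in> carrier A; y \<in> carrier A\<rbrakk> \<Longrightarrow> (c \<odot> x) \<otimes> y = c \<odot> (x \<otimes> y)"
    and smult_mult_right:
      "\<lbrakk>x \<in> carrier A; y \<in> carrier A\<rbrakk> \<Longrightarrow> x \<otimes> (c \<odot> y) = c \<odot> (x \<otimes> y)"
    and adj_closed: "x \<in> carrier A \<Longrightarrow> adj A x \<in> carrier A"
    and adj_adj: "x \<in> carrier A \<Longrightarrow> adj A (adj A x) = x"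
    and adj_add: "\<lbrakk>x \<in> carrier A; y \<in> carrier A\<rbrakk> \<Longrightarrow> adj A (x \<oplus> y) = adj A x \<oplus> adj A y"
    and adj_smult: "x \<in> carrier A \<Longrightarrow> adj A (c \<odot> x) = cnj c \<odot> adj A x"
    and adj_mult: "\<lbrakk>x \<in> carrier A; y \<in> carrier A\<rbrakk> \<Longrightarrow> adj A (x \<otimes> y) = adj A y \<otimes> adj A x"
    and cnorm_nonneg: "x \<in> carrier A \<Longrightarrow> 0 \<le> cnorm A x"
    and cnorm_eq_0: "x \<in> carrier A \<Longrightarrow> cnorm A x = 0 \<longleftrightarrow> x = \<zero>"
    and cnorm_triangle:
      "\<lbrakk>x \<in> carrier A; y \<in> carrier A\<rbrakk> \<Longrightarrow> cnorm A (x \<oplus> y) \<le> cnorm A x + cnorm A y"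
    and cnorm_smult: "x \<in> carrier A \<Longrightarrow> cnorm A (c \<odot> x) = cmod c * cnorm A x"
    and cnorm_mult:
      "\<lbrakk>x \<in> carrier A; y \<in> carrier A\<rbrakk> \<Longrightarrow> cnorm A (x \<otimes> y) \<le> cnorm A x * cnorm A y"
    and cnorm_adj_mult: "x \<in> carrier A \<Longrightarrow> cnorm A (adj A x \<otimes> x) = (cnorm A x)\<^sup>2"
    and complete: "Metric_space.mcomplete (carrier A) (cdist A)"

definition star_hom :: "'a cstar \<Rightarrow> 'b cstar \<Rightarrow> ('a \<Rightarrow> 'b) set" where
  "star_hom A B = {\<phi> \<in> Ring.ring_hom A B.
     (\<forall>c. \<forall>x \<in> carrier A. \<phi> (c \<odot>\<^bsub>A\<^esub> x) = c \<odot>\<^bsub>B\<^esub> \<phi> x) \<and>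
     (\<forall>x \<in> carrier A. \<phi> (adj A x) = adj B (\<phi> x))}"

definition cstar_subalgebra :: "'a set \<Rightarrow> 'a cstar \<Rightarrow> bool" where
  "cstar_subalgebra S A \<longleftrightarrow> subgroup S (add_monoid A) \<and> submonoid S A \<and>
     (\<forall>c. \<forall>x \<in> S. c \<odot>\<^bsub>A\<^esub> x \<in> S) \<and> (\<forall>x \<in> S. adj A x \<in> S) \<and>
     closedin (Metric_space.mtopology (carrier A) (cdist A)) S"

definition cstar_generated :: "'a cstar \<Rightarrow> 'a set \<Rightarrow> 'a set" where
  "cstar_generated A G = \<Inter> {S. cstar_subalgebra S A \<and> G \<subseteq> S}"

definition unitary_elem :: "'a cstar \<Rightarrow> 'a \<Rightarrow> bool" where
  "unitary_elem A x \<longleftrightarrow> x \<in> carrier A \<and>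
     adj A x \<otimes>\<^bsub>A\<^esub> x = \<one>\<^bsub>A\<^esub> \<and> x \<otimes>\<^bsub>A\<^esub> adj A x = \<one>\<^bsub>A\<^esub>"

section \<open>Rotation algebras\<close>

definition rotation_pair :: "real \<Rightarrow> 'a cstar \<Rightarrow> 'a \<Rightarrow> 'a \<Rightarrow> bool" where
  "rotation_pair \<theta> A u v \<longleftrightarrow> unitary_elem A u \<and> unitary_elem A v \<and>
     v \<otimes>\<^bsub>A\<^esub> u = exp (\<i> * of_real \<theta>) \<odot>\<^bsub>A\<^esub> (u \<otimes>\<^bsub>A\<^esub> v)"

text \<open>\<open>A\<close> with the generators \<open>u, v\<close> is the universal C*-algebra
  \<open>C*(u, v unitary | vu = exp(i \<theta>) uv)\<close>; the homomorphism \<open>\<phi>\<close> below is unique on the carrier because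
  \<open>u, v\<close> generate \<open>A\<close>. The universal property cannot quantify over types, so the test algebras \<open>B\<close> are
  those with a set of reals as carrier. This is no restriction: a C*-algebra generated by two
  elements has at most continuum many elements, so for a C*-algebra on any type that contains such
  a pair \<open>U, V\<close>, the subalgebra generated by \<open>U, V\<close> is isomorphic to such a \<open>B\<close>.\<close>

definition rotation_algebra :: "real \<Rightarrow> 'a cstar \<Rightarrow> 'a \<Rightarrow> 'a \<Rightarrow> bool" where
  "rotation_algebra \<theta> A u v \<longleftrightarrow>
     unital_cstar_algebra A \<and> rotation_pair \<theta> A u v \<and> cstar_generated A {u, v} = carrier A \<and>
     (\<forall>(B :: real cstar) U V. unital_cstar_algebra B \<and> rotation_pair \<theta> B U V \<longrightarrow>
        (\<exists>\<phi> \<in> star_hom A B. \<phi> u = U \<and> \<phi> v = V))"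

section \<open>Matrices over a C*-algebra\<close>

text \<open>The *-algebra \<open>M\<^sub>k(\<complex>) \<otimes> A = M\<^sub>k(A)\<close> equipped with a candidate norm \<open>N\<close>. There is exactly one \<open>N\<close>
  (up to values outside the carrier) that makes it a C*-algebra; this is the norm meant by
  \<open>M\<^sub>k(\<complex>) \<otimes> A\<close>.\<close>

definition matrix_algebra :: "nat \<Rightarrow> 'a cstar \<Rightarrow> ('a mat \<Rightarrow> real) \<Rightarrow> 'a mat cstar" where
  "matrix_algebra k A N =
    \<lparr>carrier = {X \<in> carrier_mat k k. \<forall>i<k. \<forall>j<k. X $$ (i, j) \<in> carrier A},
     monoid.mult = (\<lambda>X Y. mat k k (\<lambda>(i, j). \<Oplus>\<^bsub>A\<^esub>l\<in>{..<k}. X $$ (i, l) \<otimes>\<^bsub>A\<^esub> Y $$ (l, j))),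
     one = mat k k (\<lambda>(i, j). if i = j then \<one>\<^bsub>A\<^esub> else \<zero>\<^bsub>A\<^esub>),
     zero = mat k k (\<lambda>_. \<zero>\<^bsub>A\<^esub>),
     add = (\<lambda>X Y. mat k k (\<lambda>ij. X $$ ij \<oplus>\<^bsub>A\<^esub> Y $$ ij)),
     smult = (\<lambda>c. map_mat (\<lambda>x. c \<odot>\<^bsub>A\<^esub> x)),
     adj = (\<lambda>X. mat k k (\<lambda>(i, j). adj A (X $$ (j, i)))),
     cnorm = N\<rparr>"

definition mat_tensor :: "'a cstar \<Rightarrow> complex mat \<Rightarrow> 'a \<Rightarrow> 'a mat" where
  "mat_tensor A B x = map_mat (\<lambda>b. b \<odot>\<^bsub>A\<^esub> x) B"

end

theory Submission
  imports Defs
begin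

text \<open>Write \<open>\<delta> = \<theta>' - \<theta>\<close>. If \<open>U, V\<close> are unitary matrices with \<open>VU = e\<^sup>i\<^sup>\<delta> UV\<close> and \<open>\<xi>\<close> is a unit vector, then
  \<open>u\<^sub>\<theta> \<otimes> U, v\<^sub>\<theta> \<otimes> V\<close> is a pair of angle \<open>\<theta>'\<close>, and slicing with the vector state of \<open>\<xi>\<close> gives a completely
  contractive unital map sending \<open>u\<^sub>\<theta>\<^sub>', v\<^sub>\<theta>\<^sub>'\<close> to \<open>\<langle>U\<xi>,\<xi>\<rangle> u\<^sub>\<theta>, \<langle>V\<xi>,\<xi>\<rangle> v\<^sub>\<theta>\<close>. With clock and shift matrices
  and \<open>\<xi>\<close> a sine window of width about \<open>\<bar>\<delta>\<bar>\<^sup>-\<^sup>1\<^sup>/\<^sup>2\<close>, both scalars are real and \<open>1 - O(\<bar>\<delta>\<bar>)\<close>. Hence the norm of a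
  polynomial of degree one at \<open>\<theta>\<close> exceeds the one at \<open>\<theta>'\<close> by at most \<open>O(\<bar>\<delta>\<bar>)\<close>.

  Such \<open>U, V\<close> exist only for \<open>\<delta> \<in> 2\<pi>\<rat>\<close>. For general \<open>\<delta>\<close> take \<open>n \<times> n\<close> matrices for \<open>\<delta>\<^sub>n \<in> 2\<pi>\<int>/n\<close> with
  \<open>\<delta>\<^sub>n \<longlonglongrightarrow> \<delta>\<close> and map \<open>A\<^sub>\<theta>\<^sub>'\<close> to the quotient \<open>\<Prod> M\<^sub>k\<^sub>n(A\<^sub>\<theta>) / \<Oplus> M\<^sub>k\<^sub>n(A\<^sub>\<theta>)\<close>.\<close>

section \<open>Seminormed *-algebras\<close>

text \<open>Determinants show that matrices of size n with \<open>VU = e^(i \<delta>) UV\<close>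
  satisfy \<open>e^(i n \<delta>) = 1\<close>; this obstacle forces the approximation.

  The shape of the window matters. A sine window of width m loses O(1/m^2) under the shift and
  O((\<delta> m)^2) under the clock, and m of order \<open>|\<delta>|^(-1/2)\<close> balances the
  two. A constant window would lose 1/m under the shift, and no width would then give O(|\<delta>|).

  Norms are compared only through *-homomorphisms, which are contractive, and through products with
  elements of norm at most 1. So the slice is not taken with a state: \<xi> becomes the first column
  of a matrix W, and compression by W lands in a corner of the matrices of size nk over A at angle
  \<theta>. The norms there are those assumed for all matrix sizes.

  The universal property yields a homomorphism on the algebra of angle \<theta>' alone. The
  coefficient matrices enter through a representation of M_k(C) in the quotient that commutes with
  its image.\<close>

lemma complex_ring_simps [simp]:
  "carrier complex_ring = UNIV" "monoid.mult complex_ring = (*)" "one complex_ring = 1"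
  "zero complex_ring = 0" "add complex_ring = (+)"
  by (simp_all add: complex_ring_def)

lemma cring_complex_ring: "cring complex_ring"
proof (rule cringI)
  show "abelian_group complex_ring"
  proof (rule abelian_groupI)
    show "\<exists>y\<in>carrier complex_ring. y \<oplus>\<^bsub>complex_ring\<^esub> x = \<zero>\<^bsub>complex_ring\<^esub>" for x
      by (auto intro: exI[of _ "- x"])
  qed auto
  show "comm_monoid complex_ring"
    by (rule comm_monoidI) (auto simp: mult_ac)
qed (auto simp: algebra_simps)

text \<open>Definiteness and completeness are left out: the limsup on bounded sequences and the norm
  pulled back along a corner embedding are first known to satisfy just these laws. The C*-identity
  is kept, since it bounds isometries.\<close>

locale seminormed_star_algebra = ring A for A :: "'a cstar" (structure) +
  assumes complex_module: "module complex_ring A"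
    and smult_mult_left:
      "\<lbrakk>x \<in> carrier A; y \<in> carrier A\<rbrakk> \<Longrightarrow> (c \<odot> x) \<otimes> y = c \<odot> (x \<otimes> y)"
    and smult_mult_right:
      "\<lbrakk>x \<in> carrier A; y \<in> carrier A\<rbrakk> \<Longrightarrow> x \<otimes> (c \<odot> y) = c \<odot> (x \<otimes> y)"
    and adj_closed [simp, intro]: "x \<in> carrier A \<Longrightarrow> adj A x \<in> carrier A"
    and adj_adj: "x \<in> carrier A \<Longrightarrow> adj A (adj A x) = x"
    and adj_add: "\<lbrakk>x \<in> carrier A; y \<in> carrier A\<rbrakk> \<Longrightarrow> adj A (x \<oplus> y) = adj A x \<oplus> adj A y"
    and adj_smult: "x \<in> carrier A \<Longrightarrow> adj A (c \<odot> x) = cnj c \<odot> adj A x"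
    and adj_mult: "\<lbrakk>x \<in> carrier A; y \<in> carrier A\<rbrakk> \<Longrightarrow> adj A (x \<otimes> y) = adj A y \<otimes> adj A x"
    and cnorm_nonneg: "x \<in> carrier A \<Longrightarrow> 0 \<le> cnorm A x"
    and cnorm_triangle:
      "\<lbrakk>x \<in> carrier A; y \<in> carrier A\<rbrakk> \<Longrightarrow> cnorm A (x \<oplus> y) \<le> cnorm A x + cnorm A y"
    and cnorm_smult: "x \<in> carrier A \<Longrightarrow> cnorm A (c \<odot> x) = cmod c * cnorm A x"
    and cnorm_mult:
      "\<lbrakk>x \<in> carrier A; y \<in> carrier A\<rbrakk> \<Longrightarrow> cnorm A (x \<otimes> y) \<le> cnorm A x * cnorm A y"
    and cnorm_adj_mult: "x \<in> carrier A \<Longrightarrow> cnorm A (adj A x \<otimes> x) = (cnorm A x)\<^sup>2"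

text \<open>Additive inverses come from the scalar -1, so an instance has to supply only closure,
  identities and norm laws.\<close>

lemma seminormed_star_algebraI:
  fixes A :: "'a cstar" (structure)
  assumes closed: "\<zero> \<in> carrier A" "\<one> \<in> carrier A"
      "\<And>x y. x \<in> carrier A \<Longrightarrow> y \<in> carrier A \<Longrightarrow> x \<oplus> y \<in> carrier A"
      "\<And>x y. x \<in> carrier A \<Longrightarrow> y \<in> carrier A \<Longrightarrow> x \<otimes> y \<in> carrier A"
      "\<And>c x. x \<in> carrier A \<Longrightarrow> c \<odot> x \<in> carrier A"
      "\<And>x. x \<in> carrier A \<Longrightarrow> adj A x \<in> carrier A"
    and add: "\<And>x y z. x \<in> carrier A \<Longrightarrow> y \<in> carrier A \<Longrightarrow> z \<in> carrier A \<Longrightarrow> (x \<oplus> y) \<oplus> z = x \<oplus> (y \<oplus> z)"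
      "\<And>x y. x \<in> carrier A \<Longrightarrow> y \<in> carrier A \<Longrightarrow> x \<oplus> y = y \<oplus> x"
      "\<And>x. x \<in> carrier A \<Longrightarrow> \<zero> \<oplus> x = x"
      "\<And>x. x \<in> carrier A \<Longrightarrow> ((-1) \<odot> x) \<oplus> x = \<zero>"
    and mult: "\<And>x y z. x \<in> carrier A \<Longrightarrow> y \<in> carrier A \<Longrightarrow> z \<in> carrier A \<Longrightarrow> (x \<otimes> y) \<otimes> z = x \<otimes> (y \<otimes> z)"
      "\<And>x. x \<in> carrier A \<Longrightarrow> \<one> \<otimes> x = x"
      "\<And>x. x \<in> carrier A \<Longrightarrow> x \<otimes> \<one> = x"
      "\<And>x y z. x \<in> carrier A \<Longrightarrow> y \<in> carrier A \<Longrightarrow> z \<in> carrier A \<Longrightarrow> (x \<oplus> y) \<otimes> z = x \<otimes> z \<oplus> y \<otimes> z"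
      "\<And>x y z. x \<in> carrier A \<Longrightarrow> y \<in> carrier A \<Longrightarrow> z \<in> carrier A \<Longrightarrow> z \<otimes> (x \<oplus> y) = z \<otimes> x \<oplus> z \<otimes> y"
    and smult: "\<And>c d x. x \<in> carrier A \<Longrightarrow> (c + d) \<odot> x = c \<odot> x \<oplus> d \<odot> x"
      "\<And>c x y. x \<in> carrier A \<Longrightarrow> y \<in> carrier A \<Longrightarrow> c \<odot> (x \<oplus> y) = c \<odot> x \<oplus> c \<odot> y"
      "\<And>c d x. x \<in> carrier A \<Longrightarrow> (c * d) \<odot> x = c \<odot> (d \<odot> x)"
      "\<And>x. x \<in> carrier A \<Longrightarrow> 1 \<odot> x = x"
      "\<And>c x y. x \<in> carrier A \<Longrightarrow> y \<in> carrier A \<Longrightarrow> (c \<odot> x) \<otimes> y = c \<odot> (x \<otimes> y)"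
      "\<And>c x y. x \<in> carrier A \<Longrightarrow> y \<in> carrier A \<Longrightarrow> x \<otimes> (c \<odot> y) = c \<odot> (x \<otimes> y)"
    and adj: "\<And>x. x \<in> carrier A \<Longrightarrow> adj A (adj A x) = x"
      "\<And>x y. x \<in> carrier A \<Longrightarrow> y \<in> carrier A \<Longrightarrow> adj A (x \<oplus> y) = adj A x \<oplus> adj A y"
      "\<And>c x. x \<in> carrier A \<Longrightarrow> adj A (c \<odot> x) = cnj c \<odot> adj A x"
      "\<And>x y. x \<in> carrier A \<Longrightarrow> y \<in> carrier A \<Longrightarrow> adj A (x \<otimes> y) = adj A y \<otimes> adj A x"
    and norm: "\<And>x. x \<in> carrier A \<Longrightarrow> 0 \<le> cnorm A x"
      "\<And>x y. x \<in> carrier A \<Longrightarrow> y \<in> carrier A \<Longrightarrow> cnorm A (x \<oplus> y) \<le> cnorm A x + cnorm A y"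
      "\<And>c x. x \<in> carrier A \<Longrightarrow> cnorm A (c \<odot> x) = cmod c * cnorm A x"
      "\<And>x y. x \<in> carrier A \<Longrightarrow> y \<in> carrier A \<Longrightarrow> cnorm A (x \<otimes> y) \<le> cnorm A x * cnorm A y"
      "\<And>x. x \<in> carrier A \<Longrightarrow> cnorm A (adj A x \<otimes> x) = (cnorm A x)\<^sup>2"
  shows "seminormed_star_algebra A"
proof -
  have grp: "abelian_group A"
  proof (rule abelian_groupI)
    show "\<exists>y\<in>carrier A. y \<oplus> x = \<zero>" if "x \<in> carrier A" for x
      using closed(5)[OF that] add(4)[OF that] by blast
  qed (simp_all only: closed add(1) add(3), rule add(2))
  have monoid: "monoid A"
    by (rule monoidI) (simp_all only: closed mult)
  have ring: "ring A"
    by (rule ringI[OF grp monoid]) (simp_all only: mult)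
  have module: "module complex_ring A"
    by (rule moduleI[OF cring_complex_ring grp]) (simp_all only: complex_ring_simps closed smult)
  have "seminormed_star_algebra_axioms A"
    by (rule seminormed_star_algebra_axioms.intro)
      (rule module | erule (1) smult adj norm | erule closed smult adj norm)+
  with ring show ?thesis
    by (rule seminormed_star_algebra.intro)
qed

context seminormed_star_algebra
begin

lemma smult_closed [simp, intro]: "x \<in> carrier A \<Longrightarrow> c \<odot> x \<in> carrier A"
  using module.smult_closed[OF complex_module] by simp

lemma smult_l_distr: "x \<in> carrier A \<Longrightarrow> (c + d) \<odot> x = c \<odot> x \<oplus> d \<odot> x"
  using module.smult_l_distr[OF complex_module] by simp

lemma smult_r_distr: "\<lbrakk>x \<in> carrier A; y \<in> carrier A\<rbrakk> \<Longrightarrow> c \<odot> (x \<oplus> y) = c \<odot> x \<oplus> c \<odot> y"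
  using module.smult_r_distr[OF complex_module] by simp

lemma smult_smult: "x \<in> carrier A \<Longrightarrow> c \<odot> (d \<odot> x) = (c * d) \<odot> x"
  using module.smult_assoc1[OF complex_module] by simp

lemma smult_one [simp]: "x \<in> carrier A \<Longrightarrow> 1 \<odot> x = x"
  using module.smult_one[OF complex_module] by simp

lemma smult_zero_left [simp]: "x \<in> carrier A \<Longrightarrow> 0 \<odot> x = \<zero>"
  using smult_l_distr[of x 0 0] by (simp add: local.add.l_cancel_one)

lemma smult_zero_right [simp]: "c \<odot> \<zero> = \<zero>"
  using smult_smult[of \<zero> c 0] by simp

lemma smult_minus_one: "x \<in> carrier A \<Longrightarrow> (-1) \<odot> x = \<ominus> x"
  using smult_l_distr[of x "-1" 1] by (simp add: minus_equality)

lemmas star_algebra_simps = a_ac m_assoc l_distr r_distr l_neg r_neg smult_l_distr smult_r_distr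
  smult_smult smult_mult_left smult_mult_right smult_minus_one adj_adj adj_add adj_smult adj_mult
  cnorm_nonneg cnorm_triangle cnorm_smult cnorm_mult cnorm_adj_mult

lemma minus_smult: "\<lbrakk>x \<in> carrier A; y \<in> carrier A\<rbrakk> \<Longrightarrow> c \<odot> x \<ominus> c \<odot> y = c \<odot> (x \<ominus> y)"
  by (simp add: minus_eq smult_r_distr smult_smult flip: smult_minus_one)

lemma smult_minus: "x \<in> carrier A \<Longrightarrow> c \<odot> x \<ominus> d \<odot> x = (c - d) \<odot> x"
  using smult_l_distr[of x c "-d"] by (simp add: minus_eq smult_smult flip: smult_minus_one)

lemma adj_one [simp]: "adj A \<one> = \<one>"
  by (metis adj_adj adj_closed adj_mult l_one one_closed r_one)

lemma adj_uminus: "x \<in> carrier A \<Longrightarrow> adj A (\<ominus> x) = \<ominus> adj A x"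
  by (simp add: adj_smult flip: smult_minus_one)

lemma adj_minus: "\<lbrakk>x \<in> carrier A; y \<in> carrier A\<rbrakk> \<Longrightarrow> adj A (x \<ominus> y) = adj A x \<ominus> adj A y"
  by (simp add: minus_eq adj_add adj_uminus)

lemma cnorm_zero [simp]: "cnorm A \<zero> = 0"
  using cnorm_smult[of \<zero> 0] by simp

lemma cnorm_uminus: "x \<in> carrier A \<Longrightarrow> cnorm A (\<ominus> x) = cnorm A x"
  by (simp add: cnorm_smult flip: smult_minus_one)

lemma cnorm_minus_commute:
  "\<lbrakk>x \<in> carrier A; y \<in> carrier A\<rbrakk> \<Longrightarrow> cnorm A (x \<ominus> y) = cnorm A (y \<ominus> x)"
  by (metis a_minus_def add.inv_closed add.m_comm cnorm_uminus local.minus_add minus_closed minus_minus)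

lemma minus_eq_zero_iff: "\<lbrakk>x \<in> carrier A; y \<in> carrier A\<rbrakk> \<Longrightarrow> x \<ominus> y = \<zero> \<longleftrightarrow> x = y"
  by (metis a_minus_def add.inv_solve_right l_zero zero_closed)

lemma minus_triangle:
  assumes "x \<in> carrier A" "y \<in> carrier A" "z \<in> carrier A"
  shows "cnorm A (x \<ominus> z) \<le> cnorm A (x \<ominus> y) + cnorm A (y \<ominus> z)"
proof -
  have "x \<ominus> z = (x \<ominus> y) \<oplus> (y \<ominus> z)" using assms by algebra
  then show ?thesis using assms by (simp add: cnorm_triangle)
qed

lemma cnorm_le_minus:
  assumes "x \<in> carrier A" "y \<in> carrier A"
  shows "cnorm A x \<le> cnorm A (x \<ominus> y) + cnorm A y"
proof -
  have "x = (x \<ominus> y) \<oplus> y" using assms by algebra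
  then show ?thesis using assms by (metis cnorm_triangle minus_closed)
qed

text \<open>The C*-identity gives \<open>|y|^2 = |y* y| <= |y*| |y|\<close>; cancelling |y| gives
  one inequality, and the adjoint of y the other.\<close>

lemma cnorm_adj [simp]:
  assumes x: "x \<in> carrier A"
  shows "cnorm A (adj A x) = cnorm A x"
proof -
  have *: "cnorm A y \<le> cnorm A (adj A y)" if y: "y \<in> carrier A" for y
  proof (cases "cnorm A y = 0")
    case False
    have "(cnorm A y)\<^sup>2 \<le> cnorm A (adj A y) * cnorm A y"
      using cnorm_mult[of "adj A y" y] cnorm_adj_mult[OF y] y by simp
    then show ?thesis using False cnorm_nonneg[OF y] by (simp add: power2_eq_square)
  qed (use cnorm_nonneg y in auto)
  show ?thesis using *[OF x] *[of "adj A x"] x by (simp add: adj_adj)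
qed

text \<open>\<open>p = p* p\<close> turns the C*-identity into \<open>|p| = |p|^2\<close>. Equality
  with 1 cannot be claimed, as the seminorm of p may vanish.\<close>

lemma cnorm_le_one_if_projection:
  assumes "p \<in> carrier A" "adj A p \<otimes> p = p"
  shows "cnorm A p \<le> 1"
  using cnorm_adj_mult[OF assms(1)] assms(2) cnorm_nonneg[OF assms(1)]
  by (cases "cnorm A p = 0") (auto simp: power2_eq_square)

lemma cnorm_one_le: "cnorm A \<one> \<le> 1"
  by (rule cnorm_le_one_if_projection) auto

text \<open>One bound for all partial isometries in use: unitaries, matrix units and the compressing
  element built from the window.\<close>

lemma cnorm_le_one_if_isometry:
  assumes "x \<in> carrier A" "adj A x \<otimes> x = p" "adj A p \<otimes> p = p"
  shows "cnorm A x \<le> 1"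
proof -
  have "p \<in> carrier A" using assms by auto
  then have "(cnorm A x)\<^sup>2 \<le> 1"
    using cnorm_adj_mult[OF assms(1)] assms cnorm_le_one_if_projection[of p] by simp
  then show ?thesis by (simp add: power2_le_iff_abs_le abs_square_le_1 cnorm_nonneg[OF assms(1)])
qed

lemma cnorm_unitary_le: "unitary_elem A x \<Longrightarrow> cnorm A x \<le> 1"
  unfolding unitary_elem_def by (rule cnorm_le_one_if_isometry[of _ "\<one>"]) auto

lemma cnorm_mult_le:
  assumes "x \<in> carrier A" "y \<in> carrier A" "cnorm A x \<le> a" "cnorm A y \<le> b"
  shows "cnorm A (x \<otimes> y) \<le> a * b"
proof -
  have "cnorm A x * cnorm A y \<le> a * b"
    using assms cnorm_nonneg[of x] cnorm_nonneg[of y] by (intro mult_mono) auto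
  then show ?thesis using cnorm_mult[OF assms(1,2)] by linarith
qed

end

text \<open>Completeness is phrased with sequences because \<open>Metric_space\<close> does not
  apply to a seminorm. For a definite norm the two notions agree, by the sublocale and
  \<open>unital_cstar_algebraI\<close>.\<close>

locale seminormed_cstar_algebra = seminormed_star_algebra +
  assumes seq_complete: "\<lbrakk>\<And>i. X i \<in> carrier A;
      \<And>e. e > 0 \<Longrightarrow> \<exists>n. \<forall>i\<ge>n. \<forall>j\<ge>n. cnorm A (X i \<ominus> X j) < e\<rbrakk>
    \<Longrightarrow> \<exists>x\<in>carrier A. (\<lambda>i. cnorm A (X i \<ominus> x)) \<longlonglongrightarrow> 0"

lemma (in unital_cstar_algebra) seminormed_star_algebra: "seminormed_star_algebra A"
  by (rule seminormed_star_algebra.intro[OF ring_axioms], rule seminormed_star_algebra_axioms.intro)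
    (rule complex_module smult_mult_left smult_mult_right adj_closed adj_adj adj_add adj_smult
      adj_mult cnorm_nonneg cnorm_triangle cnorm_smult cnorm_mult cnorm_adj_mult; assumption)+

lemma (in unital_cstar_algebra) Metric_space_cdist: "Metric_space (carrier A) (cdist A)"
proof -
  interpret S: seminormed_star_algebra A by (rule seminormed_star_algebra)
  show ?thesis
    by unfold_locales
      (auto simp: cdist_def cnorm_nonneg S.cnorm_minus_commute cnorm_eq_0 S.minus_triangle S.minus_eq_zero_iff)
qed

sublocale unital_cstar_algebra \<subseteq> seminormed_cstar_algebra
proof -
  interpret S: seminormed_star_algebra A by (rule seminormed_star_algebra)
  interpret Metric_space "carrier A" "cdist A" by (rule Metric_space_cdist)
  show "seminormed_cstar_algebra A"
  proof unfold_locales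
    fix X :: "nat \<Rightarrow> 'a"
    assume X: "\<And>i. X i \<in> carrier A"
      and C: "\<And>e. e > 0 \<Longrightarrow> \<exists>n. \<forall>i\<ge>n. \<forall>j\<ge>n. cnorm A (X i \<ominus> X j) < e"
    have "MCauchy X"
      unfolding MCauchy_def using X C by (auto simp: cdist_def)
    then obtain x where "limitin mtopology X x sequentially"
      using complete by (auto simp: mcomplete_def)
    then show "\<exists>x\<in>carrier A. (\<lambda>i. cnorm A (X i \<ominus> x)) \<longlonglongrightarrow> 0"
      using X by (auto simp: limitin_metric_dist_null cdist_def)
  qed
qed

lemma (in seminormed_cstar_algebra) unital_cstar_algebraI:
  assumes "\<And>x. x \<in> carrier A \<Longrightarrow> cnorm A x = 0 \<Longrightarrow> x = \<zero>"
  shows "unital_cstar_algebra A"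
proof -
  have eq_0: "cnorm A x = 0 \<longleftrightarrow> x = \<zero>" if "x \<in> carrier A" for x
    using assms that by auto
  interpret Metric_space "carrier A" "cdist A"
  proof
    show "(cdist A x y = 0) = (x = y)" if "x \<in> carrier A" "y \<in> carrier A" for x y
      using that by (simp add: cdist_def eq_0 minus_eq_zero_iff)
  qed (auto simp: cdist_def cnorm_nonneg cnorm_minus_commute minus_triangle)
  have "mcomplete"
    unfolding mcomplete_def
  proof (intro allI impI)
    fix X :: "nat \<Rightarrow> 'a"
    assume C: "MCauchy X"
    then have X: "X i \<in> carrier A" for i by (auto simp: MCauchy_def)
    have "\<exists>x\<in>carrier A. (\<lambda>i. cnorm A (X i \<ominus> x)) \<longlonglongrightarrow> 0"
      using C X by (intro seq_complete) (auto simp: MCauchy_def cdist_def)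
    then show "\<exists>x. limitin mtopology X x sequentially"
      using X by (auto simp: limitin_metric_dist_null cdist_def)
  qed
  show ?thesis
    by (rule unital_cstar_algebra.intro[OF ring_axioms], rule unital_cstar_algebra_axioms.intro)
      (rule complex_module smult_mult_left smult_mult_right adj_closed adj_adj adj_add adj_smult
        adj_mult cnorm_nonneg eq_0 cnorm_triangle cnorm_smult cnorm_mult cnorm_adj_mult \<open>mcomplete\<close>;
       assumption)+
qed

section \<open>Contractivity of *-homomorphisms\<close>

context unital_cstar_algebra
begin

lemma eq_if_cnorm_minus_le_null_sequence:
  assumes "x \<in> carrier A" "y \<in> carrier A" "b \<longlonglongrightarrow> 0" "\<And>n. cnorm A (x \<ominus> y) \<le> b n"
  shows "x = y"
proof -
  have "cnorm A (x \<ominus> y) \<le> 0"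
    using assms(3,4) by (intro LIMSEQ_le_const) auto
  then show ?thesis
    using assms(1,2) cnorm_nonneg[of "x \<ominus> y"] cnorm_eq_0[of "x \<ominus> y"] minus_eq_zero_iff by simp
qed

text \<open>The fixed point is \<open>1 - sqrt (1 - a)\<close>.\<close>

lemma ex_half_fixpoint:
  assumes a: "a \<in> carrier A" "adj A a = a" "cnorm A a < 1"
    and x: "x \<in> carrier A" "x \<otimes> a = a \<otimes> x"
  obtains w where "w \<in> carrier A" "adj A w = w" "x \<otimes> w = w \<otimes> x" "w = (1/2) \<odot> (a \<oplus> w \<otimes> w)"
proof -
  define f where "f w = (1/2) \<odot> (a \<oplus> w \<otimes> w)" for w
  define W where "W n = (f ^^ n) \<zero>" for n
  \<comment> \<open>The smaller root of \<open>t = (|a| + t^2) / 2\<close>. The iterates stay in the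
    ball of radius \<rho>, on which f is \<rho>-Lipschitz, and \<rho> < 1 because |a| < 1.\<close>
  define \<rho> where "\<rho> = 1 - sqrt (1 - cnorm A a)"
  have \<rho>: "0 \<le> \<rho>" "\<rho> < 1" "(cnorm A a + \<rho>\<^sup>2) / 2 = \<rho>"
    using a cnorm_nonneg[of a] by (auto simp: \<rho>_def power2_eq_square field_simps)
  have W0: "W 0 = \<zero>" and WS: "W (Suc n) = f (W n)" for n by (simp_all add: W_def)
  have f_closed: "f y \<in> carrier A" if "y \<in> carrier A" for y
    using that a by (simp add: f_def)
  have W: "W n \<in> carrier A" for n
    by (induction n) (auto simp: W0 WS f_closed)
  have W_le: "cnorm A (W n) \<le> \<rho>" for n
  proof (induction n)
    case (Suc n)
    have "cnorm A (a \<oplus> W n \<otimes> W n) \<le> cnorm A a + \<rho> * \<rho>"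
      using cnorm_triangle[of a "W n \<otimes> W n"] cnorm_mult_le[OF W W Suc Suc] a W by force
    then have "cnorm A (W (Suc n)) \<le> (cnorm A a + \<rho>\<^sup>2) / 2"
      using a W by (simp add: WS f_def cnorm_smult power2_eq_square norm_divide)
    then show ?case using \<rho> by simp
  qed (simp add: W0 \<rho>)
  have W_adj: "adj A (W n) = W n" for n
  proof (induction n)
    case 0
    show ?case using adj_smult[of \<zero> 0] by (simp add: W0)
  qed (use a W in \<open>simp add: WS f_def adj_smult adj_add adj_mult\<close>)
  have W_comm: "x \<otimes> W n = W n \<otimes> x" for n
  proof (induction n)
    case (Suc n)
    have "x \<otimes> (W n \<otimes> W n) = W n \<otimes> W n \<otimes> x"
      using W x by (metis Suc m_assoc)
    then show ?case
      using a W x by (simp add: WS f_def smult_mult_left smult_mult_right r_distr l_distr)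
  qed (use x in \<open>simp add: W0\<close>)
  have f_diff: "cnorm A (f y \<ominus> f z) \<le> (cnorm A y + cnorm A z) / 2 * cnorm A (y \<ominus> z)"
    if yz: "y \<in> carrier A" "z \<in> carrier A" for y z
  proof -
    have "(a \<oplus> y \<otimes> y) \<ominus> (a \<oplus> z \<otimes> z) = y \<otimes> (y \<ominus> z) \<oplus> (y \<ominus> z) \<otimes> z"
      using a yz by algebra
    then have "f y \<ominus> f z = (1/2) \<odot> (y \<otimes> (y \<ominus> z) \<oplus> (y \<ominus> z) \<otimes> z)"
      using a yz by (simp add: f_def minus_smult)
    then have "cnorm A (f y \<ominus> f z) = cnorm A (y \<otimes> (y \<ominus> z) \<oplus> (y \<ominus> z) \<otimes> z) / 2"
      using yz by (simp add: cnorm_smult norm_divide)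
    also have "\<dots> \<le> (cnorm A y * cnorm A (y \<ominus> z) + cnorm A (y \<ominus> z) * cnorm A z) / 2"
      using yz cnorm_triangle[of "y \<otimes> (y \<ominus> z)" "(y \<ominus> z) \<otimes> z"]
        cnorm_mult[of y "y \<ominus> z"] cnorm_mult[of "y \<ominus> z" z] by fastforce
    finally show ?thesis by (simp add: algebra_simps)
  qed
  have W_diff: "cnorm A (W (n + m) \<ominus> W n) \<le> \<rho> ^ n" for n m
  proof (induction n)
    case 0
    have "W m \<ominus> \<zero> = W m" using W by (simp add: minus_eq)
    then show ?case using W_le[of m] \<rho> by (simp add: W0)
  next
    case (Suc n)
    have "cnorm A (W (Suc n + m) \<ominus> W (Suc n)) \<le> (cnorm A (W (n + m)) + cnorm A (W n)) / 2 * cnorm A (W (n + m) \<ominus> W n)"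
      using f_diff[OF W W] by (simp add: WS)
    also have "\<dots> \<le> \<rho> * \<rho> ^ n"
      using W_le[of "n + m"] W_le[of n] Suc \<rho> cnorm_nonneg[OF W]
      by (intro mult_mono) (auto intro!: cnorm_nonneg W)
    finally show ?case by simp
  qed
  have "\<exists>w\<in>carrier A. (\<lambda>n. cnorm A (W n \<ominus> w)) \<longlonglongrightarrow> 0"
  proof (rule seq_complete)
    fix e :: real
    assume "e > 0"
    then obtain N where N: "\<rho> ^ N < e" using \<rho> real_arch_pow_inv by blast
    show "\<exists>n. \<forall>i\<ge>n. \<forall>j\<ge>n. cnorm A (W i \<ominus> W j) < e"
    proof (intro exI allI impI)
      have *: "cnorm A (W i \<ominus> W j) < e" if "N \<le> j" "j \<le> i" for i j
      proof -
        have "cnorm A (W i \<ominus> W j) \<le> \<rho> ^ j" using W_diff[of j "i - j"] that by simp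
        also have "\<dots> \<le> \<rho> ^ N" using \<rho> that by (intro power_decreasing) auto
        finally show ?thesis using N by simp
      qed
      show "cnorm A (W i \<ominus> W j) < e" if "N \<le> i" "N \<le> j" for i j
        using *[of i j] *[of j i] that cnorm_minus_commute[OF W W, of i j] by (cases "i \<le> j") auto
    qed
  qed (rule W)
  then obtain w where w: "w \<in> carrier A" and lim: "(\<lambda>n. cnorm A (W n \<ominus> w)) \<longlonglongrightarrow> 0" by blast
  have "adj A w = w"
  proof (rule eq_if_cnorm_minus_le_null_sequence)
    show "(\<lambda>n. cnorm A (W n \<ominus> w) + cnorm A (W n \<ominus> w)) \<longlonglongrightarrow> 0"
      using tendsto_add[OF lim lim] by simp
    fix n
    have "cnorm A (adj A w \<ominus> w) \<le> cnorm A (adj A w \<ominus> adj A (W n)) + cnorm A (W n \<ominus> w)"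
      using minus_triangle[of "adj A w" "W n" w] w W by (simp add: W_adj)
    also have "cnorm A (adj A w \<ominus> adj A (W n)) = cnorm A (W n \<ominus> w)"
      using w W by (simp add: adj_minus[symmetric] cnorm_minus_commute[of w])
    finally show "cnorm A (adj A w \<ominus> w) \<le> cnorm A (W n \<ominus> w) + cnorm A (W n \<ominus> w)" .
  qed (use w in auto)
  moreover have "x \<otimes> w = w \<otimes> x"
  proof (rule eq_if_cnorm_minus_le_null_sequence)
    show "(\<lambda>n. cnorm A x * cnorm A (W n \<ominus> w) + cnorm A (W n \<ominus> w) * cnorm A x) \<longlonglongrightarrow> 0"
      using tendsto_add[OF tendsto_mult_left[OF lim, of "cnorm A x"] tendsto_mult_right[OF lim, of "cnorm A x"]] by simp
    fix n
    \<comment> \<open>The commutator with the limit is split at \<open>W n\<close>, whose own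
      commutator with x is zero.\<close>
    have "x \<otimes> w \<ominus> w \<otimes> x = x \<otimes> (w \<ominus> W n) \<oplus> (x \<otimes> W n \<ominus> W n \<otimes> x) \<oplus> (W n \<ominus> w) \<otimes> x"
      using w W[of n] x by algebra
    also have "\<dots> = x \<otimes> (w \<ominus> W n) \<oplus> (W n \<ominus> w) \<otimes> x"
      using w W[of n] x W_comm[of n] by (simp add: minus_eq_zero_iff)
    finally have "cnorm A (x \<otimes> w \<ominus> w \<otimes> x) \<le> cnorm A (x \<otimes> (w \<ominus> W n)) + cnorm A ((W n \<ominus> w) \<otimes> x)"
      using w W[of n] x by (simp add: cnorm_triangle)
    also have "\<dots> \<le> cnorm A x * cnorm A (w \<ominus> W n) + cnorm A (W n \<ominus> w) * cnorm A x"
      using w W[of n] x by (intro add_mono cnorm_mult) auto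
    finally show "cnorm A (x \<otimes> w \<ominus> w \<otimes> x) \<le> cnorm A x * cnorm A (W n \<ominus> w) + cnorm A (W n \<ominus> w) * cnorm A x"
      using w W by (simp add: cnorm_minus_commute[of w])
  qed (use w x in auto)
  moreover have "w = f w"
  proof (rule eq_if_cnorm_minus_le_null_sequence)
    show "(\<lambda>n. cnorm A (W (Suc n) \<ominus> w) + (1 + cnorm A w) * cnorm A (W n \<ominus> w)) \<longlonglongrightarrow> 0"
      using tendsto_add[OF LIMSEQ_Suc[OF lim] tendsto_mult_left[OF lim, of "1 + cnorm A w"]] by simp
    fix n
    have "cnorm A (w \<ominus> f w) \<le> cnorm A (w \<ominus> W (Suc n)) + cnorm A (W (Suc n) \<ominus> f w)"
      using minus_triangle w W f_closed by blast
    also have "cnorm A (w \<ominus> W (Suc n)) = cnorm A (W (Suc n) \<ominus> w)"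
      using w W by (rule cnorm_minus_commute)
    also have "cnorm A (W (Suc n) \<ominus> f w) \<le> (cnorm A (W n) + cnorm A w) / 2 * cnorm A (W n \<ominus> w)"
      using f_diff[OF W w] by (simp add: WS)
    also have "\<dots> \<le> (1 + cnorm A w) * cnorm A (W n \<ominus> w)"
      using W_le[of n] \<rho> cnorm_nonneg[OF w] w W
      by (intro mult_right_mono cnorm_nonneg) (auto simp: field_simps)
    finally show "cnorm A (w \<ominus> f w) \<le> cnorm A (W (Suc n) \<ominus> w) + (1 + cnorm A w) * cnorm A (W n \<ominus> w)"
      by simp
  qed (use w f_closed in auto)
  ultimately show thesis using that w by (auto simp: f_def)
qed

text \<open>The fixed point for \<open>a = x^2\<close> is \<open>w = 1 - sqrt (1 - x^2)\<close>.
  Hence \<open>y = 1 - w\<close> is a self-adjoint root of \<open>1 - x^2\<close> that commutes with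
  x, and \<open>z = x + i y\<close> has real part x and \<open>z* z = x^2 + y^2 = 1\<close>.\<close>

lemma selfadjoint_eq_average_unitary:
  assumes x: "x \<in> carrier A" "adj A x = x" "cnorm A x < 1"
  obtains z where "z \<in> carrier A" "adj A z \<otimes> z = \<one>" "x = (1/2) \<odot> (z \<oplus> adj A z)"
proof -
  define a where "a = x \<otimes> x"
  have "(cnorm A x)\<^sup>2 < 1"
    using x cnorm_nonneg[of x] by (simp add: abs_square_less_1)
  then have "cnorm A (x \<otimes> x) < 1"
    using cnorm_adj_mult[of x] x by simp
  then have a: "a \<in> carrier A" "adj A a = a" "cnorm A a < 1" "x \<otimes> a = a \<otimes> x"
    using x by (simp_all add: a_def adj_mult m_assoc)
  obtain w where w: "w \<in> carrier A" "adj A w = w" "x \<otimes> w = w \<otimes> x" "w = (1/2) \<odot> (a \<oplus> w \<otimes> w)"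
    using ex_half_fixpoint[OF a(1-3) x(1) a(4)] .
  define y where "y = \<one> \<ominus> w"
  have y: "y \<in> carrier A" "adj A y = y" using w by (simp_all add: y_def adj_minus)
  \<comment> \<open>The fixed-point equation doubled; it replaces \<open>w + w\<close> in the
    expansion of \<open>(1 - w)^2\<close> and leaves \<open>1 - a\<close>.\<close>
  have ww: "w \<oplus> w = a \<oplus> w \<otimes> w"
  proof -
    have "w \<oplus> w = (1/2 + 1/2) \<odot> (a \<oplus> w \<otimes> w)"
      using w a by (metis add.m_closed m_closed smult_l_distr)
    then show ?thesis using a w by simp
  qed
  have "y \<otimes> y = \<one> \<ominus> (w \<oplus> w) \<oplus> w \<otimes> w" 
    using w(1) by (simp add: y_def minus_eq l_distr r_distr l_minus r_minus minus_add a_assoc)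
  also have "\<dots> = \<one> \<ominus> a" unfolding ww using w(1) a(1) by algebra
  finally have yy: "x \<otimes> x \<oplus> y \<otimes> y = \<one>" using a x unfolding a_def[symmetric] by (simp, algebra)
  have xy: "x \<otimes> y = y \<otimes> x"
    using w x by (simp add: y_def minus_eq r_distr l_distr r_minus l_minus)
  define z where "z = x \<oplus> \<i> \<odot> y"
  have z: "z \<in> carrier A" "adj A z = x \<oplus> (- \<i>) \<odot> y"
    using x y by (simp_all add: z_def adj_add adj_smult)
  have "adj A z \<otimes> z = x \<otimes> x \<oplus> \<i> \<odot> (x \<otimes> y) \<oplus> ((- \<i>) \<odot> (x \<otimes> y) \<oplus> y \<otimes> y)"
    unfolding z(2) unfolding z_def using x y
    by (simp add: l_distr r_distr smult_mult_left smult_mult_right smult_smult smult_r_distr xy a_ac)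
  also have "\<dots> = x \<otimes> x \<oplus> y \<otimes> y \<oplus> (\<i> + (- \<i>)) \<odot> (x \<otimes> y)"
    unfolding smult_l_distr[OF m_closed[OF x(1) y(1)]] using x y by (simp add: a_assoc a_comm a_lcomm)
  finally have "adj A z \<otimes> z = \<one>" using x y by (simp add: yy)
  moreover have "x = (1/2) \<odot> (z \<oplus> adj A z)"
  proof -
    have "z \<oplus> adj A z = (1 + 1) \<odot> x \<oplus> (\<i> + (- \<i>)) \<odot> y"
      unfolding smult_l_distr[OF x(1)] smult_l_distr[OF y(1)] z(2) unfolding z_def
      using x y by (simp add: a_ac)
    then show ?thesis using x y by (simp add: smult_smult)
  qed
  ultimately show thesis using that z by blast
qed

end

lemma star_homE:
  assumes "\<phi> \<in> star_hom A B"
  shows "\<phi> \<in> ring_hom A B"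
    and "x \<in> carrier A \<Longrightarrow> \<phi> x \<in> carrier B"
    and "x \<in> carrier A \<Longrightarrow> y \<in> carrier A \<Longrightarrow> \<phi> (x \<otimes>\<^bsub>A\<^esub> y) = \<phi> x \<otimes>\<^bsub>B\<^esub> \<phi> y"
    and "x \<in> carrier A \<Longrightarrow> y \<in> carrier A \<Longrightarrow> \<phi> (x \<oplus>\<^bsub>A\<^esub> y) = \<phi> x \<oplus>\<^bsub>B\<^esub> \<phi> y"
    and "\<phi> \<one>\<^bsub>A\<^esub> = \<one>\<^bsub>B\<^esub>"
    and "x \<in> carrier A \<Longrightarrow> \<phi> (c \<odot>\<^bsub>A\<^esub> x) = c \<odot>\<^bsub>B\<^esub> \<phi> x"
    and "x \<in> carrier A \<Longrightarrow> \<phi> (adj A x) = adj B (\<phi> x)"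
  using assms by (auto simp: star_hom_def ring_hom_def)

lemma star_homI:
  assumes "\<And>x. x \<in> carrier A \<Longrightarrow> \<phi> x \<in> carrier B"
    and "\<And>x y. x \<in> carrier A \<Longrightarrow> y \<in> carrier A \<Longrightarrow> \<phi> (x \<otimes>\<^bsub>A\<^esub> y) = \<phi> x \<otimes>\<^bsub>B\<^esub> \<phi> y"
    and "\<And>x y. x \<in> carrier A \<Longrightarrow> y \<in> carrier A \<Longrightarrow> \<phi> (x \<oplus>\<^bsub>A\<^esub> y) = \<phi> x \<oplus>\<^bsub>B\<^esub> \<phi> y"
    and "\<phi> \<one>\<^bsub>A\<^esub> = \<one>\<^bsub>B\<^esub>"
    and "\<And>c x. x \<in> carrier A \<Longrightarrow> \<phi> (c \<odot>\<^bsub>A\<^esub> x) = c \<odot>\<^bsub>B\<^esub> \<phi> x"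
    and "\<And>x. x \<in> carrier A \<Longrightarrow> \<phi> (adj A x) = adj B (\<phi> x)"
  shows "\<phi> \<in> star_hom A B"
  using assms by (auto simp: star_hom_def ring_hom_def)

lemma star_hom_comp:
  "\<phi> \<in> star_hom A B \<Longrightarrow> \<psi> \<in> star_hom B C \<Longrightarrow> \<psi> \<circ> \<phi> \<in> star_hom A C"
  by (rule star_homI) (simp_all add: star_homE(2-))

text \<open>A self-adjoint element of norm less than 1 is the real part of a unitary, a property that
  homomorphisms preserve.\<close>

lemma star_hom_contractive:
  assumes A: "unital_cstar_algebra A" and B: "seminormed_star_algebra B"
    and \<phi>: "\<phi> \<in> star_hom A B" and x: "x \<in> carrier A"
  shows "cnorm B (\<phi> x) \<le> cnorm A x"
proof -
  interpret A: unital_cstar_algebra A by fact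
  interpret B: seminormed_star_algebra B by fact
  note \<phi>E = star_homE(2-)[OF \<phi>]
  have unit: "cnorm B (\<phi> h) \<le> 1" if h: "h \<in> carrier A" "adj A h = h" "cnorm A h < 1" for h
  proof -
    obtain z where z: "z \<in> carrier A" "adj A z \<otimes>\<^bsub>A\<^esub> z = \<one>\<^bsub>A\<^esub>" "h = (1/2) \<odot>\<^bsub>A\<^esub> (z \<oplus>\<^bsub>A\<^esub> adj A z)"
      using A.selfadjoint_eq_average_unitary[OF h] .
    have "adj B (\<phi> z) \<otimes>\<^bsub>B\<^esub> \<phi> z = \<one>\<^bsub>B\<^esub>"
      using z by (metis A.adj_closed \<phi>E(2,4,6))
    then have "cnorm B (\<phi> z) \<le> 1"
      using z \<phi>E(1) by (intro B.cnorm_le_one_if_isometry) auto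
    moreover have "cnorm B (\<phi> h) \<le> (cnorm B (\<phi> z) + cnorm B (adj B (\<phi> z))) / 2"
      using z(1) \<phi>E(1)[OF z(1)] B.cnorm_triangle[of "\<phi> z" "adj B (\<phi> z)"]
      by (simp add: z(3) \<phi>E B.cnorm_smult norm_divide)
    ultimately show ?thesis using \<phi>E(1)[OF z(1)] by simp
  qed
  \<comment> \<open>The C*-identity, used in both algebras, reduces the claim to this self-adjoint
    element.\<close>
  define h where "h = adj A x \<otimes>\<^bsub>A\<^esub> x"
  have h: "h \<in> carrier A" "adj A h = h"
    using x by (simp_all add: h_def A.adj_mult A.adj_adj)
  have "cnorm B (\<phi> h) \<le> cnorm A h"
  proof (rule field_le_epsilon)
    fix e :: real
    assume e: "e > 0"
    \<comment> \<open>Every t above the norm of h scales it into the open unit ball, where it is a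
      real part of the required kind; then e tends to 0.\<close>
    define t where "t = cnorm A h + e"
    have t: "t > 0" "cnorm A h < t" using e A.cnorm_nonneg[OF h(1)] by (auto simp: t_def)
    have "cnorm B (\<phi> (complex_of_real (1/t) \<odot>\<^bsub>A\<^esub> h)) \<le> 1"
      using t h by (intro unit) (auto simp: A.adj_smult A.cnorm_smult norm_divide)
    then have "cnorm B (\<phi> h) / t \<le> 1"
      using t h \<phi>E(1)[OF h(1)] by (simp add: \<phi>E B.cnorm_smult norm_divide)
    then show "cnorm B (\<phi> h) \<le> cnorm A h + e"
      using t by (simp add: t_def)
  qed
  then have "(cnorm B (\<phi> x))\<^sup>2 \<le> (cnorm A x)\<^sup>2"
    using x \<phi>E(1)[OF x] by (simp add: h_def \<phi>E A.cnorm_adj_mult B.cnorm_adj_mult)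
  then show ?thesis using A.cnorm_nonneg[OF x] by (rule power2_le_imp_le)
qed

section \<open>Quotients and the universal property over arbitrary types\<close>

lemma star_hom_minus:
  assumes A: "seminormed_star_algebra A" and B: "seminormed_star_algebra B"
    and \<phi>: "\<phi> \<in> star_hom A B" and "x \<in> carrier A" "y \<in> carrier A"
  shows "\<phi> (x \<ominus>\<^bsub>A\<^esub> y) = \<phi> x \<ominus>\<^bsub>B\<^esub> \<phi> y"
proof -
  interpret A: seminormed_star_algebra A by fact
  interpret B: seminormed_star_algebra B by fact
  show ?thesis
    using assms(4,5) star_homE(2-)[OF \<phi>]
    by (simp add: A.minus_eq B.minus_eq flip: A.smult_minus_one B.smult_minus_one)
qed

text \<open>Only the fibres of q matter. With q the class map this is the quotient by the null
  elements; with q injective it copies the algebra to another type. Chosen representatives make both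
  cases one construction.\<close>

definition pushforward_cstar :: "'a cstar \<Rightarrow> ('a \<Rightarrow> 'b) \<Rightarrow> 'b cstar" where
  "pushforward_cstar A q = (let r = inv_into (carrier A) q in
    \<lparr>carrier = q ` carrier A,
     monoid.mult = (\<lambda>x y. q (r x \<otimes>\<^bsub>A\<^esub> r y)),
     one = q \<one>\<^bsub>A\<^esub>,
     zero = q \<zero>\<^bsub>A\<^esub>,
     add = (\<lambda>x y. q (r x \<oplus>\<^bsub>A\<^esub> r y)),
     smult = (\<lambda>c x. q (c \<odot>\<^bsub>A\<^esub> r x)),
     adj = (\<lambda>x. q (adj A (r x))),
     cnorm = (\<lambda>x. cnorm A (r x))\<rparr>)"

locale cstar_quotient_map = seminormed_cstar_algebra A for A :: "'a cstar" (structure) +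
  fixes q :: "'a \<Rightarrow> 'b"
  assumes q_eq_iff: "\<lbrakk>x \<in> carrier A; y \<in> carrier A\<rbrakk> \<Longrightarrow> q x = q y \<longleftrightarrow> cnorm A (x \<ominus> y) = 0"
begin

abbreviation B :: "'b cstar" where "B \<equiv> pushforward_cstar A q"

lemma representative:
  assumes "x \<in> carrier A"
  shows "inv_into (carrier A) q (q x) \<in> carrier A"
    and "cnorm A (inv_into (carrier A) q (q x) \<ominus> x) = 0"
proof -
  show "inv_into (carrier A) q (q x) \<in> carrier A"
    using assms by (simp add: inv_into_into)
  then show "cnorm A (inv_into (carrier A) q (q x) \<ominus> x) = 0"
    using assms by (simp add: f_inv_into_f flip: q_eq_iff)
qed

lemma q_eqI: "\<lbrakk>x \<in> carrier A; y \<in> carrier A; cnorm A (x \<ominus> y) \<le> 0\<rbrakk> \<Longrightarrow> q x = q y"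
  using cnorm_nonneg[of "x \<ominus> y"] q_eq_iff by fastforce

lemma carrier_B: "carrier B = q ` carrier A"
  and one_B: "\<one>\<^bsub>B\<^esub> = q \<one>" and zero_B: "\<zero>\<^bsub>B\<^esub> = q \<zero>"
  by (simp_all add: pushforward_cstar_def Let_def)

text \<open>A null element times any element is null, so the product does not depend on the
  representatives.\<close>

lemma mult_B:
  assumes x: "x \<in> carrier A" and y: "y \<in> carrier A"
  shows "q x \<otimes>\<^bsub>B\<^esub> q y = q (x \<otimes> y)"
proof -
  obtain x' y' where x': "x' = inv_into (carrier A) q (q x)" and y': "y' = inv_into (carrier A) q (q y)" by blast
  note rx = representative[OF x, folded x'] and ry = representative[OF y, folded y']
  have "x' \<otimes> y' \<ominus> x \<otimes> y = x' \<otimes> (y' \<ominus> y) \<oplus> (x' \<ominus> x) \<otimes> y"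
    using rx(1) ry(1) x y by algebra
  then have "cnorm A (x' \<otimes> y' \<ominus> x \<otimes> y) \<le> cnorm A (x' \<otimes> (y' \<ominus> y)) + cnorm A ((x' \<ominus> x) \<otimes> y)"
    using rx(1) ry(1) x y by (simp add: cnorm_triangle)
  also have "\<dots> \<le> cnorm A x' * 0 + 0 * cnorm A y"
    using rx ry x y by (intro add_mono cnorm_mult_le) auto
  finally have "q (x' \<otimes> y') = q (x \<otimes> y)"
    using rx(1) ry(1) x y by (intro q_eqI) auto
  then show ?thesis by (simp add: pushforward_cstar_def Let_def x' y')
qed

lemma add_B:
  assumes x: "x \<in> carrier A" and y: "y \<in> carrier A"
  shows "q x \<oplus>\<^bsub>B\<^esub> q y = q (x \<oplus> y)"
proof -
  obtain x' y' where x': "x' = inv_into (carrier A) q (q x)" and y': "y' = inv_into (carrier A) q (q y)" by blast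
  note rx = representative[OF x, folded x'] and ry = representative[OF y, folded y']
  have "(x' \<oplus> y') \<ominus> (x \<oplus> y) = (x' \<ominus> x) \<oplus> (y' \<ominus> y)"
    using rx(1) ry(1) x y by algebra
  then have "cnorm A ((x' \<oplus> y') \<ominus> (x \<oplus> y)) \<le> cnorm A (x' \<ominus> x) + cnorm A (y' \<ominus> y)"
    using rx(1) ry(1) x y by (simp add: cnorm_triangle)
  then have "q (x' \<oplus> y') = q (x \<oplus> y)"
    using rx ry x y by (intro q_eqI) auto
  then show ?thesis by (simp add: pushforward_cstar_def Let_def x' y')
qed

lemma smult_B:
  assumes x: "x \<in> carrier A"
  shows "c \<odot>\<^bsub>B\<^esub> q x = q (c \<odot> x)"
proof -
  obtain x' where x': "x' = inv_into (carrier A) q (q x)" by blast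
  note rx = representative[OF x, folded x']
  have "q (c \<odot> x') = q (c \<odot> x)"
    using rx x by (intro q_eqI) (auto simp: minus_smult cnorm_smult)
  then show ?thesis by (simp add: pushforward_cstar_def Let_def x')
qed

lemma adj_B:
  assumes x: "x \<in> carrier A"
  shows "adj B (q x) = q (adj A x)"
proof -
  obtain x' where x': "x' = inv_into (carrier A) q (q x)" by blast
  note rx = representative[OF x, folded x']
  have "q (adj A x') = q (adj A x)"
    using rx x by (intro q_eqI) (auto simp flip: adj_minus)
  then show ?thesis by (simp add: pushforward_cstar_def Let_def x')
qed

lemma cnorm_B:
  assumes x: "x \<in> carrier A"
  shows "cnorm B (q x) = cnorm A x"
proof -
  obtain x' where x': "x' = inv_into (carrier A) q (q x)" by blast
  note rx = representative[OF x, folded x']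
  have "cnorm A x' = cnorm A x"
    using rx x cnorm_le_minus[of x' x] cnorm_le_minus[of x x'] cnorm_minus_commute[of x x'] by simp
  then show ?thesis by (simp add: pushforward_cstar_def Let_def x')
qed

lemmas B_simps = mult_B add_B smult_B adj_B cnorm_B one_B zero_B

lemma seminormed_star_algebra_B: "seminormed_star_algebra B"
  by (rule seminormed_star_algebraI)
    (auto simp: carrier_B B_simps star_algebra_simps)

lemma q_star_hom: "q \<in> star_hom A B"
  by (rule star_homI) (auto simp: carrier_B B_simps)

text \<open>q preserves norms of differences, so a Cauchy sequence of images lifts to a Cauchy
  sequence in A. Definiteness holds because q identifies null elements with zero.\<close>

lemma unital_cstar_algebra_B: "unital_cstar_algebra B"
proof -
  interpret B: seminormed_star_algebra B by (rule seminormed_star_algebra_B)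
  note q_minus = star_hom_minus[OF seminormed_star_algebra_axioms seminormed_star_algebra_B q_star_hom]
  interpret B: seminormed_cstar_algebra B
  proof unfold_locales
    fix X :: "nat \<Rightarrow> 'b"
    assume X: "\<And>i. X i \<in> carrier B"
      and C: "\<And>e. e > 0 \<Longrightarrow> \<exists>n. \<forall>i\<ge>n. \<forall>j\<ge>n. cnorm B (X i \<ominus>\<^bsub>B\<^esub> X j) < e"
    from X have "\<forall>i. \<exists>y. y \<in> carrier A \<and> X i = q y" by (auto simp: carrier_B)
    then obtain Y where Y: "\<And>i. Y i \<in> carrier A" "\<And>i. X i = q (Y i)" by metis
    have "\<exists>x\<in>carrier A. (\<lambda>i. cnorm A (Y i \<ominus> x)) \<longlonglongrightarrow> 0"
      using C Y by (intro seq_complete) (auto simp: cnorm_B simp flip: q_minus)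
    then show "\<exists>x\<in>carrier B. (\<lambda>i. cnorm B (X i \<ominus>\<^bsub>B\<^esub> x)) \<longlonglongrightarrow> 0"
      using Y by (auto simp: carrier_B cnorm_B simp flip: q_minus)
  qed
  show ?thesis
  proof (rule B.unital_cstar_algebraI)
    fix x assume "x \<in> carrier B" and 0: "cnorm B x = 0"
    then obtain y where y: "y \<in> carrier A" "x = q y" by (auto simp: carrier_B)
    moreover have "y \<ominus> \<zero> = y" using y by (simp add: minus_eq)
    ultimately show "x = \<zero>\<^bsub>B\<^esub>"
      using 0 q_eqI[of y \<zero>] by (simp add: cnorm_B zero_B)
  qed
qed

end

section \<open>Algebras generated by two elements and their cardinality\<close>

lemma (in seminormed_star_algebra) seminormed_star_algebra_subset:
  assumes S: "S \<subseteq> carrier A" "\<zero> \<in> S" "\<one> \<in> S"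
    "\<And>x y. x \<in> S \<Longrightarrow> y \<in> S \<Longrightarrow> x \<oplus> y \<in> S" "\<And>x y. x \<in> S \<Longrightarrow> y \<in> S \<Longrightarrow> x \<otimes> y \<in> S"
    "\<And>c x. x \<in> S \<Longrightarrow> c \<odot> x \<in> S" "\<And>x. x \<in> S \<Longrightarrow> adj A x \<in> S"
  shows "seminormed_star_algebra (A\<lparr>carrier := S\<rparr>)"
proof -
  have *: "x \<in> carrier A" if "x \<in> S" for x using that S(1) by auto
  show ?thesis
    by (rule seminormed_star_algebraI)
      (auto simp: S(2-) * star_algebra_simps)
qed

text \<open>Syntax trees for noncommutative *-polynomials in two variables with Gaussian rational
  coefficients: a countable dense set in the C*-algebra generated by two elements.\<close>

datatype star_poly = Var1 | Var2 | One | Add star_poly star_poly | Mult star_poly star_poly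
  | Adj star_poly | Smult rat rat star_poly

instance star_poly :: countable
  by countable_datatype

primrec star_poly_eval :: "'a cstar \<Rightarrow> 'a \<Rightarrow> 'a \<Rightarrow> star_poly \<Rightarrow> 'a" where
  "star_poly_eval A x y Var1 = x"
| "star_poly_eval A x y Var2 = y"
| "star_poly_eval A x y One = \<one>\<^bsub>A\<^esub>"
| "star_poly_eval A x y (Add p r) = star_poly_eval A x y p \<oplus>\<^bsub>A\<^esub> star_poly_eval A x y r"
| "star_poly_eval A x y (Mult p r) = star_poly_eval A x y p \<otimes>\<^bsub>A\<^esub> star_poly_eval A x y r"
| "star_poly_eval A x y (Adj p) = adj A (star_poly_eval A x y p)"
| "star_poly_eval A x y (Smult a b p) = Complex (of_rat a) (of_rat b) \<odot>\<^bsub>A\<^esub> star_poly_eval A x y p"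

lemma gaussian_rational_dense:
  assumes "e > 0"
  obtains a b where "cmod (c - Complex (of_rat a) (of_rat b)) < e"
proof -
  have "\<exists>a. \<bar>t - of_rat a\<bar> < e/2" for t :: real
  proof -
    obtain a where "t - e/2 < of_rat a" "of_rat a < t + e/2"
      using of_rat_dense[of "t - e/2" "t + e/2"] assms by auto
    then show ?thesis by (intro exI[of _ a]) (auto simp: abs_if)
  qed
  then obtain a b where "\<bar>Re c - of_rat a\<bar> < e/2" "\<bar>Im c - of_rat b\<bar> < e/2" by metis
  then have "cmod (c - Complex (of_rat a) (of_rat b)) < e"
    using cmod_le[of "c - Complex (of_rat a) (of_rat b)"] by simp
  then show thesis by (rule that)
qed

text \<open>Described by approximation and not as an intersection of subalgebras: an element is then
  determined by its distances to countably many polynomials, which permits counting.\<close>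

definition star_poly_closure :: "'a cstar \<Rightarrow> 'a \<Rightarrow> 'a \<Rightarrow> 'a set" where
  "star_poly_closure A x y =
    {z \<in> carrier A. \<forall>e>0. \<exists>p. cnorm A (z \<ominus>\<^bsub>A\<^esub> star_poly_eval A x y p) < e}"

context unital_cstar_algebra
begin

context
  fixes x y
  assumes xy [simp]: "x \<in> carrier A" "y \<in> carrier A"
begin

abbreviation "ev \<equiv> star_poly_eval A x y"
abbreviation "S \<equiv> star_poly_closure A x y"

lemma star_poly_eval_closed [simp]: "ev p \<in> carrier A"
  by (induction p) auto

lemma star_poly_closure_subset: "S \<subseteq> carrier A"
  by (auto simp: star_poly_closure_def)

lemma star_poly_closureD: "z \<in> S \<Longrightarrow> e > 0 \<Longrightarrow> \<exists>p. cnorm A (z \<ominus> ev p) < e"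
  by (auto simp: star_poly_closure_def)

lemma star_poly_closureI:
  assumes "z \<in> carrier A" "\<And>e. e > 0 \<Longrightarrow> \<exists>p. cnorm A (z \<ominus> ev p) < e"
  shows "z \<in> S"
  using assms by (auto simp: star_poly_closure_def)

lemma ev_in_star_poly_closure: "ev p \<in> S"
  by (rule star_poly_closureI) (auto simp: minus_eq r_neg intro!: exI[of _ p])

lemma add_in_star_poly_closure:
  assumes z: "z \<in> S" "z' \<in> S"
  shows "z \<oplus> z' \<in> S"
proof (rule star_poly_closureI)
  have c [simp]: "z \<in> carrier A" "z' \<in> carrier A" using z star_poly_closure_subset by auto
  show "z \<oplus> z' \<in> carrier A" by simp
  fix e :: real assume "e > 0"
  then obtain p r where p: "cnorm A (z \<ominus> ev p) < e/2" and r: "cnorm A (z' \<ominus> ev r) < e/2"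
    using star_poly_closureD[OF z(1), of "e/2"] star_poly_closureD[OF z(2), of "e/2"] by auto
  have "(z \<oplus> z') \<ominus> ev (Add p r) = (z \<ominus> ev p) \<oplus> (z' \<ominus> ev r)"
    using c star_poly_eval_closed[of p] star_poly_eval_closed[of r] unfolding star_poly_eval.simps by algebra
  then have "cnorm A ((z \<oplus> z') \<ominus> ev (Add p r)) < e"
    using p r cnorm_triangle[of "z \<ominus> ev p" "z' \<ominus> ev r"] by simp
  then show "\<exists>p. cnorm A ((z \<oplus> z') \<ominus> ev p) < e" by blast
qed

lemma mult_in_star_poly_closure:
  assumes z: "z \<in> S" "z' \<in> S"
  shows "z \<otimes> z' \<in> S"
proof (rule star_poly_closureI)
  have c [simp]: "z \<in> carrier A" "z' \<in> carrier A" using z star_poly_closure_subset by auto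
  show "z \<otimes> z' \<in> carrier A" by simp
  fix e :: real assume e: "e > 0"
  have z'0: "0 \<le> cnorm A z'" by (simp add: cnorm_nonneg)
  then obtain p where p: "cnorm A (z \<ominus> ev p) < e / 2 / (cnorm A z' + 1)"
    using star_poly_closureD[OF z(1), of "e / 2 / (cnorm A z' + 1)"] e by auto
  have p0: "0 \<le> cnorm A (ev p)" by (simp add: cnorm_nonneg)
  \<comment> \<open>The tolerance for r depends on the norm of \<open>ev p\<close>, so p is chosen
    first; adding 1 to the norms avoids division by zero.\<close>
  then obtain r where r: "cnorm A (z' \<ominus> ev r) < e / 2 / (cnorm A (ev p) + 1)"
    using star_poly_closureD[OF z(2), of "e / 2 / (cnorm A (ev p) + 1)"] e by auto
  have "z \<otimes> z' \<ominus> ev (Mult p r) = (z \<ominus> ev p) \<otimes> z' \<oplus> ev p \<otimes> (z' \<ominus> ev r)"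
    using c star_poly_eval_closed[of p] star_poly_eval_closed[of r] unfolding star_poly_eval.simps by algebra
  then have "cnorm A (z \<otimes> z' \<ominus> ev (Mult p r)) \<le> cnorm A ((z \<ominus> ev p) \<otimes> z') + cnorm A (ev p \<otimes> (z' \<ominus> ev r))"
    by (simp add: cnorm_triangle)
  also have "\<dots> \<le> cnorm A (z \<ominus> ev p) * cnorm A z' + cnorm A (ev p) * cnorm A (z' \<ominus> ev r)"
    by (intro add_mono cnorm_mult) auto
  also have "\<dots> \<le> cnorm A (z \<ominus> ev p) * (cnorm A z' + 1) + (cnorm A (ev p) + 1) * cnorm A (z' \<ominus> ev r)"
    by (intro add_mono mult_mono) (auto simp: cnorm_nonneg add_nonneg_nonneg)
  also have "\<dots> < e"
    using p r z'0 p0 by (simp add: pos_less_divide_eq algebra_simps)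
  finally show "\<exists>p. cnorm A (z \<otimes> z' \<ominus> ev p) < e" by blast
qed

lemma smult_in_star_poly_closure:
  assumes z: "z \<in> S"
  shows "c \<odot> z \<in> S"
proof (rule star_poly_closureI)
  have c [simp]: "z \<in> carrier A" using z star_poly_closure_subset by auto
  show "c \<odot> z \<in> carrier A" by simp
  fix e :: real assume e: "e > 0"
  obtain p where p: "cnorm A (z \<ominus> ev p) < e / 2 / (cmod c + 1)"
    using star_poly_closureD[OF z, of "e / 2 / (cmod c + 1)"] e by (auto simp: add_nonneg_pos)
  have p0: "0 \<le> cnorm A (ev p)" by (simp add: cnorm_nonneg)
  obtain a b where ab: "cmod (c - Complex (of_rat a) (of_rat b)) < e / 2 / (cnorm A (ev p) + 1)"
    using gaussian_rational_dense[of "e / 2 / (cnorm A (ev p) + 1)" c] e p0 by auto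
  let ?c = "Complex (of_rat a) (of_rat b)"
  have "cnorm A (c \<odot> z \<ominus> ev (Smult a b p)) \<le> cnorm A (c \<odot> (z \<ominus> ev p)) + cnorm A ((c - ?c) \<odot> ev p)"
    using minus_triangle[of "c \<odot> z" "c \<odot> ev p" "?c \<odot> ev p"] by (simp add: minus_smult smult_minus)
  also have "\<dots> = cmod c * cnorm A (z \<ominus> ev p) + cmod (c - ?c) * cnorm A (ev p)"
    by (simp add: cnorm_smult)
  also have "\<dots> \<le> (cmod c + 1) * cnorm A (z \<ominus> ev p) + cmod (c - ?c) * (cnorm A (ev p) + 1)"
    by (intro add_mono mult_mono) (auto simp: cnorm_nonneg add_nonneg_nonneg)
  also have "\<dots> < e"
  proof -
    have "0 < cmod c + 1" "0 < cnorm A (ev p) + 1"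
      using norm_ge_zero[of c] p0 by linarith+
    then have "cnorm A (z \<ominus> ev p) * (cmod c + 1) < e / 2" "cmod (c - ?c) * (cnorm A (ev p) + 1) < e / 2"
      using p ab by (simp_all only: pos_less_divide_eq)
    then show ?thesis by (simp only: mult.commute[of "cmod c + 1"])
  qed
  finally show "\<exists>p. cnorm A (c \<odot> z \<ominus> ev p) < e" by blast
qed

lemma adj_in_star_poly_closure:
  assumes z: "z \<in> S"
  shows "adj A z \<in> S"
proof (rule star_poly_closureI)
  have c [simp]: "z \<in> carrier A" using z star_poly_closure_subset by auto
  show "adj A z \<in> carrier A" by simp
  fix e :: real assume e: "e > 0"
  obtain p where "cnorm A (z \<ominus> ev p) < e" using star_poly_closureD[OF z e] by blast
  then have "cnorm A (adj A z \<ominus> ev (Adj p)) < e" by (simp flip: adj_minus)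
  then show "\<exists>p. cnorm A (adj A z \<ominus> ev p) < e" by blast
qed

lemma zero_in_star_poly_closure: "\<zero> \<in> S"
  using smult_in_star_poly_closure[OF ev_in_star_poly_closure[of One], of 0] by simp

lemma seminormed_star_algebra_star_poly_closure: "seminormed_star_algebra (A\<lparr>carrier := S\<rparr>)"
  using ev_in_star_poly_closure[of One]
  by (intro seminormed_star_algebra_subset star_poly_closure_subset zero_in_star_poly_closure add_in_star_poly_closure
      mult_in_star_poly_closure smult_in_star_poly_closure adj_in_star_poly_closure) auto

text \<open>Subtraction is defined through the additive inverse, which refers to the carrier. In
  both algebras the inverse is multiplication by -1, which does not.\<close>

lemma minus_star_poly_closure:
  assumes "z \<in> S" "z' \<in> S"
  shows "z \<ominus>\<^bsub>A\<lparr>carrier := S\<rparr>\<^esub> z' = z \<ominus> z'"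
proof -
  interpret S: seminormed_star_algebra "A\<lparr>carrier := S\<rparr>" by (rule seminormed_star_algebra_star_poly_closure)
  have "\<ominus>\<^bsub>A\<lparr>carrier := S\<rparr>\<^esub> z' = \<ominus> z'"
    using S.smult_minus_one[of z'] smult_minus_one[of z'] assms star_poly_closure_subset by auto
  then show ?thesis by (simp add: a_minus_def)
qed

lemma seminormed_cstar_algebra_star_poly_closure: "seminormed_cstar_algebra (A\<lparr>carrier := S\<rparr>)"
proof -
  interpret S: seminormed_star_algebra "A\<lparr>carrier := S\<rparr>" by (rule seminormed_star_algebra_star_poly_closure)
  show ?thesis
  proof unfold_locales
    fix X :: "nat \<Rightarrow> 'a"
    assume X: "\<And>i. X i \<in> carrier (A\<lparr>carrier := S\<rparr>)"
      and C: "\<And>e. e > 0 \<Longrightarrow> \<exists>n. \<forall>i\<ge>n. \<forall>j\<ge>n.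
        cnorm (A\<lparr>carrier := S\<rparr>) (X i \<ominus>\<^bsub>A\<lparr>carrier := S\<rparr>\<^esub> X j) < e"
    have XS: "X i \<in> S" for i using X by simp
    then have XA: "X i \<in> carrier A" for i using star_poly_closure_subset by auto
    have "\<exists>z\<in>carrier A. (\<lambda>i. cnorm A (X i \<ominus> z)) \<longlonglongrightarrow> 0"
      using C XS XA by (intro seq_complete) (auto simp: minus_star_poly_closure)
    then obtain z where z: "z \<in> carrier A" "(\<lambda>i. cnorm A (X i \<ominus> z)) \<longlonglongrightarrow> 0" by blast
    have "z \<in> S"
    proof (rule star_poly_closureI[OF z(1)])
      fix e :: real assume e: "e > 0"
      have "eventually (\<lambda>i. cnorm A (X i \<ominus> z) < e/2) sequentially"
        using z(2) e by (intro order_tendstoD) auto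
      then obtain i where i: "cnorm A (X i \<ominus> z) < e/2" by (auto simp: eventually_sequentially)
      obtain p where "cnorm A (X i \<ominus> ev p) < e/2" using star_poly_closureD[OF XS, of "e/2"] e by auto
      then have "cnorm A (z \<ominus> ev p) < e"
        using i minus_triangle[of z "X i" "ev p"] z XA cnorm_minus_commute[of z "X i"] by simp
      then show "\<exists>p. cnorm A (z \<ominus> ev p) < e" by blast
    qed
    then show "\<exists>x\<in>carrier (A\<lparr>carrier := S\<rparr>).
        (\<lambda>i. cnorm (A\<lparr>carrier := S\<rparr>) (X i \<ominus>\<^bsub>A\<lparr>carrier := S\<rparr>\<^esub> x)) \<longlonglongrightarrow> 0"
      using z XS by (auto simp: minus_star_poly_closure)
  qed
qed

text \<open>An element z is recovered from the pairs (p, n) with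
  \<open>|z - p| < 1 / (n + 1)\<close>. Coded by numbers they form a set of naturals, and such sets
  inject into the reals.\<close>

lemma ex_inj_on_star_poly_closure_real: "\<exists>q :: 'a \<Rightarrow> real. inj_on q S"
proof -
  have "(UNIV :: nat set set) \<lesssim> (UNIV :: real set)"
    by (rule eqpoll_imp_lepoll[OF nat_sets_eqpoll_reals])
  then obtain r :: "nat set \<Rightarrow> real" where r: "inj r" by (auto simp: lepoll_def)
  define F where "F z = {to_nat (p, n) | p n. cnorm A (z \<ominus> ev p) < 1 / real (Suc n)}" for z
  have F_iff: "to_nat (p, n) \<in> F z \<longleftrightarrow> cnorm A (z \<ominus> ev p) < 1 / real (Suc n)" for z p n
    by (auto simp: F_def)
  have "z = z'" if zS: "z \<in> S" "z' \<in> S" and F: "F z = F z'" for z z'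
  proof (rule ccontr)
    have c: "z \<in> carrier A" "z' \<in> carrier A" using zS star_poly_closure_subset by auto
    assume "z \<noteq> z'"
    then have "cnorm A (z \<ominus> z') > 0"
      using c cnorm_nonneg[of "z \<ominus> z'"] cnorm_eq_0[of "z \<ominus> z'"] minus_eq_zero_iff by fastforce
    \<comment> \<open>With a tolerance below half the distance, no polynomial can be this close to
      both points.\<close>
    then obtain n where n: "1 / real (Suc n) < cnorm A (z \<ominus> z') / 2"
      using nat_approx_posE[of "cnorm A (z \<ominus> z') / 2"] by auto
    obtain p where p: "cnorm A (z \<ominus> ev p) < 1 / real (Suc n)"
      using star_poly_closureD[OF zS(1), of "1 / real (Suc n)"] by auto
    then have "cnorm A (z' \<ominus> ev p) < 1 / real (Suc n)"
      using F F_iff by blast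
    then show False
      using p n minus_triangle[of z "ev p" z'] cnorm_minus_commute[of "ev p" z'] c by simp
  qed
  then have "inj_on (\<lambda>z. r (F z)) S"
    using r by (auto simp: inj_on_def)
  then show ?thesis by blast
qed

end
end

text \<open>The definition tests only algebras carried by reals. The closure of the polynomials in U
  and V injects into the reals, so the test is applied to its copy there, and the inverse of the
  injection brings the homomorphism back.\<close>

lemma rotation_algebra_universal:
  assumes A: "rotation_algebra \<theta> A u v" and C: "unital_cstar_algebra C" and UV: "rotation_pair \<theta> C U V"
  obtains \<phi> where "\<phi> \<in> star_hom A C" "\<phi> u = U" "\<phi> v = V"
proof -
  interpret C: unital_cstar_algebra C by fact
  have c: "U \<in> carrier C" "V \<in> carrier C"
    using UV by (auto simp: rotation_pair_def unitary_elem_def)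
  define S where "S = star_poly_closure C U V"
  have S: "S \<subseteq> carrier C" unfolding S_def by (rule C.star_poly_closure_subset[OF c])
  obtain q :: "_ \<Rightarrow> real" where q: "inj_on q S"
    using C.ex_inj_on_star_poly_closure_real[OF c] S_def by auto
  interpret S: seminormed_cstar_algebra "C\<lparr>carrier := S\<rparr>"
    unfolding S_def by (rule C.seminormed_cstar_algebra_star_poly_closure[OF c])
  interpret Q: cstar_quotient_map "C\<lparr>carrier := S\<rparr>" q
  proof unfold_locales
    fix x y assume "x \<in> carrier (C\<lparr>carrier := S\<rparr>)" "y \<in> carrier (C\<lparr>carrier := S\<rparr>)"
    then have xy: "x \<in> S" "y \<in> S" by auto
    then have "x \<ominus>\<^bsub>C\<lparr>carrier := S\<rparr>\<^esub> y = x \<ominus>\<^bsub>C\<^esub> y"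
      unfolding S_def by (rule C.minus_star_poly_closure[OF c])
    then show "q x = q y \<longleftrightarrow> cnorm (C\<lparr>carrier := S\<rparr>) (x \<ominus>\<^bsub>C\<lparr>carrier := S\<rparr>\<^esub> y) = 0"
      using xy S q C.cnorm_eq_0 C.minus_eq_zero_iff by (auto simp: inj_on_eq_iff subset_iff)
  qed
  define B where "B = pushforward_cstar (C\<lparr>carrier := S\<rparr>) q"
  have UVS: "U \<in> S" "V \<in> S"
    using C.ev_in_star_poly_closure[OF c, of Var1] C.ev_in_star_poly_closure[OF c, of Var2] by (auto simp: S_def)
  note simps = Q.carrier_B[folded B_def] Q.B_simps[folded B_def]
  have "rotation_pair \<theta> B (q U) (q V)"
    using UV UVS S.m_closed[of U V] S.adj_closed[of U] S.adj_closed[of V]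
    by (simp add: rotation_pair_def unitary_elem_def simps)
  moreover have "unital_cstar_algebra B"
    using Q.unital_cstar_algebra_B by (simp add: B_def)
  ultimately obtain \<phi> where \<phi>: "\<phi> \<in> star_hom A B" "\<phi> u = q U" "\<phi> v = q V"
    using A unfolding rotation_algebra_def by blast
  have inv: "inv_into S q (q x) = x" if "x \<in> S" for x
    using q that by simp
  have "inv_into S q \<in> star_hom B C"
    using S.m_closed S.a_closed S.smult_closed S.adj_closed S.one_closed S
    by (intro star_homI) (auto simp: simps inv)
  then have "inv_into S q \<circ> \<phi> \<in> star_hom A C"
    using \<phi>(1) by (intro star_hom_comp)
  then show thesis
    using that[of "inv_into S q \<circ> \<phi>"] \<phi> inv UVS by simp
qed

section \<open>Sequence algebras\<close>

text \<open>The cosets of the null elements: sets over the original type, so that the quotient needs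
  no type of its own.\<close>

lemma (in seminormed_cstar_algebra) cstar_quotient_map_class:
  "cstar_quotient_map A (\<lambda>x. {y \<in> carrier A. cnorm A (x \<ominus> y) = 0})"
proof (rule cstar_quotient_map.intro[OF seminormed_cstar_algebra_axioms], rule cstar_quotient_map_axioms.intro)
  fix x y assume xy: "x \<in> carrier A" "y \<in> carrier A"
  show "{z \<in> carrier A. cnorm A (x \<ominus> z) = 0} = {z \<in> carrier A. cnorm A (y \<ominus> z) = 0}
    \<longleftrightarrow> cnorm A (x \<ominus> y) = 0" (is "?L \<longleftrightarrow> ?R")
  proof
    assume ?L
    moreover have "cnorm A (y \<ominus> y) = 0" using xy by (simp add: minus_eq r_neg)
    ultimately show ?R using xy by blast
  next
    assume ?R
    then have "cnorm A (x \<ominus> z) = cnorm A (y \<ominus> z)" if "z \<in> carrier A" for z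
      using xy that minus_triangle[of x y z] minus_triangle[of y x z] cnorm_minus_commute[of x y] by simp
    then show ?L by auto
  qed
qed

text \<open>Bounded sequences with \<open>limsup \<parallel>x\<^sub>i\<parallel>\<close> as seminorm; dividing by its kernel gives
  \<open>\<Prod> D\<^sub>i / \<Oplus> D\<^sub>i\<close>.\<close>

definition seq_cstar :: "(nat \<Rightarrow> 'a cstar) \<Rightarrow> (nat \<Rightarrow> 'a) cstar" where
  "seq_cstar D =
    \<lparr>carrier = {x. (\<forall>i. x i \<in> carrier (D i)) \<and> (\<exists>M. \<forall>i. cnorm (D i) (x i) \<le> M)},
     monoid.mult = (\<lambda>x y i. x i \<otimes>\<^bsub>D i\<^esub> y i),
     one = (\<lambda>i. \<one>\<^bsub>D i\<^esub>),
     zero = (\<lambda>i. \<zero>\<^bsub>D i\<^esub>),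
     add = (\<lambda>x y i. x i \<oplus>\<^bsub>D i\<^esub> y i),
     smult = (\<lambda>c x i. c \<odot>\<^bsub>D i\<^esub> x i),
     adj = (\<lambda>x i. adj (D i) (x i)),
     cnorm = (\<lambda>x. Inf {M. \<forall>\<^sub>F i in sequentially. cnorm (D i) (x i) \<le> M})\<rparr>"

locale cstar_sequence =
  fixes D :: "nat \<Rightarrow> 'a cstar"
  assumes D: "\<And>i. unital_cstar_algebra (D i)"
begin

sublocale D: unital_cstar_algebra "D i" for i by (rule D)

abbreviation P where "P \<equiv> seq_cstar D"

lemma seq_simps [simp]:
  "(x \<otimes>\<^bsub>P\<^esub> y) i = x i \<otimes>\<^bsub>D i\<^esub> y i" "\<one>\<^bsub>P\<^esub> i = \<one>\<^bsub>D i\<^esub>" "\<zero>\<^bsub>P\<^esub> i = \<zero>\<^bsub>D i\<^esub>"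
  "(x \<oplus>\<^bsub>P\<^esub> y) i = x i \<oplus>\<^bsub>D i\<^esub> y i" "(c \<odot>\<^bsub>P\<^esub> x) i = c \<odot>\<^bsub>D i\<^esub> x i" "adj P x i = adj (D i) (x i)"
  by (simp_all add: seq_cstar_def)

lemma seq_carrierI:
  "(\<And>i. x i \<in> carrier (D i)) \<Longrightarrow> (\<And>i. cnorm (D i) (x i) \<le> M) \<Longrightarrow> x \<in> carrier P"
  by (auto simp: seq_cstar_def)

lemma seq_carrierD: "x \<in> carrier P \<Longrightarrow> x i \<in> carrier (D i)"
  by (auto simp: seq_cstar_def)

lemma seq_carrier_bound:
  assumes "x \<in> carrier P"
  shows "\<exists>M\<ge>0. \<forall>i. cnorm (D i) (x i) \<le> M"
proof -
  obtain M where M: "\<forall>i. cnorm (D i) (x i) \<le> M" using assms by (auto simp: seq_cstar_def)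
  moreover have "0 \<le> M"
    using M[rule_format, of 0] D.cnorm_nonneg[OF seq_carrierD[OF assms], of 0] by linarith
  ultimately show ?thesis by blast
qed

lemma seq_closed:
  assumes x: "x \<in> carrier P" and y: "y \<in> carrier P"
  shows "x \<oplus>\<^bsub>P\<^esub> y \<in> carrier P" "x \<otimes>\<^bsub>P\<^esub> y \<in> carrier P" "c \<odot>\<^bsub>P\<^esub> x \<in> carrier P" "adj P x \<in> carrier P"
proof -
  obtain M where M: "M \<ge> 0" "\<And>i. cnorm (D i) (x i) \<le> M" using seq_carrier_bound[OF x] by blast
  obtain M' where M': "M' \<ge> 0" "\<And>i. cnorm (D i) (y i) \<le> M'" using seq_carrier_bound[OF y] by blast
  note [simp] = seq_carrierD[OF x] seq_carrierD[OF y]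
  show "x \<oplus>\<^bsub>P\<^esub> y \<in> carrier P"
  proof (rule seq_carrierI)
    show "cnorm (D i) ((x \<oplus>\<^bsub>P\<^esub> y) i) \<le> M + M'" for i
      using D.cnorm_triangle[of "x i" i "y i"] M(2)[of i] M'(2)[of i] by simp
  qed simp
  show "x \<otimes>\<^bsub>P\<^esub> y \<in> carrier P"
  proof (rule seq_carrierI)
    show "cnorm (D i) ((x \<otimes>\<^bsub>P\<^esub> y) i) \<le> M * M'" for i
      using D.cnorm_mult_le[OF _ _ M(2) M'(2)] by simp
  qed simp
  show "c \<odot>\<^bsub>P\<^esub> x \<in> carrier P"
  proof (rule seq_carrierI)
    show "cnorm (D i) ((c \<odot>\<^bsub>P\<^esub> x) i) \<le> cmod c * M" for i
      using M(2)[of i] by (simp add: D.cnorm_smult mult_left_mono)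
  qed simp
  show "adj P x \<in> carrier P"
  proof (rule seq_carrierI)
    show "cnorm (D i) (adj P x i) \<le> M" for i
      using M(2)[of i] by simp
  qed simp
qed

lemma seq_units: "\<one>\<^bsub>P\<^esub> \<in> carrier P" "\<zero>\<^bsub>P\<^esub> \<in> carrier P"
proof -
  show "\<one>\<^bsub>P\<^esub> \<in> carrier P" by (rule seq_carrierI[where M=1]) (auto simp: D.cnorm_one_le)
  show "\<zero>\<^bsub>P\<^esub> \<in> carrier P" by (rule seq_carrierI[where M=0]) auto
qed

text \<open>Eventual bounds with arbitrarily small slack replace the infimum; this is the form in
  which the inequalities for the seminorm are proved. Bounded sequences make the set of eventual
  bounds nonempty, nonnegative norms bound it below.\<close>

lemma seq_cnorm_le_iff:
  assumes x: "x \<in> carrier P"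
  shows "cnorm P x \<le> c \<longleftrightarrow> (\<forall>e>0. \<forall>\<^sub>F i in sequentially. cnorm (D i) (x i) \<le> c + e)"
proof -
  define B where "B = {M. \<forall>\<^sub>F i in sequentially. cnorm (D i) (x i) \<le> M}"
  have cnorm_eq: "cnorm P x = Inf B" by (simp add: seq_cstar_def B_def)
  have "0 \<le> M" if "M \<in> B" for M
  proof -
    have "\<forall>\<^sub>F i in sequentially. cnorm (D i) (x i) \<le> M" using that by (simp add: B_def)
    then obtain i where "cnorm (D i) (x i) \<le> M" by (auto simp: eventually_sequentially)
    then show ?thesis using D.cnorm_nonneg[OF seq_carrierD[OF x], of i] by linarith
  qed
  then have bdd: "bdd_below B" by (rule bdd_belowI[of B 0])
  obtain M where "M \<ge> 0" "\<And>i. cnorm (D i) (x i) \<le> M" using seq_carrier_bound[OF x] by blast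
  then have ne: "B \<noteq> {}" by (auto simp: B_def intro!: exI[of _ M] always_eventually)
  show ?thesis
  proof (intro iffI allI impI)
    fix e :: real assume "cnorm P x \<le> c" "e > 0"
    then have "Inf B < c + e" by (simp add: cnorm_eq)
    then obtain M where M: "M \<in> B" "M < c + e" using cInf_lessD[OF ne] by blast
    then show "\<forall>\<^sub>F i in sequentially. cnorm (D i) (x i) \<le> c + e"
      by (auto simp: B_def elim!: eventually_mono)
  next
    assume *: "\<forall>e>0. \<forall>\<^sub>F i in sequentially. cnorm (D i) (x i) \<le> c + e"
    show "cnorm P x \<le> c"
    proof (rule field_le_epsilon)
      fix e :: real assume "e > 0"
      then have "c + e \<in> B" using * by (simp add: B_def)
      then show "cnorm P x \<le> c + e" unfolding cnorm_eq by (rule cInf_lower[OF _ bdd])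
    qed
  qed
qed

lemma seq_cnorm_eventually:
  "x \<in> carrier P \<Longrightarrow> e > 0 \<Longrightarrow> \<forall>\<^sub>F i in sequentially. cnorm (D i) (x i) \<le> cnorm P x + e"
  using seq_cnorm_le_iff[of x "cnorm P x"] by simp

lemma seq_cnorm_nonneg:
  assumes x: "x \<in> carrier P"
  shows "0 \<le> cnorm P x"
proof (rule ccontr)
  assume "\<not> 0 \<le> cnorm P x"
  then have "\<forall>\<^sub>F i in sequentially. cnorm (D i) (x i) \<le> cnorm P x + (- cnorm P x / 2)"
    by (intro seq_cnorm_eventually x) simp
  then obtain i where "cnorm (D i) (x i) \<le> cnorm P x / 2" by (auto simp: eventually_sequentially)
  then show False using D.cnorm_nonneg[OF seq_carrierD[OF x], of i] \<open>\<not> 0 \<le> cnorm P x\<close> by simp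
qed

lemma seq_cnorm_triangle:
  assumes x: "x \<in> carrier P" and y: "y \<in> carrier P"
  shows "cnorm P (x \<oplus>\<^bsub>P\<^esub> y) \<le> cnorm P x + cnorm P y"
  unfolding seq_cnorm_le_iff[OF seq_closed(1)[OF x y]]
proof (intro allI impI)
  fix e :: real assume "e > 0"
  then have "e/2 > 0" by simp
  from seq_cnorm_eventually[OF x this] seq_cnorm_eventually[OF y this]
  show "\<forall>\<^sub>F i in sequentially. cnorm (D i) ((x \<oplus>\<^bsub>P\<^esub> y) i) \<le> cnorm P x + cnorm P y + e"
  proof eventually_elim
    case (elim i)
    then show ?case
      using D.cnorm_triangle[OF seq_carrierD[OF x] seq_carrierD[OF y], of i] by simp
  qed
qed

lemma seq_cnorm_mult:
  assumes x: "x \<in> carrier P" and y: "y \<in> carrier P"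
  shows "cnorm P (x \<otimes>\<^bsub>P\<^esub> y) \<le> cnorm P x * cnorm P y"
  unfolding seq_cnorm_le_iff[OF seq_closed(2)[OF x y]]
proof (intro allI impI)
  fix e :: real assume e: "e > 0"
  define a b where "a = cnorm P x" and "b = cnorm P y"
  have ab: "a \<ge> 0" "b \<ge> 0" using x y by (simp_all add: a_def b_def seq_cnorm_nonneg)
  \<comment> \<open>\<open>(a + d) (b + d) = a b + d (a + b + d)\<close>, and d <= 1 keeps the last
    factor at most a + b + 1.\<close>
  define d where "d = min 1 (e / (a + b + 1))"
  have d: "d > 0" "d \<le> 1" "d \<le> e / (a + b + 1)" using ab e by (auto simp: d_def)
  have "d * (a + b + d) \<le> e / (a + b + 1) * (a + b + 1)"
    using d ab e by (intro mult_mono) auto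
  also have "\<dots> = e" using ab by simp
  finally have ab_le: "(a + d) * (b + d) \<le> a * b + e"
    using ab by (simp add: algebra_simps)
  from seq_cnorm_eventually[OF x d(1)] seq_cnorm_eventually[OF y d(1)]
  show "\<forall>\<^sub>F i in sequentially. cnorm (D i) ((x \<otimes>\<^bsub>P\<^esub> y) i) \<le> cnorm P x * cnorm P y + e"
  proof (eventually_elim)
    case (elim i)
    then show ?case
      using D.cnorm_mult_le[OF seq_carrierD[OF x] seq_carrierD[OF y], of i "a + d" "b + d"] ab_le
      by (simp add: a_def b_def)
  qed
qed

lemma seq_cnorm_smult_le:
  assumes x: "x \<in> carrier P"
  shows "cnorm P (c \<odot>\<^bsub>P\<^esub> x) \<le> cmod c * cnorm P x"
  unfolding seq_cnorm_le_iff[OF seq_closed(3)[OF x x]]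
proof (intro allI impI)
  fix e :: real assume e: "e > 0"
  have pos: "0 < cmod c + 1" using norm_ge_zero[of c] by linarith
  then have "e / (cmod c + 1) > 0" using e by simp
  from seq_cnorm_eventually[OF x this]
  show "\<forall>\<^sub>F i in sequentially. cnorm (D i) ((c \<odot>\<^bsub>P\<^esub> x) i) \<le> cmod c * cnorm P x + e"
  proof (eventually_elim)
    case (elim i)
    have "cmod c * cnorm (D i) (x i) \<le> cmod c * (cnorm P x + e / (cmod c + 1))"
      using elim by (intro mult_left_mono) auto
    also have "\<dots> = cmod c * cnorm P x + cmod c * (e / (cmod c + 1))" by (simp add: algebra_simps)
    also have "cmod c * (e / (cmod c + 1)) \<le> (cmod c + 1) * (e / (cmod c + 1))"
      using e pos by (intro mult_right_mono) auto
    also have "\<dots> = e" using pos by simp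
    finally show ?case using seq_carrierD[OF x] by (simp add: D.cnorm_smult)
  qed
qed

lemma seq_cnorm_smult:
  assumes x: "x \<in> carrier P"
  shows "cnorm P (c \<odot>\<^bsub>P\<^esub> x) = cmod c * cnorm P x"
proof (cases "c = 0")
  case True
  then show ?thesis
    using seq_cnorm_smult_le[OF x, of c] seq_cnorm_nonneg[OF seq_closed(3)[OF x x], of c] by simp
next
  case False
  \<comment> \<open>The reverse inequality is the one already proved, applied to the scalar
    \<open>1 / c\<close>.\<close>
  have "inverse c \<odot>\<^bsub>P\<^esub> (c \<odot>\<^bsub>P\<^esub> x) = x"
    using False seq_carrierD[OF x] by (auto simp: D.smult_smult)
  then have "cnorm P x \<le> cmod (inverse c) * cnorm P (c \<odot>\<^bsub>P\<^esub> x)"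
    using seq_cnorm_smult_le[OF seq_closed(3)[OF x x], of "inverse c" c] by simp
  then have "cmod c * cnorm P x \<le> cnorm P (c \<odot>\<^bsub>P\<^esub> x)"
    using False by (simp add: norm_inverse norm_divide field_simps)
  then show ?thesis using seq_cnorm_smult_le[OF x, of c] by simp
qed

lemma seq_cnorm_adj: "x \<in> carrier P \<Longrightarrow> cnorm P (adj P x) = cnorm P x"
  using seq_carrierD[of x] by (simp add: seq_cstar_def)

lemma seq_cnorm_adj_mult:
  assumes x: "x \<in> carrier P"
  shows "cnorm P (adj P x \<otimes>\<^bsub>P\<^esub> x) = (cnorm P x)\<^sup>2"
proof (rule antisym)
  have x': "adj P x \<in> carrier P" by (rule seq_closed(4)[OF x x])
  show "cnorm P (adj P x \<otimes>\<^bsub>P\<^esub> x) \<le> (cnorm P x)\<^sup>2"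
    using seq_cnorm_mult[OF x' x] by (simp add: seq_cnorm_adj x power2_eq_square)
  define s where "s = cnorm P (adj P x \<otimes>\<^bsub>P\<^esub> x)"
  have s: "s \<ge> 0" using x x' by (simp add: s_def seq_cnorm_nonneg seq_closed)
  have "cnorm P x \<le> sqrt s"
    unfolding seq_cnorm_le_iff[OF x]
  proof (intro allI impI)
    fix e :: real assume e: "e > 0"
    then have "e\<^sup>2 > 0" by simp
    from seq_cnorm_eventually[OF seq_closed(2)[OF x' x] this]
    show "\<forall>\<^sub>F i in sequentially. cnorm (D i) (x i) \<le> sqrt s + e"
    proof eventually_elim
      case (elim i)
      then have "(cnorm (D i) (x i))\<^sup>2 \<le> s + e\<^sup>2"
        using D.cnorm_adj_mult[OF seq_carrierD[OF x], of i] by (simp add: s_def)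
      also have "\<dots> \<le> (sqrt s + e)\<^sup>2" using s e by (simp add: power2_sum)
      finally show ?case by (rule power2_le_imp_le) (use s e in simp)
    qed
  qed
  then have "(cnorm P x)\<^sup>2 \<le> (sqrt s)\<^sup>2" by (intro power_mono seq_cnorm_nonneg x)
  then show "(cnorm P x)\<^sup>2 \<le> cnorm P (adj P x \<otimes>\<^bsub>P\<^esub> x)" using s by (simp add: s_def)
qed

lemma seminormed_star_algebra_seq: "seminormed_star_algebra P"
  by (rule seminormed_star_algebraI;
      (rule seq_units seq_closed seq_cnorm_nonneg seq_cnorm_triangle seq_cnorm_smult seq_cnorm_mult
        seq_cnorm_adj_mult; assumption)?;
      rule ext;
      frule seq_carrierD;
      simp add: D.a_ac D.m_assoc D.l_distr D.r_distr D.smult_l_distr D.smult_r_distr seq_carrierD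
        D.smult_smult D.smult_mult_left D.smult_mult_right D.adj_adj D.adj_add D.adj_smult D.adj_mult
        D.smult_minus_one D.r_neg D.l_neg)

sublocale P: seminormed_star_algebra P by (rule seminormed_star_algebra_seq)

lemma seq_minus:
  assumes "x \<in> carrier P" "y \<in> carrier P"
  shows "(x \<ominus>\<^bsub>P\<^esub> y) i = x i \<ominus>\<^bsub>D i\<^esub> y i"
proof -
  have "x \<ominus>\<^bsub>P\<^esub> y = x \<oplus>\<^bsub>P\<^esub> (-1) \<odot>\<^bsub>P\<^esub> y" using assms by (simp add: P.minus_eq P.smult_minus_one)
  then show ?thesis using assms(2)[THEN seq_carrierD] by (simp add: D.minus_eq D.smult_minus_one)
qed

text \<open>A small limsup controls components only from some index on, so the component sequences
  of a Cauchy sequence may diverge. The limit is instead a diagonal sequence along a subsequence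
  with steps at most \<open>2^-k\<close>.\<close>

lemma seminormed_cstar_algebra_seq: "seminormed_cstar_algebra P"
proof unfold_locales
  fix X :: "nat \<Rightarrow> nat \<Rightarrow> 'a"
  assume X: "\<And>i. X i \<in> carrier P"
    and C: "\<And>e. e > 0 \<Longrightarrow> \<exists>n. \<forall>i\<ge>n. \<forall>j\<ge>n. cnorm P (X i \<ominus>\<^bsub>P\<^esub> X j) < e"
  note XD = X[THEN seq_carrierD]
  have "\<forall>k. \<exists>n. \<forall>i\<ge>n. \<forall>j\<ge>n. cnorm P (X i \<ominus>\<^bsub>P\<^esub> X j) < (1/2) ^ Suc k"
    by (intro allI C) simp
  then obtain N where N: "\<And>k i j. i \<ge> N k \<Longrightarrow> j \<ge> N k \<Longrightarrow> cnorm P (X i \<ominus>\<^bsub>P\<^esub> X j) < (1/2) ^ Suc k"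
    by metis
  \<comment> \<open>Cumulative sums, so that \<open>m k\<close> and \<open>m (Suc k)\<close> both
    lie beyond \<open>N k\<close>.\<close>
  define m where "m k = (\<Sum>l\<le>k. N l)" for k
  have m: "N k \<le> m k" "N k \<le> m (Suc k)" for k
  proof -
    show "N k \<le> m k" by (auto simp: m_def intro!: member_le_sum)
    then show "N k \<le> m (Suc k)" by (simp add: m_def)
  qed
  have "\<forall>k. \<exists>T. \<forall>i\<ge>T. cnorm (D i) (X (m k) i \<ominus>\<^bsub>D i\<^esub> X (m (Suc k)) i) \<le> (1/2) ^ k"
  proof
    fix k
    have "cnorm P (X (m k) \<ominus>\<^bsub>P\<^esub> X (m (Suc k))) < (1/2) ^ Suc k" by (rule N[OF m])
    moreover have "\<forall>\<^sub>F i in sequentially. cnorm (D i) ((X (m k) \<ominus>\<^bsub>P\<^esub> X (m (Suc k))) i)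
        \<le> cnorm P (X (m k) \<ominus>\<^bsub>P\<^esub> X (m (Suc k))) + (1/2) ^ Suc k"
      using X by (intro seq_cnorm_eventually) auto
    ultimately have "\<forall>\<^sub>F i in sequentially. cnorm (D i) (X (m k) i \<ominus>\<^bsub>D i\<^esub> X (m (Suc k)) i) \<le> (1/2) ^ k"
      by (auto simp: seq_minus X elim!: eventually_mono)
    then show "\<exists>T. \<forall>i\<ge>T. cnorm (D i) (X (m k) i \<ominus>\<^bsub>D i\<^esub> X (m (Suc k)) i) \<le> (1/2) ^ k"
      by (simp add: eventually_sequentially)
  qed
  then obtain T where T: "\<And>k i. i \<ge> T k \<Longrightarrow> cnorm (D i) (X (m k) i \<ominus>\<^bsub>D i\<^esub> X (m (Suc k)) i) \<le> (1/2) ^ k"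
    by metis
  \<comment> \<open>The bound is the sum of \<open>2^-l\<close> over k <= l < k + d in closed
    form.\<close>
  have tele: "cnorm (D i) (X (m k) i \<ominus>\<^bsub>D i\<^esub> X (m (k + d)) i) \<le> 2 * (1/2) ^ k - 2 * (1/2) ^ (k + d)"
    if "\<And>l. l < k + d \<Longrightarrow> T l \<le> i" for i k d
    using that
  proof (induction d)
    case 0
    have "X (m k) i \<ominus>\<^bsub>D i\<^esub> X (m k) i = \<zero>\<^bsub>D i\<^esub>" using XD by (simp add: D.minus_eq D.r_neg)
    then show ?case by simp
  next
    case (Suc d)
    then have "cnorm (D i) (X (m k) i \<ominus>\<^bsub>D i\<^esub> X (m (k + d)) i) \<le> 2 * (1/2) ^ k - 2 * (1/2) ^ (k + d)"
      by simp
    moreover have "cnorm (D i) (X (m (k + d)) i \<ominus>\<^bsub>D i\<^esub> X (m (Suc (k + d))) i) \<le> (1/2) ^ (k + d)"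
      using Suc.prems by (intro T) simp
    ultimately show ?case
      using D.minus_triangle[of "X (m k) i" i "X (m (k + d)) i" "X (m (k + Suc d)) i"] XD by simp
  qed
  text \<open>The limit runs through the subsequence slowly enough that the \<open>i\<close>-th component is already
    controlled when it is used.\<close>
  define good where "good i J \<longleftrightarrow> J \<le> i \<and> (\<forall>l<J. T l \<le> i)" for i J
  \<comment> \<open>\<open>good i 0\<close> always holds and \<open>good i J\<close> implies J <= i,
    so the greatest J exists.\<close>
  define J where "J i = (GREATEST J. good i J)" for i
  have J_good: "good i (J i)" for i
    unfolding J_def by (rule GreatestI_nat[of _ 0 i]) (auto simp: good_def)
  have J_ge: "k \<le> J i" if "good i k" for i k
    unfolding J_def by (rule Greatest_le_nat[where P = "good i", OF that, of i]) (auto simp: good_def)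
  define z where "z i = X (m (J i)) i" for i
  have zD: "z i \<in> carrier (D i)" for i by (simp add: z_def XD)
  have z_diff: "cnorm (D i) (X (m k) i \<ominus>\<^bsub>D i\<^esub> z i) \<le> 2 * (1/2) ^ k" if "k \<le> J i" for k i
  proof -
    have "cnorm (D i) (X (m k) i \<ominus>\<^bsub>D i\<^esub> z i) \<le> 2 * (1/2) ^ k - 2 * (1/2) ^ J i"
      using tele[of k "J i - k" i] that J_good[of i] by (simp add: z_def good_def)
    also have "\<dots> \<le> 2 * (1/2) ^ k" by simp
    finally show ?thesis .
  qed
  obtain M where M: "\<And>i. cnorm (D i) (X (m 0) i) \<le> M" using seq_carrier_bound[OF X] by blast
  \<comment> \<open>The case k = 0 of \<open>z_diff\<close> holds at every index and bounds z by the
    bounded sequence \<open>X (m 0)\<close>.\<close>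
  have z: "z \<in> carrier P"
  proof (rule seq_carrierI[OF zD])
    fix i
    show "cnorm (D i) (z i) \<le> 2 + M"
      using z_diff[of 0 i] M[of i] D.cnorm_le_minus[OF zD XD, of i "m 0"]
        D.cnorm_minus_commute[OF zD XD, of i "m 0"] by simp
  qed
  have lim: "cnorm P (X (m k) \<ominus>\<^bsub>P\<^esub> z) \<le> 2 * (1/2) ^ k" for k
  proof -
    have X': "X (m k) \<ominus>\<^bsub>P\<^esub> z \<in> carrier P" using X z by simp
    show ?thesis
      unfolding seq_cnorm_le_iff[OF X']
    proof (intro allI impI)
      fix e :: real assume e: "e > 0"
      define i0 where "i0 = k + (\<Sum>l<k. T l)"
      have "cnorm (D i) ((X (m k) \<ominus>\<^bsub>P\<^esub> z) i) \<le> 2 * (1/2) ^ k + e" if "i \<ge> i0" for i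
      proof -
        have "T l \<le> i" if "l < k" for l
          using \<open>i \<ge> i0\<close> member_le_sum[of l "{..<k}" T] that by (simp add: i0_def)
        then have "good i k" using that by (auto simp: good_def i0_def)
        then show ?thesis using z_diff[OF J_ge] e X z by (simp add: seq_minus add_increasing2)
      qed
      then show "\<forall>\<^sub>F i in sequentially. cnorm (D i) ((X (m k) \<ominus>\<^bsub>P\<^esub> z) i) \<le> 2 * (1/2) ^ k + e"
        by (auto simp: eventually_sequentially)
    qed
  qed
  have "(\<lambda>n. cnorm P (X n \<ominus>\<^bsub>P\<^esub> z)) \<longlonglongrightarrow> 0"
  proof (rule LIMSEQ_I)
    fix r :: real assume "r > 0"
    then obtain k where k: "(1/2) ^ k < r / 3" using real_arch_pow_inv[of "r/3" "1/2"] by auto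
    have "norm (cnorm P (X n \<ominus>\<^bsub>P\<^esub> z) - 0) < r" if "n \<ge> N k" for n
    proof -
      have "cnorm P (X n \<ominus>\<^bsub>P\<^esub> z) \<le> cnorm P (X n \<ominus>\<^bsub>P\<^esub> X (m k)) + cnorm P (X (m k) \<ominus>\<^bsub>P\<^esub> z)"
        using X z by (intro P.minus_triangle)
      also have "\<dots> < (1/2) ^ Suc k + 2 * (1/2) ^ k"
        using N[OF that m(1)] lim[of k] by linarith
      finally show ?thesis using k P.cnorm_nonneg[of "X n \<ominus>\<^bsub>P\<^esub> z"] X z by simp
    qed
    then show "\<exists>no. \<forall>n\<ge>no. norm (cnorm P (X n \<ominus>\<^bsub>P\<^esub> z) - 0) < r" by blast
  qed
  then show "\<exists>x\<in>carrier P. (\<lambda>i. cnorm P (X i \<ominus>\<^bsub>P\<^esub> x)) \<longlonglongrightarrow> 0"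
    using z by blast
qed

end

section \<open>Matrix units\<close>

text \<open>One induction for all additive maps in use: scalars, the adjoint, homomorphisms,
  components of sequences and entries of matrices.\<close>

lemma (in abelian_monoid) finsum_additive:
  assumes H: "abelian_monoid H"
    and h: "h \<in> carrier G \<rightarrow> carrier H" "h \<zero> = \<zero>\<^bsub>H\<^esub>"
      "\<And>x y. x \<in> carrier G \<Longrightarrow> y \<in> carrier G \<Longrightarrow> h (x \<oplus> y) = h x \<oplus>\<^bsub>H\<^esub> h y"
    and f: "f \<in> I \<rightarrow> carrier G"
  shows "h (finsum G f I) = finsum H (\<lambda>i. h (f i)) I"
proof -
  interpret H: abelian_monoid H by fact
  show ?thesis
    using f
  proof (induction I rule: infinite_finite_induct)
    case (insert i I)
    then have "f \<in> I \<rightarrow> carrier G" "f i \<in> carrier G" "(\<lambda>i. h (f i)) \<in> I \<rightarrow> carrier H" "h (f i) \<in> carrier H"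
      using h(1) by auto
    then show ?case using insert h by simp
  qed (auto simp: h)
qed

lemma (in abelian_monoid) finsum_swap:
  assumes "\<And>i j. i \<in> I \<Longrightarrow> j \<in> J \<Longrightarrow> f i j \<in> carrier G"
  shows "(\<Oplus>i\<in>I. \<Oplus>j\<in>J. f i j) = (\<Oplus>j\<in>J. \<Oplus>i\<in>I. f i j)"
  using assms
proof (induction I rule: infinite_finite_induct)
  case (insert i I)
  have "(\<Oplus>i\<in>insert i I. \<Oplus>j\<in>J. f i j) = (\<Oplus>j\<in>J. f i j) \<oplus> (\<Oplus>i\<in>I. \<Oplus>j\<in>J. f i j)"
    using insert by (intro finsum_insert) (auto intro!: finsum_closed)
  also have "\<dots> = (\<Oplus>j\<in>J. f i j) \<oplus> (\<Oplus>j\<in>J. \<Oplus>i\<in>I. f i j)"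
    using insert by simp
  also have "\<dots> = (\<Oplus>j\<in>J. f i j \<oplus> (\<Oplus>i\<in>I. f i j))"
    using insert.prems by (intro finsum_addf[symmetric]) (auto intro!: finsum_closed)
  also have "\<dots> = (\<Oplus>j\<in>J. \<Oplus>i\<in>insert i I. f i j)"
    using insert by (intro finsum_cong' refl finsum_insert[symmetric]) (auto intro!: finsum_closed)
  finally show ?case .
qed simp_all

lemma (in abelian_monoid) finsum_delta:
  assumes "finite I" "i \<in> I" "x \<in> carrier G"
  shows "(\<Oplus>j\<in>I. if i = j then x else \<zero>) = x"
  using finsum_singleton[OF assms(2,1), of "\<lambda>_. x"] assms(3) by simp

lemma (in ring) finsum2_ldistr:
  assumes "finite I" "finite J" "\<And>i j. i \<in> I \<Longrightarrow> j \<in> J \<Longrightarrow> f i j \<in> carrier R" "z \<in> carrier R"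
  shows "(\<Oplus>i\<in>I. \<Oplus>j\<in>J. f i j) \<otimes> z = (\<Oplus>i\<in>I. \<Oplus>j\<in>J. f i j \<otimes> z)"
proof -
  have "(\<Oplus>i\<in>I. \<Oplus>j\<in>J. f i j) \<otimes> z = (\<Oplus>i\<in>I. (\<Oplus>j\<in>J. f i j) \<otimes> z)"
    using assms by (intro finsum_ldistr) (auto intro!: finsum_closed)
  also have "\<dots> = (\<Oplus>i\<in>I. \<Oplus>j\<in>J. f i j \<otimes> z)"
    using assms by (intro finsum_cong' refl finsum_ldistr) (auto intro!: finsum_closed)
  finally show ?thesis .
qed

lemma (in ring) finsum2_rdistr:
  assumes "finite I" "finite J" "\<And>i j. i \<in> I \<Longrightarrow> j \<in> J \<Longrightarrow> f i j \<in> carrier R" "z \<in> carrier R"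
  shows "z \<otimes> (\<Oplus>i\<in>I. \<Oplus>j\<in>J. f i j) = (\<Oplus>i\<in>I. \<Oplus>j\<in>J. z \<otimes> f i j)"
proof -
  have "z \<otimes> (\<Oplus>i\<in>I. \<Oplus>j\<in>J. f i j) = (\<Oplus>i\<in>I. z \<otimes> (\<Oplus>j\<in>J. f i j))"
    using assms by (intro finsum_rdistr) (auto intro!: finsum_closed)
  also have "\<dots> = (\<Oplus>i\<in>I. \<Oplus>j\<in>J. z \<otimes> f i j)"
    using assms by (intro finsum_cong' refl finsum_rdistr) (auto intro!: finsum_closed)
  finally show ?thesis .
qed

context seminormed_star_algebra
begin

lemma smult_finsum:
  "f \<in> I \<rightarrow> carrier A \<Longrightarrow> c \<odot> finsum A f I = (\<Oplus>i\<in>I. c \<odot> f i)"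
  by (rule finsum_additive) (auto simp: smult_r_distr abelian_monoid_axioms)

lemma adj_zero [simp]: "adj A \<zero> = \<zero>"
  using adj_smult[of \<zero> 0] by simp

lemma adj_finsum:
  "f \<in> I \<rightarrow> carrier A \<Longrightarrow> adj A (finsum A f I) = (\<Oplus>i\<in>I. adj A (f i))"
  by (rule finsum_additive) (auto simp: adj_add abelian_monoid_axioms)

lemma finsum_smult:
  "finite I \<Longrightarrow> x \<in> carrier A \<Longrightarrow> (\<Oplus>i\<in>I. c i \<odot> x) = (\<Sum>i\<in>I. c i) \<odot> x"
  by (induction I rule: finite_induct) (auto simp: smult_l_distr)

end

lemma star_hom_zero:
  assumes A: "seminormed_star_algebra A" and B: "seminormed_star_algebra B" and \<phi>: "\<phi> \<in> star_hom A B"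
  shows "\<phi> \<zero>\<^bsub>A\<^esub> = \<zero>\<^bsub>B\<^esub>"
proof -
  interpret A: seminormed_star_algebra A by fact
  interpret B: seminormed_star_algebra B by fact
  have "\<phi> (0 \<odot>\<^bsub>A\<^esub> \<zero>\<^bsub>A\<^esub>) = 0 \<odot>\<^bsub>B\<^esub> \<phi> \<zero>\<^bsub>A\<^esub>" using star_homE(6)[OF \<phi>] by blast
  then show ?thesis using star_homE(2)[OF \<phi>] by simp
qed

lemma star_hom_finsum:
  assumes A: "seminormed_star_algebra A" and B: "seminormed_star_algebra B" and \<phi>: "\<phi> \<in> star_hom A B"
    and f: "f \<in> I \<rightarrow> carrier A"
  shows "\<phi> (finsum A f I) = finsum B (\<lambda>i. \<phi> (f i)) I"
proof -
  interpret A: seminormed_star_algebra A by fact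
  interpret B: seminormed_star_algebra B by fact
  show ?thesis
    by (rule A.finsum_additive) (use f star_homE[OF \<phi>] star_hom_zero[OF A B \<phi>] B.abelian_monoid_axioms in auto)
qed

section \<open>Homomorphisms out of M_k(A)\<close>

lemma matrix_algebra_simps:
  "carrier (matrix_algebra k A N) = {X \<in> carrier_mat k k. \<forall>i<k. \<forall>j<k. X $$ (i, j) \<in> carrier A}"
  "X \<otimes>\<^bsub>matrix_algebra k A N\<^esub> Y = mat k k (\<lambda>(i, j). \<Oplus>\<^bsub>A\<^esub>l\<in>{..<k}. X $$ (i, l) \<otimes>\<^bsub>A\<^esub> Y $$ (l, j))"
  "\<one>\<^bsub>matrix_algebra k A N\<^esub> = mat k k (\<lambda>(i, j). if i = j then \<one>\<^bsub>A\<^esub> else \<zero>\<^bsub>A\<^esub>)"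
  "\<zero>\<^bsub>matrix_algebra k A N\<^esub> = mat k k (\<lambda>_. \<zero>\<^bsub>A\<^esub>)"
  "X \<oplus>\<^bsub>matrix_algebra k A N\<^esub> Y = mat k k (\<lambda>ij. X $$ ij \<oplus>\<^bsub>A\<^esub> Y $$ ij)"
  "c \<odot>\<^bsub>matrix_algebra k A N\<^esub> X = map_mat (\<lambda>x. c \<odot>\<^bsub>A\<^esub> x) X"
  "adj (matrix_algebra k A N) X = mat k k (\<lambda>(i, j). adj A (X $$ (j, i)))"
  "cnorm (matrix_algebra k A N) X = N X"
  by (simp_all add: matrix_algebra_def)

lemma (in seminormed_star_algebra) mat_tensor_closed:
  "B \<in> carrier_mat k k \<Longrightarrow> x \<in> carrier A \<Longrightarrow> mat_tensor A B x \<in> carrier (matrix_algebra k A N)"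
  by (auto simp: mat_tensor_def matrix_algebra_simps)

text \<open>A unital *-representation of M_k(C) in C, given by the images of the elementary
  matrices; \<open>combination\<close> is the representation itself. Matrix coefficients are thus
  multiplied inside C, without forming a tensor product.\<close>

locale matrix_units = seminormed_star_algebra C for C :: "'c cstar" (structure) +
  fixes k :: nat and e :: "nat \<Rightarrow> nat \<Rightarrow> 'c"
  assumes e_closed: "a < k \<Longrightarrow> b < k \<Longrightarrow> e a b \<in> carrier C"
    and e_mult: "\<lbrakk>a < k; b < k; c < k; d < k\<rbrakk> \<Longrightarrow> e a b \<otimes> e c d = (if b = c then e a d else \<zero>)"
    and e_adj: "a < k \<Longrightarrow> b < k \<Longrightarrow> adj C (e a b) = e b a"
    and e_sum: "(\<Oplus>a\<in>{..<k}. e a a) = \<one>"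
begin

definition combination :: "complex mat \<Rightarrow> 'c" where
  "combination B = (\<Oplus>a\<in>{..<k}. \<Oplus>b\<in>{..<k}. B $$ (a, b) \<odot> e a b)"

text \<open>On \<open>B \<otimes> x\<close> this is \<open>combination B\<close> times
  \<open>\<phi> x\<close>: the map induced on M_k(A) by commuting representations of M_k(C) and
  A.\<close>

definition amplify :: "('a \<Rightarrow> 'c) \<Rightarrow> 'a mat \<Rightarrow> 'c" where
  "amplify \<phi> X = (\<Oplus>a\<in>{..<k}. \<Oplus>b\<in>{..<k}. e a b \<otimes> \<phi> (X $$ (a, b)))"

lemma cnorm_e_le: "a < k \<Longrightarrow> b < k \<Longrightarrow> cnorm C (e a b) \<le> 1"
  by (rule cnorm_le_one_if_isometry[of _ "e b b"]) (auto simp: e_closed e_mult e_adj)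

lemma combination_closed [simp]: "combination B \<in> carrier C"
  by (auto simp: combination_def e_closed intro!: finsum_closed)

end

locale commuting_star_hom = matrix_units C k e + A: seminormed_star_algebra A
  for C :: "'c cstar" (structure) and k e and A :: "'a cstar" +
  fixes \<phi> :: "'a \<Rightarrow> 'c" and N :: "'a mat \<Rightarrow> real"
  assumes hom: "\<phi> \<in> star_hom A C"
    and commute: "\<lbrakk>x \<in> carrier A; a < k; b < k\<rbrakk> \<Longrightarrow> e a b \<otimes> \<phi> x = \<phi> x \<otimes> e a b"
begin

abbreviation "M \<equiv> matrix_algebra k A N"

lemmas \<phi> = star_homE(2-)[OF hom]
  and \<phi>_zero = star_hom_zero[OF A.seminormed_star_algebra_axioms seminormed_star_algebra_axioms hom]
  and \<phi>_finsum = star_hom_finsum[OF A.seminormed_star_algebra_axioms seminormed_star_algebra_axioms hom]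

lemma entry: "X \<in> carrier M \<Longrightarrow> a < k \<Longrightarrow> b < k \<Longrightarrow> X $$ (a, b) \<in> carrier A"
  by (simp add: matrix_algebra_simps)

lemma \<phi>_entry: "X \<in> carrier M \<Longrightarrow> a < k \<Longrightarrow> b < k \<Longrightarrow> \<phi> (X $$ (a, b)) \<in> carrier C"
  by (simp add: entry \<phi>)

lemma amplify_closed: "X \<in> carrier M \<Longrightarrow> amplify \<phi> X \<in> carrier C"
  by (auto simp: amplify_def e_closed \<phi>_entry intro!: finsum_closed)

text \<open>Commutation moves \<open>\<phi> x\<close> past the second matrix unit, so
  \<open>e a b \<phi>(x) e c d \<phi>(y)\<close> is \<open>e a d \<phi>(x y)\<close> for b = c and
  zero otherwise. What remains is the matrix product with its sums in another order.\<close>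

lemma amplify_mult:
  assumes X: "X \<in> carrier M" and Y: "Y \<in> carrier M"
  shows "amplify \<phi> (X \<otimes>\<^bsub>M\<^esub> Y) = amplify \<phi> X \<otimes> amplify \<phi> Y"
proof -
  let ?K = "{..<k}"
  note [simp] = e_closed \<phi>_entry[OF X] \<phi>_entry[OF Y] entry[OF X] entry[OF Y]
  have term_eq: "e a b \<otimes> \<phi> (X $$ (a, b)) \<otimes> (e c d \<otimes> \<phi> (Y $$ (c, d)))
      = (if b = c then e a d \<otimes> \<phi> (X $$ (a, b) \<otimes>\<^bsub>A\<^esub> Y $$ (b, d)) else \<zero>)"
    if [simp]: "a < k" "b < k" "c < k" "d < k" for a b c d
  proof -
    have "e a b \<otimes> \<phi> (X $$ (a, b)) \<otimes> (e c d \<otimes> \<phi> (Y $$ (c, d)))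
        = e a b \<otimes> (\<phi> (X $$ (a, b)) \<otimes> e c d) \<otimes> \<phi> (Y $$ (c, d))"
      by (simp add: m_assoc)
    also have "\<dots> = (e a b \<otimes> e c d) \<otimes> (\<phi> (X $$ (a, b)) \<otimes> \<phi> (Y $$ (c, d)))"
      by (simp add: m_assoc flip: commute)
    finally show ?thesis by (simp add: e_mult \<phi>)
  qed
  have inner: "(\<Oplus>d\<in>?K. e a b \<otimes> \<phi> (X $$ (a, b)) \<otimes> (e c d \<otimes> \<phi> (Y $$ (c, d))))
      = (if b = c then (\<Oplus>d\<in>?K. e a d \<otimes> \<phi> (X $$ (a, b) \<otimes>\<^bsub>A\<^esub> Y $$ (b, d))) else \<zero>)"
    if [simp]: "a < k" "b < k" "c < k" for a b c
  proof -
    have "(\<Oplus>d\<in>?K. e a b \<otimes> \<phi> (X $$ (a, b)) \<otimes> (e c d \<otimes> \<phi> (Y $$ (c, d))))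
        = (\<Oplus>d\<in>?K. if b = c then e a d \<otimes> \<phi> (X $$ (a, b) \<otimes>\<^bsub>A\<^esub> Y $$ (b, d)) else \<zero>)"
      by (intro finsum_cong' refl term_eq) (auto simp: \<phi>)
    then show ?thesis by (cases "b = c") auto
  qed
  have "amplify \<phi> X \<otimes> amplify \<phi> Y = (\<Oplus>a\<in>?K. \<Oplus>b\<in>?K. e a b \<otimes> \<phi> (X $$ (a, b)) \<otimes> amplify \<phi> Y)"
    unfolding amplify_def[of \<phi> X] by (intro finsum2_ldistr) (auto simp: amplify_closed[OF Y])
  also have "\<dots> = (\<Oplus>a\<in>?K. \<Oplus>b\<in>?K. \<Oplus>c\<in>?K. \<Oplus>d\<in>?K. e a b \<otimes> \<phi> (X $$ (a, b)) \<otimes> (e c d \<otimes> \<phi> (Y $$ (c, d))))"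
    unfolding amplify_def[of \<phi> Y]
    by (intro finsum_cong' refl finsum2_rdistr) (auto intro!: finsum_closed)
  also have "\<dots> = (\<Oplus>a\<in>?K. \<Oplus>b\<in>?K. \<Oplus>c\<in>?K. if b = c then
      (\<Oplus>d\<in>?K. e a d \<otimes> \<phi> (X $$ (a, b) \<otimes>\<^bsub>A\<^esub> Y $$ (b, d))) else \<zero>)"
    by (intro finsum_cong' refl inner) (auto simp: \<phi> intro!: finsum_closed)
  also have "\<dots> = (\<Oplus>a\<in>?K. \<Oplus>b\<in>?K. \<Oplus>d\<in>?K. e a d \<otimes> \<phi> (X $$ (a, b) \<otimes>\<^bsub>A\<^esub> Y $$ (b, d)))"
    by (intro finsum_cong' refl finsum_delta) (auto simp: \<phi> intro!: finsum_closed)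
  also have "\<dots> = (\<Oplus>a\<in>?K. \<Oplus>d\<in>?K. \<Oplus>b\<in>?K. e a d \<otimes> \<phi> (X $$ (a, b) \<otimes>\<^bsub>A\<^esub> Y $$ (b, d)))"
    by (intro finsum_cong' refl finsum_swap) (auto simp: \<phi> intro!: finsum_closed)
  also have "\<dots> = (\<Oplus>a\<in>?K. \<Oplus>d\<in>?K. e a d \<otimes> \<phi> (\<Oplus>\<^bsub>A\<^esub>b\<in>?K. X $$ (a, b) \<otimes>\<^bsub>A\<^esub> Y $$ (b, d)))"
    by (intro finsum_cong' refl) (auto simp: \<phi> \<phi>_finsum finsum_rdistr Pi_def intro!: finsum_closed)
  also have "\<dots> = amplify \<phi> (X \<otimes>\<^bsub>M\<^esub> Y)"
    unfolding amplify_def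
    by (intro finsum_cong' refl)
      (auto simp: \<phi> \<phi>_finsum matrix_algebra_simps Pi_def intro!: finsum_closed)
  finally show ?thesis ..
qed

lemma amplify_add:
  assumes X: "X \<in> carrier M" and Y: "Y \<in> carrier M"
  shows "amplify \<phi> (X \<oplus>\<^bsub>M\<^esub> Y) = amplify \<phi> X \<oplus> amplify \<phi> Y"
proof -
  let ?K = "{..<k}"
  note [simp] = e_closed \<phi>_entry[OF X] \<phi>_entry[OF Y] entry[OF X] entry[OF Y]
  have "amplify \<phi> (X \<oplus>\<^bsub>M\<^esub> Y)
      = (\<Oplus>a\<in>?K. \<Oplus>b\<in>?K. e a b \<otimes> \<phi> (X $$ (a, b)) \<oplus> e a b \<otimes> \<phi> (Y $$ (a, b)))"
    unfolding amplify_def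
    by (intro finsum_cong' refl) (auto simp: \<phi> r_distr matrix_algebra_simps intro!: finsum_closed)
  also have "\<dots> = (\<Oplus>a\<in>?K. (\<Oplus>b\<in>?K. e a b \<otimes> \<phi> (X $$ (a, b))) \<oplus> (\<Oplus>b\<in>?K. e a b \<otimes> \<phi> (Y $$ (a, b))))"
    by (intro finsum_cong' refl finsum_addf) (auto intro!: finsum_closed)
  also have "\<dots> = amplify \<phi> X \<oplus> amplify \<phi> Y"
    unfolding amplify_def by (intro finsum_addf) (auto intro!: finsum_closed)
  finally show ?thesis .
qed

lemma amplify_one: "amplify \<phi> \<one>\<^bsub>M\<^esub> = \<one>"
proof -
  let ?K = "{..<k}"
  have "amplify \<phi> \<one>\<^bsub>M\<^esub> = (\<Oplus>a\<in>?K. \<Oplus>b\<in>?K. if a = b then e a a else \<zero>)"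
    unfolding amplify_def
    by (intro finsum_cong' refl) (auto simp: \<phi> \<phi>_zero e_closed matrix_algebra_simps intro!: finsum_closed)
  also have "\<dots> = (\<Oplus>a\<in>?K. e a a)"
    by (intro finsum_cong' refl finsum_delta) (auto simp: e_closed)
  finally show ?thesis by (simp add: e_sum)
qed

lemma amplify_smult:
  assumes X: "X \<in> carrier M"
  shows "amplify \<phi> (c \<odot>\<^bsub>M\<^esub> X) = c \<odot> amplify \<phi> X"
proof -
  let ?K = "{..<k}"
  note [simp] = e_closed \<phi>_entry[OF X] entry[OF X]
  have X': "X \<in> carrier_mat k k" using X by (simp add: matrix_algebra_simps)
  have "amplify \<phi> (c \<odot>\<^bsub>M\<^esub> X) = (\<Oplus>a\<in>?K. \<Oplus>b\<in>?K. c \<odot> (e a b \<otimes> \<phi> (X $$ (a, b))))"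
    unfolding amplify_def using X'
    by (intro finsum_cong' refl) (auto simp: \<phi> smult_mult_right matrix_algebra_simps intro!: finsum_closed)
  also have "\<dots> = (\<Oplus>a\<in>?K. c \<odot> (\<Oplus>b\<in>?K. e a b \<otimes> \<phi> (X $$ (a, b))))"
    by (intro finsum_cong' refl smult_finsum[symmetric]) (auto intro!: finsum_closed)
  also have "\<dots> = c \<odot> amplify \<phi> X"
    unfolding amplify_def by (intro smult_finsum[symmetric]) (auto intro!: finsum_closed)
  finally show ?thesis .
qed

lemma amplify_adj:
  assumes X: "X \<in> carrier M"
  shows "amplify \<phi> (adj M X) = adj C (amplify \<phi> X)"
proof -
  let ?K = "{..<k}"
  note [simp] = e_closed \<phi>_entry[OF X] entry[OF X]
  have "adj C (amplify \<phi> X) = (\<Oplus>a\<in>?K. adj C (\<Oplus>b\<in>?K. e a b \<otimes> \<phi> (X $$ (a, b))))"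
    unfolding amplify_def by (intro adj_finsum) (auto intro!: finsum_closed)
  also have "\<dots> = (\<Oplus>a\<in>?K. \<Oplus>b\<in>?K. adj C (e a b \<otimes> \<phi> (X $$ (a, b))))"
    by (intro finsum_cong' refl adj_finsum) (auto intro!: finsum_closed)
  \<comment> \<open>Exchanging the sums matches the transposition in the adjoint of a
    matrix.\<close>
  also have "\<dots> = (\<Oplus>b\<in>?K. \<Oplus>a\<in>?K. adj C (e a b \<otimes> \<phi> (X $$ (a, b))))"
    by (intro finsum_swap) auto
  also have "\<dots> = amplify \<phi> (adj M X)"
    unfolding amplify_def
    by (intro finsum_cong' refl)
      (auto simp: adj_mult e_adj commute matrix_algebra_simps \<phi>(1) intro!: finsum_closed simp flip: \<phi>(6))
  finally show ?thesis ..
qed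

lemma amplify_star_hom: "amplify \<phi> \<in> star_hom M C"
  by (intro star_homI amplify_closed amplify_mult amplify_add amplify_one amplify_smult amplify_adj)

lemma amplify_mat_tensor:
  assumes B: "B \<in> carrier_mat k k" and x: "x \<in> carrier A"
  shows "amplify \<phi> (mat_tensor A B x) = combination B \<otimes> \<phi> x"
proof -
  let ?K = "{..<k}"
  have "amplify \<phi> (mat_tensor A B x) = (\<Oplus>a\<in>?K. \<Oplus>b\<in>?K. (B $$ (a, b) \<odot> e a b) \<otimes> \<phi> x)"
    unfolding amplify_def using B x
    by (intro finsum_cong' refl)
      (auto simp: e_closed \<phi> mat_tensor_def smult_mult_left smult_mult_right intro!: finsum_closed)
  also have "\<dots> = combination B \<otimes> \<phi> x"
    unfolding combination_def using x by (intro finsum2_ldistr[symmetric]) (auto simp: e_closed \<phi>)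
  finally show ?thesis .
qed

end

text \<open>The set of \<open>x\<close> for which \<open>\<phi> x\<close> commutes with \<open>F\<close> is a C*-subalgebra.\<close>

lemma star_hom_commute_if_commute_on_generators:
  fixes A :: "'a cstar" and C :: "'c cstar"
  assumes A: "unital_cstar_algebra A" and C: "unital_cstar_algebra C" and \<phi>: "\<phi> \<in> star_hom A C"
    and G: "cstar_generated A G = carrier A" "G \<subseteq> carrier A"
    and F: "F \<subseteq> carrier C" "\<And>f. f \<in> F \<Longrightarrow> adj C f \<in> F"
    and comm: "\<And>x f. x \<in> G \<Longrightarrow> f \<in> F \<Longrightarrow> f \<otimes>\<^bsub>C\<^esub> \<phi> x = \<phi> x \<otimes>\<^bsub>C\<^esub> f"
    and xf: "x \<in> carrier A" "f \<in> F"
  shows "f \<otimes>\<^bsub>C\<^esub> \<phi> x = \<phi> x \<otimes>\<^bsub>C\<^esub> f"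
proof -
  interpret A: unital_cstar_algebra A by fact
  interpret C: unital_cstar_algebra C by fact
  interpret A: Metric_space "carrier A" "cdist A" by (rule A.Metric_space_cdist)
  note h = star_homE(2-)[OF \<phi>]
    and h_minus = star_hom_minus[OF A.seminormed_star_algebra_axioms C.seminormed_star_algebra_axioms \<phi>]
    and h_zero = star_hom_zero[OF A.seminormed_star_algebra_axioms C.seminormed_star_algebra_axioms \<phi>]
  note FC [simp] = subsetD[OF F(1)]
  define S where "S = {x \<in> carrier A. \<forall>f\<in>F. f \<otimes>\<^bsub>C\<^esub> \<phi> x = \<phi> x \<otimes>\<^bsub>C\<^esub> f}"
  have S_smult: "c \<odot>\<^bsub>A\<^esub> x \<in> S" if "x \<in> S" for c x
    using that by (auto simp: S_def h C.smult_mult_left C.smult_mult_right)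
  have S_add: "x \<oplus>\<^bsub>A\<^esub> y \<in> S" if "x \<in> S" "y \<in> S" for x y
    using that by (auto simp: S_def h C.l_distr C.r_distr)
  have S_mult: "x \<otimes>\<^bsub>A\<^esub> y \<in> S" if "x \<in> S" "y \<in> S" for x y
  proof -
    have "f \<otimes>\<^bsub>C\<^esub> (\<phi> x \<otimes>\<^bsub>C\<^esub> \<phi> y) = \<phi> x \<otimes>\<^bsub>C\<^esub> \<phi> y \<otimes>\<^bsub>C\<^esub> f" if f: "f \<in> F" for f
    proof -
      have xy: "x \<in> carrier A" "y \<in> carrier A"
        and "f \<otimes>\<^bsub>C\<^esub> \<phi> x = \<phi> x \<otimes>\<^bsub>C\<^esub> f" "f \<otimes>\<^bsub>C\<^esub> \<phi> y = \<phi> y \<otimes>\<^bsub>C\<^esub> f"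
        using \<open>x \<in> S\<close> \<open>y \<in> S\<close> f by (auto simp: S_def)
      then show ?thesis using f h(1)[OF xy(1)] h(1)[OF xy(2)] by (metis C.m_assoc FC)
    qed
    then show ?thesis using that by (auto simp: S_def h)
  qed
  have S_adj: "adj A x \<in> S" if x: "x \<in> S" for x
  proof -
    have xA: "x \<in> carrier A" using x by (simp add: S_def)
    \<comment> \<open>The adjoint of the relation for \<open>adj C f\<close>; here F has to be
      closed under adjoints.\<close>
    have "f \<otimes>\<^bsub>C\<^esub> adj C (\<phi> x) = adj C (\<phi> x) \<otimes>\<^bsub>C\<^esub> f" if f: "f \<in> F" for f
    proof -
      have "adj C f \<otimes>\<^bsub>C\<^esub> \<phi> x = \<phi> x \<otimes>\<^bsub>C\<^esub> adj C f" using x F(2)[OF f] by (simp add: S_def)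
      then have "adj C (adj C f \<otimes>\<^bsub>C\<^esub> \<phi> x) = adj C (\<phi> x \<otimes>\<^bsub>C\<^esub> adj C f)" by simp
      then show ?thesis using f h(1)[OF xA] by (simp add: C.adj_mult C.adj_adj)
    qed
    then show ?thesis using xA by (simp add: S_def h)
  qed
  have S_one: "\<one>\<^bsub>A\<^esub> \<in> S" by (auto simp: S_def h)
  have S_zero: "\<zero>\<^bsub>A\<^esub> \<in> S" by (auto simp: S_def h_zero)
  have "closedin A.mtopology S"
    unfolding A.metric_closedin_iff_sequentially_closed
  proof (intro conjI allI impI)
    show "S \<subseteq> carrier A" by (auto simp: S_def)
    fix \<sigma> l
    assume "range \<sigma> \<subseteq> S \<and> limitin A.mtopology \<sigma> l sequentially"
    then have \<sigma>: "\<And>n. \<sigma> n \<in> S" and l: "l \<in> carrier A" and lim: "(\<lambda>n. cdist A (\<sigma> n) l) \<longlonglongrightarrow> 0"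
      by (auto simp: A.limitin_metric_dist_null)
    have \<sigma>A: "\<sigma> n \<in> carrier A" for n using \<sigma>[of n] by (simp add: S_def)
    note [simp] = h(1)[OF \<sigma>A] h(1)[OF l]
    have "f \<otimes>\<^bsub>C\<^esub> \<phi> l = \<phi> l \<otimes>\<^bsub>C\<^esub> f" if f: "f \<in> F" for f
    proof (rule C.eq_if_cnorm_minus_le_null_sequence)
      \<comment> \<open>The factor 2 counts the two places of the commutator where
        \<open>\<phi> l\<close> is replaced by \<open>\<phi> (\<sigma> n)\<close>; contractivity of
        \<phi> bounds the distance in C by the one in A.\<close>
      show "(\<lambda>n. 2 * cnorm C f * cdist A (\<sigma> n) l) \<longlonglongrightarrow> 0"
        using tendsto_mult_left[OF lim, of "2 * cnorm C f"] by simp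
      fix n
      have comm: "f \<otimes>\<^bsub>C\<^esub> \<phi> (\<sigma> n) = \<phi> (\<sigma> n) \<otimes>\<^bsub>C\<^esub> f" using \<sigma> f by (simp add: S_def)
      have "f \<otimes>\<^bsub>C\<^esub> \<phi> l \<ominus>\<^bsub>C\<^esub> \<phi> l \<otimes>\<^bsub>C\<^esub> f
          = f \<otimes>\<^bsub>C\<^esub> (\<phi> l \<ominus>\<^bsub>C\<^esub> \<phi> (\<sigma> n)) \<oplus>\<^bsub>C\<^esub> (f \<otimes>\<^bsub>C\<^esub> \<phi> (\<sigma> n) \<ominus>\<^bsub>C\<^esub> \<phi> (\<sigma> n) \<otimes>\<^bsub>C\<^esub> f)
            \<oplus>\<^bsub>C\<^esub> (\<phi> (\<sigma> n) \<ominus>\<^bsub>C\<^esub> \<phi> l) \<otimes>\<^bsub>C\<^esub> f"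
        using FC[OF f] h(1)[OF \<sigma>A[of n]] h(1)[OF l] by algebra
      also have "\<dots> = f \<otimes>\<^bsub>C\<^esub> (\<phi> l \<ominus>\<^bsub>C\<^esub> \<phi> (\<sigma> n)) \<oplus>\<^bsub>C\<^esub> (\<phi> (\<sigma> n) \<ominus>\<^bsub>C\<^esub> \<phi> l) \<otimes>\<^bsub>C\<^esub> f"
        using f by (simp add: comm C.minus_eq_zero_iff)
      finally have "cnorm C (f \<otimes>\<^bsub>C\<^esub> \<phi> l \<ominus>\<^bsub>C\<^esub> \<phi> l \<otimes>\<^bsub>C\<^esub> f)
          \<le> cnorm C (f \<otimes>\<^bsub>C\<^esub> (\<phi> l \<ominus>\<^bsub>C\<^esub> \<phi> (\<sigma> n))) + cnorm C ((\<phi> (\<sigma> n) \<ominus>\<^bsub>C\<^esub> \<phi> l) \<otimes>\<^bsub>C\<^esub> f)"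
        using f by (simp add: C.cnorm_triangle)
      also have "\<dots> \<le> cnorm C f * cnorm C (\<phi> l \<ominus>\<^bsub>C\<^esub> \<phi> (\<sigma> n)) + cnorm C (\<phi> (\<sigma> n) \<ominus>\<^bsub>C\<^esub> \<phi> l) * cnorm C f"
        using f by (intro add_mono C.cnorm_mult) auto
      also have "\<dots> = 2 * cnorm C f * cnorm C (\<phi> (\<sigma> n) \<ominus>\<^bsub>C\<^esub> \<phi> l)"
        by (simp add: C.cnorm_minus_commute[of "\<phi> l"])
      also have "\<dots> \<le> 2 * cnorm C f * cdist A (\<sigma> n) l"
        using star_hom_contractive[OF A C.seminormed_star_algebra_axioms \<phi>, of "\<sigma> n \<ominus>\<^bsub>A\<^esub> l"]
          l \<sigma>A C.cnorm_nonneg[OF FC[OF f]]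
        by (intro mult_left_mono) (auto simp: cdist_def h_minus)
      finally show "cnorm C (f \<otimes>\<^bsub>C\<^esub> \<phi> l \<ominus>\<^bsub>C\<^esub> \<phi> l \<otimes>\<^bsub>C\<^esub> f) \<le> 2 * cnorm C f * cdist A (\<sigma> n) l" .
    qed (use f in auto)
    then show "l \<in> S" using l by (simp add: S_def)
  qed
  moreover have "subgroup S (add_monoid A)"
  proof (rule A.add.subgroupI)
    show "\<ominus>\<^bsub>A\<^esub> x \<in> S" if "x \<in> S" for x
      using S_smult[OF that, of "-1"] that by (simp add: A.smult_minus_one S_def)
  qed (use S_zero S_add in \<open>auto simp: S_def\<close>)
  moreover have "submonoid S A"
    by (rule submonoid.intro) (use S_one S_mult in \<open>auto simp: S_def\<close>)
  ultimately have "cstar_subalgebra S A"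
    using S_smult S_adj by (simp add: cstar_subalgebra_def)
  moreover have "G \<subseteq> S" using G(2) comm by (auto simp: S_def)
  ultimately have "carrier A \<subseteq> S" unfolding G(1)[symmetric] cstar_generated_def by blast
  then show ?thesis using xf by (auto simp: S_def)
qed

lemma (in cstar_sequence) seq_finsum:
  assumes "f \<in> I \<rightarrow> carrier P"
  shows "finsum P f I i = finsum (D i) (\<lambda>j. f j i) I"
  using assms by (intro P.finsum_additive) (auto simp: D.abelian_monoid_axioms seq_carrierD)

text \<open>The rotation relation holds in \<open>D i\<close> up to an error tending to 0, hence
  exactly in the quotient of the sequence algebra. There the universal property and the commuting
  matrix units give a contractive homomorphism on M_k(A). Since the quotient norm is a limsup, its
  bound by the norm in M_k(A) becomes an eventual bound on the components.\<close>

lemma (in cstar_sequence) amplified_norm_limit: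
  fixes A :: "'b cstar"
  assumes rot: "rotation_algebra \<theta> A u v"
    and M: "unital_cstar_algebra (matrix_algebra k A N)"
    and U: "\<And>i. unitary_elem (D i) (U i)" and V: "\<And>i. unitary_elem (D i) (V i)"
    and UV: "(\<lambda>i. cnorm (D i) (V i \<otimes>\<^bsub>D i\<^esub> U i \<ominus>\<^bsub>D i\<^esub> exp (\<i> * of_real \<theta>) \<odot>\<^bsub>D i\<^esub> (U i \<otimes>\<^bsub>D i\<^esub> V i))) \<longlonglongrightarrow> 0"
    and E: "\<And>i. matrix_units (D i) k (E i)"
    and commU: "\<And>i a b. a < k \<Longrightarrow> b < k \<Longrightarrow> E i a b \<otimes>\<^bsub>D i\<^esub> U i = U i \<otimes>\<^bsub>D i\<^esub> E i a b"
    and commV: "\<And>i a b. a < k \<Longrightarrow> b < k \<Longrightarrow> E i a b \<otimes>\<^bsub>D i\<^esub> V i = V i \<otimes>\<^bsub>D i\<^esub> E i a b"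
    and B: "B0 \<in> carrier_mat k k" "B1 \<in> carrier_mat k k" "B2 \<in> carrier_mat k k"
      "B3 \<in> carrier_mat k k" "B4 \<in> carrier_mat k k"
    and \<epsilon>: "\<epsilon> > 0"
  defines "\<beta> \<equiv> \<lambda>i. matrix_units.combination (D i) k (E i)"
  shows "\<forall>\<^sub>F i in sequentially.
    cnorm (D i) (\<beta> i B0 \<oplus>\<^bsub>D i\<^esub> \<beta> i B1 \<otimes>\<^bsub>D i\<^esub> U i \<oplus>\<^bsub>D i\<^esub> \<beta> i B2 \<otimes>\<^bsub>D i\<^esub> adj (D i) (U i)
        \<oplus>\<^bsub>D i\<^esub> \<beta> i B3 \<otimes>\<^bsub>D i\<^esub> V i \<oplus>\<^bsub>D i\<^esub> \<beta> i B4 \<otimes>\<^bsub>D i\<^esub> adj (D i) (V i))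
    \<le> cnorm (matrix_algebra k A N)
        (mat_tensor A B0 \<one>\<^bsub>A\<^esub>
          \<oplus>\<^bsub>matrix_algebra k A N\<^esub> mat_tensor A B1 u
          \<oplus>\<^bsub>matrix_algebra k A N\<^esub> mat_tensor A B2 (adj A u)
          \<oplus>\<^bsub>matrix_algebra k A N\<^esub> mat_tensor A B3 v
          \<oplus>\<^bsub>matrix_algebra k A N\<^esub> mat_tensor A B4 (adj A v)) + \<epsilon>"
proof -
  interpret A: unital_cstar_algebra A using rot by (simp add: rotation_algebra_def)
  interpret M: unital_cstar_algebra "matrix_algebra k A N" by fact
  interpret E: matrix_units "D i" k "E i" for i by (rule E)
  interpret P: seminormed_cstar_algebra P by (rule seminormed_cstar_algebra_seq)
  define q where "q x = {y \<in> carrier P. cnorm P (x \<ominus>\<^bsub>P\<^esub> y) = 0}" for x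
  interpret Q: cstar_quotient_map P q
    unfolding q_def using P.cstar_quotient_map_class .
  define C where "C = pushforward_cstar P q"
  interpret C: unital_cstar_algebra C
    unfolding C_def by (rule Q.unital_cstar_algebra_B)
  note C_simps = Q.B_simps[folded C_def] and C_carrier = Q.carrier_B[folded C_def]
  have q: "q \<in> star_hom P C" unfolding C_def by (rule Q.q_star_hom)
  have UP: "U \<in> carrier P" and VP: "V \<in> carrier P"
    using U V D.cnorm_unitary_le by (auto intro!: seq_carrierI[where M = 1] simp: unitary_elem_def)
  have EP: "(\<lambda>i. E i a b) \<in> carrier P" if "a < k" "b < k" for a b
    using E.e_closed[OF that] E.cnorm_e_le[OF that] by (rule seq_carrierI)
  have "rotation_pair \<theta> C (q U) (q V)"
  proof -
    have "adj P U \<otimes>\<^bsub>P\<^esub> U = \<one>\<^bsub>P\<^esub>" "U \<otimes>\<^bsub>P\<^esub> adj P U = \<one>\<^bsub>P\<^esub>"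
      "adj P V \<otimes>\<^bsub>P\<^esub> V = \<one>\<^bsub>P\<^esub>" "V \<otimes>\<^bsub>P\<^esub> adj P V = \<one>\<^bsub>P\<^esub>"
      using U V by (auto simp: unitary_elem_def)
    then have "unitary_elem C (q U)" "unitary_elem C (q V)"
      using UP VP by (auto simp: unitary_elem_def C_simps C_carrier)
    \<comment> \<open>An error tending to 0 has limsup 0, so the two sides have the same
      class.\<close>
    moreover have "q (V \<otimes>\<^bsub>P\<^esub> U) = q (exp (\<i> * of_real \<theta>) \<odot>\<^bsub>P\<^esub> (U \<otimes>\<^bsub>P\<^esub> V))" (is "q ?x = q ?y")
    proof (rule Q.q_eqI)
      show xy: "?x \<in> carrier P" "?y \<in> carrier P" using UP VP by auto
      have xy': "?x \<ominus>\<^bsub>P\<^esub> ?y \<in> carrier P" using xy by simp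
      show "cnorm P (?x \<ominus>\<^bsub>P\<^esub> ?y) \<le> 0"
        unfolding seq_cnorm_le_iff[OF xy']
      proof (intro allI impI)
        fix e :: real assume "e > 0"
        from order_tendstoD(2)[OF UV this]
        show "\<forall>\<^sub>F i in sequentially. cnorm (D i) ((?x \<ominus>\<^bsub>P\<^esub> ?y) i) \<le> 0 + e"
          by eventually_elim (simp add: seq_minus[OF xy])
      qed
    qed
    ultimately show ?thesis using UP VP by (simp add: rotation_pair_def C_simps)
  qed
  then obtain \<phi> where \<phi>: "\<phi> \<in> star_hom A C" "\<phi> u = q U" "\<phi> v = q V"
    using rotation_algebra_universal[OF rot C.unital_cstar_algebra_axioms] by blast
  define e where "e a b = q (\<lambda>i. E i a b)" for a b
  interpret e: matrix_units C k e
  proof (rule matrix_units.intro[OF C.seminormed_star_algebra_axioms], rule matrix_units_axioms.intro)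
    show "e a b \<in> carrier C" if "a < k" "b < k" for a b
      using EP[OF that] by (simp add: e_def C_carrier)
    show "e a b \<otimes>\<^bsub>C\<^esub> e c d = (if b = c then e a d else \<zero>\<^bsub>C\<^esub>)" if "a < k" "b < k" "c < k" "d < k" for a b c d
    proof -
      have "(\<lambda>i. E i a b) \<otimes>\<^bsub>P\<^esub> (\<lambda>i. E i c d) = (if b = c then (\<lambda>i. E i a d) else \<zero>\<^bsub>P\<^esub>)"
        using that by (auto simp: E.e_mult)
      then show ?thesis using that by (simp add: e_def C_simps EP)
    qed
    show "adj C (e a b) = e b a" if "a < k" "b < k" for a b
    proof -
      have "adj P (\<lambda>i. E i a b) = (\<lambda>i. E i b a)" using that by (auto simp: E.e_adj)
      then show ?thesis using that by (simp add: e_def C_simps EP)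
    qed
    show "(\<Oplus>\<^bsub>C\<^esub>a\<in>{..<k}. e a a) = \<one>\<^bsub>C\<^esub>"
    proof -
      have "finsum P (\<lambda>a i. E i a a) {..<k} = \<one>\<^bsub>P\<^esub>"
        by (rule ext) (simp add: seq_finsum EP E.e_sum)
      then show ?thesis
        using star_hom_finsum[OF P.seminormed_star_algebra_axioms C.seminormed_star_algebra_axioms q,
            of "\<lambda>a i. E i a a" "{..<k}"] EP
        by (simp add: e_def C_simps)
    qed
  qed
  have uv: "u \<in> carrier A" "v \<in> carrier A"
    using rot by (auto simp: rotation_algebra_def rotation_pair_def unitary_elem_def)
  define F where "F = {e a b | a b. a < k \<and> b < k}"
  \<comment> \<open>Commutation is assumed for U and V only; it spreads to the whole image of A
    because u and v generate A and the matrix units are closed under adjoints.\<close>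
  interpret h: commuting_star_hom C k e A \<phi> N
  proof (rule commuting_star_hom.intro[OF e.matrix_units_axioms A.seminormed_star_algebra_axioms],
      rule commuting_star_hom_axioms.intro[OF \<phi>(1)])
    fix x a b assume x: "x \<in> carrier A" and ab: "a < k" "b < k"
    show "e a b \<otimes>\<^bsub>C\<^esub> \<phi> x = \<phi> x \<otimes>\<^bsub>C\<^esub> e a b"
    proof (rule star_hom_commute_if_commute_on_generators[where G = "{u, v}" and F = F,
          OF A.unital_cstar_algebra_axioms C.unital_cstar_algebra_axioms \<phi>(1) _ _ _ _ _ x])
      show "cstar_generated A {u, v} = carrier A" using rot by (simp add: rotation_algebra_def)
      show "adj C f \<in> F" if "f \<in> F" for f
      proof -
        obtain c d where cd: "f = e c d" "c < k" "d < k" using \<open>f \<in> F\<close> unfolding F_def by blast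
        then have "adj C f = e d c" by (simp add: e.e_adj)
        then show ?thesis using cd unfolding F_def by blast
      qed
      have "(\<lambda>i. E i a b) \<otimes>\<^bsub>P\<^esub> U = U \<otimes>\<^bsub>P\<^esub> (\<lambda>i. E i a b)"
        "(\<lambda>i. E i a b) \<otimes>\<^bsub>P\<^esub> V = V \<otimes>\<^bsub>P\<^esub> (\<lambda>i. E i a b)" if "a < k" "b < k" for a b
        using that by (auto simp: commU commV)
      then show "f \<otimes>\<^bsub>C\<^esub> \<phi> x = \<phi> x \<otimes>\<^bsub>C\<^esub> f" if "x \<in> {u, v}" "f \<in> F" for x f
        using that \<phi>(2,3) UP VP by (auto simp: F_def e_def C_simps EP)
    qed (use uv e.e_closed ab in \<open>auto simp: F_def\<close>)
  qed
  \<comment> \<open>The elements \<open>\<beta> i B\<close> regrouped as one sequence for each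
    matrix B, whose class is the combination formed in the quotient.\<close>
  define \<gamma> where "\<gamma> B i = \<beta> i B" for B i
  have \<gamma>: "\<gamma> B \<in> carrier P" "q (\<gamma> B) = e.combination B" for B
  proof -
    define s where "s = (\<Oplus>\<^bsub>P\<^esub>a\<in>{..<k}. \<Oplus>\<^bsub>P\<^esub>b\<in>{..<k}. B $$ (a, b) \<odot>\<^bsub>P\<^esub> (\<lambda>i. E i a b))"
    have inP: "(\<Oplus>\<^bsub>P\<^esub>b\<in>{..<k}. B $$ (a, b) \<odot>\<^bsub>P\<^esub> (\<lambda>i. E i a b)) \<in> carrier P" if "a < k" for a
      using that by (auto simp: EP intro!: P.finsum_closed)
    have s: "s = \<gamma> B"
    proof (rule ext)
      fix i
      have "s i = (\<Oplus>\<^bsub>D i\<^esub>a\<in>{..<k}. (\<Oplus>\<^bsub>P\<^esub>b\<in>{..<k}. B $$ (a, b) \<odot>\<^bsub>P\<^esub> (\<lambda>i. E i a b)) i)"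
        unfolding s_def using inP by (intro seq_finsum) auto
      also have "\<dots> = (\<Oplus>\<^bsub>D i\<^esub>a\<in>{..<k}. \<Oplus>\<^bsub>D i\<^esub>b\<in>{..<k}. B $$ (a, b) \<odot>\<^bsub>D i\<^esub> E i a b)"
        by (intro D.finsum_cong' refl) (auto simp: seq_finsum EP E.e_closed Pi_def intro!: D.finsum_closed)
      finally show "s i = \<gamma> B i" by (simp add: \<gamma>_def \<beta>_def E.combination_def)
    qed
    show "\<gamma> B \<in> carrier P" unfolding s[symmetric] s_def using inP by (auto intro!: P.finsum_closed)
    have "q s = (\<Oplus>\<^bsub>C\<^esub>a\<in>{..<k}. q (\<Oplus>\<^bsub>P\<^esub>b\<in>{..<k}. B $$ (a, b) \<odot>\<^bsub>P\<^esub> (\<lambda>i. E i a b)))"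
      unfolding s_def using inP
      by (intro star_hom_finsum[OF P.seminormed_star_algebra_axioms C.seminormed_star_algebra_axioms q]) auto
    also have "\<dots> = (\<Oplus>\<^bsub>C\<^esub>a\<in>{..<k}. \<Oplus>\<^bsub>C\<^esub>b\<in>{..<k}. q (B $$ (a, b) \<odot>\<^bsub>P\<^esub> (\<lambda>i. E i a b)))"
      by (intro C.finsum_cong' refl
          star_hom_finsum[OF P.seminormed_star_algebra_axioms C.seminormed_star_algebra_axioms q])
        (auto simp: EP intro!: C.finsum_closed star_homE(2)[OF q])
    also have "\<dots> = e.combination B"
      unfolding e.combination_def e_def
      by (intro C.finsum_cong' refl) (auto simp: EP C_simps intro!: C.finsum_closed star_homE(2)[OF q])
    finally show "q (\<gamma> B) = e.combination B" by (simp add: s)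
  qed
  define X where "X = \<gamma> B0 \<oplus>\<^bsub>P\<^esub> \<gamma> B1 \<otimes>\<^bsub>P\<^esub> U \<oplus>\<^bsub>P\<^esub> \<gamma> B2 \<otimes>\<^bsub>P\<^esub> adj P U \<oplus>\<^bsub>P\<^esub> \<gamma> B3 \<otimes>\<^bsub>P\<^esub> V \<oplus>\<^bsub>P\<^esub> \<gamma> B4 \<otimes>\<^bsub>P\<^esub> adj P V"
  have X: "X \<in> carrier P" using \<gamma>(1) UP VP by (simp add: X_def)
  let ?p = "mat_tensor A B0 \<one>\<^bsub>A\<^esub> \<oplus>\<^bsub>h.M\<^esub> mat_tensor A B1 u \<oplus>\<^bsub>h.M\<^esub> mat_tensor A B2 (adj A u)
    \<oplus>\<^bsub>h.M\<^esub> mat_tensor A B3 v \<oplus>\<^bsub>h.M\<^esub> mat_tensor A B4 (adj A v)"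
  have p: "?p \<in> carrier h.M" using B uv by (simp add: A.mat_tensor_closed)
  have "e.amplify \<phi> ?p = q X"
    using B uv UP VP \<gamma>(1)
    by (simp add: h.amplify_add A.mat_tensor_closed h.amplify_mat_tensor h.\<phi> \<phi>(2,3) X_def C_simps
        flip: \<gamma>(2))
  then have "cnorm P X \<le> cnorm h.M ?p"
    using star_hom_contractive[OF M C.seminormed_star_algebra_axioms h.amplify_star_hom p] X
    by (simp add: C_simps)
  with seq_cnorm_eventually[OF X \<epsilon>] show ?thesis
    by (auto simp: X_def \<gamma>_def elim!: eventually_mono)
qed

section \<open>Matrices over a C*-algebra\<close>

lemma index_mult_mat_sum:
  assumes "A \<in> carrier_mat n m" "B \<in> carrier_mat m l" "i < n" "j < l"
  shows "(A * B) $$ (i, j) = (\<Sum>t<m. A $$ (i, t) * B $$ (t, j))"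
  using assms by (auto simp: scalar_prod_def atLeast0LessThan intro!: sum.cong)

definition adjoint_mat :: "complex mat \<Rightarrow> complex mat" where
  "adjoint_mat B = map_mat cnj (transpose_mat B)"

lemma adjoint_mat_carrier [simp]: "B \<in> carrier_mat n m \<Longrightarrow> adjoint_mat B \<in> carrier_mat m n"
  by (simp add: adjoint_mat_def)

lemma adjoint_mat_index [simp]:
  "B \<in> carrier_mat n m \<Longrightarrow> i < m \<Longrightarrow> j < n \<Longrightarrow> adjoint_mat B $$ (i, j) = cnj (B $$ (j, i))"
  by (simp add: adjoint_mat_def)

context seminormed_star_algebra
begin

lemma mat_tensor_mult:
  assumes "B \<in> carrier_mat k k" "B' \<in> carrier_mat k k" "x \<in> carrier A" "y \<in> carrier A"
  shows "mat_tensor A B x \<otimes>\<^bsub>matrix_algebra k A N\<^esub> mat_tensor A B' y = mat_tensor A (B * B') (x \<otimes> y)"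
proof (rule eq_matI)
  fix i j assume "i < dim_row (mat_tensor A (B * B') (x \<otimes> y))" "j < dim_col (mat_tensor A (B * B') (x \<otimes> y))"
  then have ij: "i < k" "j < k" using assms by (auto simp: mat_tensor_def)
  have "(mat_tensor A B x \<otimes>\<^bsub>matrix_algebra k A N\<^esub> mat_tensor A B' y) $$ (i, j)
      = (\<Oplus>l\<in>{..<k}. mat_tensor A B x $$ (i, l) \<otimes> mat_tensor A B' y $$ (l, j))"
    using ij by (simp add: matrix_algebra_simps)
  also have "\<dots> = (\<Oplus>l\<in>{..<k}. (B $$ (i, l) * B' $$ (l, j)) \<odot> (x \<otimes> y))"
    using assms ij by (intro finsum_cong' refl)
      (auto simp: mat_tensor_def smult_mult_left smult_mult_right smult_smult mult.commute)
  also have "\<dots> = (\<Sum>l<k. B $$ (i, l) * B' $$ (l, j)) \<odot> (x \<otimes> y)"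
    using assms by (intro finsum_smult) auto
  also have "\<dots> = (B * B') $$ (i, j) \<odot> (x \<otimes> y)"
    using assms ij by (simp only: index_mult_mat_sum)
  finally show "(mat_tensor A B x \<otimes>\<^bsub>matrix_algebra k A N\<^esub> mat_tensor A B' y) $$ (i, j)
      = mat_tensor A (B * B') (x \<otimes> y) $$ (i, j)"
    using assms ij by (simp add: mat_tensor_def)
qed (use assms in \<open>auto simp: matrix_algebra_simps mat_tensor_def\<close>)

lemma mat_tensor_add:
  assumes "B \<in> carrier_mat k k" "B' \<in> carrier_mat k k" "x \<in> carrier A"
  shows "mat_tensor A B x \<oplus>\<^bsub>matrix_algebra k A N\<^esub> mat_tensor A B' x = mat_tensor A (B + B') x"
  using assms by (intro eq_matI) (auto simp: matrix_algebra_simps mat_tensor_def smult_l_distr)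

lemma mat_tensor_smult:
  assumes "B \<in> carrier_mat k k" "x \<in> carrier A"
  shows "c \<odot>\<^bsub>matrix_algebra k A N\<^esub> mat_tensor A B x = mat_tensor A (c \<cdot>\<^sub>m B) x"
  using assms by (intro eq_matI) (auto simp: matrix_algebra_simps mat_tensor_def smult_smult)

lemma mat_tensor_smult_right:
  assumes "B \<in> carrier_mat k k" "x \<in> carrier A"
  shows "mat_tensor A B (c \<odot> x) = c \<odot>\<^bsub>matrix_algebra k A N\<^esub> mat_tensor A B x"
  using assms by (intro eq_matI) (auto simp: matrix_algebra_simps mat_tensor_def smult_smult mult.commute)

lemma mat_tensor_adj:
  assumes "B \<in> carrier_mat k k" "x \<in> carrier A"
  shows "adj (matrix_algebra k A N) (mat_tensor A B x) = mat_tensor A (adjoint_mat B) (adj A x)"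
  using assms by (intro eq_matI) (auto simp: matrix_algebra_simps mat_tensor_def adj_smult adjoint_mat_def)

lemma mat_tensor_one: "mat_tensor A (1\<^sub>m k) \<one> = \<one>\<^bsub>matrix_algebra k A N\<^esub>"
  by (intro eq_matI) (auto simp: matrix_algebra_simps mat_tensor_def)

lemma mat_tensor_zero: "x \<in> carrier A \<Longrightarrow> mat_tensor A (0\<^sub>m k k) x = \<zero>\<^bsub>matrix_algebra k A N\<^esub>"
  by (intro eq_matI) (auto simp: matrix_algebra_simps mat_tensor_def)

lemma finsum_matrix_algebra:
  assumes "abelian_monoid (matrix_algebra k A N)"
    and "F \<in> I \<rightarrow> carrier (matrix_algebra k A N)" "i < k" "j < k"
  shows "finsum (matrix_algebra k A N) F I $$ (i, j) = (\<Oplus>a\<in>I. F a $$ (i, j))"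
proof -
  interpret M: abelian_monoid "matrix_algebra k A N" by fact
  show ?thesis
    by (rule M.finsum_additive[OF abelian_monoid_axioms])
      (use assms in \<open>auto simp: matrix_algebra_simps\<close>)
qed

lemma matrix_algebra_carrier_mat: "X \<in> carrier (matrix_algebra k A N) \<Longrightarrow> X \<in> carrier_mat k k"
  by (simp add: matrix_algebra_simps)

end

section \<open>Kronecker products and matrix units in M_nk(A)\<close>

definition kronecker :: "nat \<Rightarrow> nat \<Rightarrow> complex mat \<Rightarrow> complex mat \<Rightarrow> complex mat" where
  "kronecker n k X Y = mat (n * k) (n * k) (\<lambda>(i, j). X $$ (i div k, j div k) * Y $$ (i mod k, j mod k))"

lemma kronecker_carrier [simp]: "kronecker n k X Y \<in> carrier_mat (n * k) (n * k)"
  by (simp add: kronecker_def)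

lemma div_mod_less:
  assumes "i < n * (k :: nat)"
  shows "i div k < n" "i mod k < k"
proof -
  have "k > 0" using assms by (cases k) auto
  then show "i div k < n" "i mod k < k" using assms by (auto simp: less_mult_imp_div_less)
qed

lemma kronecker_mult:
  assumes X: "X \<in> carrier_mat n n" "X' \<in> carrier_mat n n" and Y: "Y \<in> carrier_mat k k" "Y' \<in> carrier_mat k k"
  shows "kronecker n k X Y * kronecker n k X' Y' = kronecker n k (X * X') (Y * Y')"
proof (rule eq_matI)
  fix i j assume "i < dim_row (kronecker n k (X * X') (Y * Y'))" "j < dim_col (kronecker n k (X * X') (Y * Y'))"
  then have ij: "i < n * k" "j < n * k" by (auto simp: kronecker_def)
  define f where "f t = X $$ (i div k, t div k) * Y $$ (i mod k, t mod k)
    * (X' $$ (t div k, j div k) * Y' $$ (t mod k, j mod k))" for t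
  have "(kronecker n k X Y * kronecker n k X' Y') $$ (i, j) = (\<Sum>t<n * k. f t)"
    unfolding index_mult_mat_sum[OF kronecker_carrier kronecker_carrier ij]
    using ij by (intro sum.cong) (auto simp: kronecker_def f_def)
  \<comment> \<open>The summation index is split into blocks of length k, according to its quotient
    and remainder by k.\<close>
  also have "\<dots> = (\<Sum>p<n. \<Sum>r\<in>{p * k..<p * k + k}. f r)"
    by (rule sum.nat_group[symmetric])
  also have "\<dots> = (\<Sum>p<n. \<Sum>r<k. f (r + p * k))"
  proof (rule sum.cong[OF refl])
    show "(\<Sum>r\<in>{p * k..<p * k + k}. f r) = (\<Sum>r<k. f (r + p * k))" for p
      using sum.shift_bounds_nat_ivl[of f 0 "p * k" k] by (simp add: atLeast0LessThan add.commute)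
  qed
  also have "\<dots> = (\<Sum>p<n. \<Sum>r<k. (X $$ (i div k, p) * X' $$ (p, j div k)) * (Y $$ (i mod k, r) * Y' $$ (r, j mod k)))"
    by (intro sum.cong refl) (auto simp: f_def)
  also have "\<dots> = (X * X') $$ (i div k, j div k) * (Y * Y') $$ (i mod k, j mod k)"
    using X Y ij by (simp add: index_mult_mat_sum div_mod_less sum_product del: index_mult_mat)
  also have "\<dots> = kronecker n k (X * X') (Y * Y') $$ (i, j)"
    using ij by (simp add: kronecker_def)
  finally show "(kronecker n k X Y * kronecker n k X' Y') $$ (i, j) = kronecker n k (X * X') (Y * Y') $$ (i, j)" .
qed (auto simp: kronecker_def)

lemma kronecker_one: "kronecker n k (1\<^sub>m n) (1\<^sub>m k) = 1\<^sub>m (n * k)"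
proof (rule eq_matI)
  fix i j assume "i < dim_row (1\<^sub>m (n * k))" "j < dim_col (1\<^sub>m (n * k))"
  moreover have "i div k = j div k \<and> i mod k = j mod k \<longleftrightarrow> i = j" by (metis div_mult_mod_eq)
  ultimately show "kronecker n k (1\<^sub>m n) (1\<^sub>m k) $$ (i, j) = 1\<^sub>m (n * k) $$ (i, j)"
    by (auto simp: kronecker_def div_mod_less)
qed (auto simp: kronecker_def)

lemma kronecker_adjoint:
  assumes "X \<in> carrier_mat n n" "Y \<in> carrier_mat k k"
  shows "adjoint_mat (kronecker n k X Y) = kronecker n k (adjoint_mat X) (adjoint_mat Y)"
  using assms by (intro eq_matI) (auto simp: kronecker_def adjoint_mat_def div_mod_less)

lemma kronecker_smult_left:
  assumes "X \<in> carrier_mat n n" "Y \<in> carrier_mat k k"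
  shows "kronecker n k (c \<cdot>\<^sub>m X) Y = kronecker n k X (c \<cdot>\<^sub>m Y)"
  using assms by (intro eq_matI) (auto simp: kronecker_def div_mod_less)

lemma kronecker_smult:
  assumes "X \<in> carrier_mat n n" "Y \<in> carrier_mat k k"
  shows "kronecker n k (c \<cdot>\<^sub>m X) Y = c \<cdot>\<^sub>m kronecker n k X Y"
  using assms by (intro eq_matI) (auto simp: kronecker_def div_mod_less)

definition unit_mat :: "nat \<Rightarrow> nat \<Rightarrow> nat \<Rightarrow> complex mat" where
  "unit_mat k a b = mat k k (\<lambda>(i, j). if i = a \<and> j = b then 1 else 0)"

lemma unit_mat_carrier [simp]: "unit_mat k a b \<in> carrier_mat k k"
  by (simp add: unit_mat_def)

lemma unit_mat_mult:
  assumes "b < k" "c < k"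
  shows "unit_mat k a b * unit_mat k c d = (if b = c then unit_mat k a d else 0\<^sub>m k k)"
proof (rule eq_matI)
  fix i j assume "i < dim_row (if b = c then unit_mat k a d else 0\<^sub>m k k)"
    "j < dim_col (if b = c then unit_mat k a d else 0\<^sub>m k k)"
  then have ij: "i < k" "j < k" by (auto simp: unit_mat_def split: if_splits)
  have "(unit_mat k a b * unit_mat k c d) $$ (i, j)
      = (\<Sum>t<k. if t = b then (if i = a \<and> b = c \<and> j = d then 1 else 0) else 0)"
    unfolding index_mult_mat_sum[OF unit_mat_carrier unit_mat_carrier ij]
    using ij by (intro sum.cong) (auto simp: unit_mat_def)
  then show "(unit_mat k a b * unit_mat k c d) $$ (i, j) = (if b = c then unit_mat k a d else 0\<^sub>m k k) $$ (i, j)"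
    using assms ij by (auto simp: unit_mat_def)
qed (auto simp: unit_mat_def)

lemma unit_mat_adjoint: "a < k \<Longrightarrow> b < k \<Longrightarrow> adjoint_mat (unit_mat k a b) = unit_mat k b a"
  by (intro eq_matI) (auto simp: unit_mat_def adjoint_mat_def)

lemma kronecker_zero_right: "kronecker n k X (0\<^sub>m k k) = 0\<^sub>m (n * k) (n * k)"
  by (intro eq_matI) (auto simp: kronecker_def div_mod_less)

context seminormed_star_algebra
begin

text \<open>The elements \<open>1 \<otimes> e_ab \<otimes> 1\<close> of
  \<open>M_n \<otimes> M_k \<otimes> A\<close>. They commute with all
  \<open>X \<otimes> 1 \<otimes> x\<close>, the form of the unitaries to come.\<close>

definition tensor_unit :: "nat \<Rightarrow> nat \<Rightarrow> nat \<Rightarrow> nat \<Rightarrow> 'a mat" where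
  "tensor_unit n k a b = mat_tensor A (kronecker n k (1\<^sub>m n) (unit_mat k a b)) \<one>"

lemma tensor_unit_index:
  "i < n * k \<Longrightarrow> j < n * k \<Longrightarrow> tensor_unit n k a b $$ (i, j)
    = (if i div k = j div k \<and> i mod k = a \<and> j mod k = b then 1 else 0) \<odot> \<one>"
  by (simp add: tensor_unit_def mat_tensor_def kronecker_def unit_mat_def div_mod_less)

lemma matrix_units_tensor_unit:
  assumes M: "seminormed_star_algebra (matrix_algebra (n * k) A N)"
  shows "matrix_units (matrix_algebra (n * k) A N) k (tensor_unit n k)"
proof -
  interpret M: seminormed_star_algebra "matrix_algebra (n * k) A N" by fact
  show ?thesis
  proof (rule matrix_units.intro[OF M], rule matrix_units_axioms.intro)
    show "tensor_unit n k a b \<in> carrier (matrix_algebra (n * k) A N)" for a b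
      by (simp add: tensor_unit_def mat_tensor_closed)
    then have inM: "tensor_unit n k a b \<in> carrier (matrix_algebra (n * k) A N)" for a b .
    show "tensor_unit n k a b \<otimes>\<^bsub>matrix_algebra (n * k) A N\<^esub> tensor_unit n k c d
        = (if b = c then tensor_unit n k a d else \<zero>\<^bsub>matrix_algebra (n * k) A N\<^esub>)"
      if "b < k" "c < k" for a b c d
      using that by (simp add: tensor_unit_def mat_tensor_mult kronecker_mult unit_mat_mult
          kronecker_zero_right mat_tensor_zero)
    show "adj (matrix_algebra (n * k) A N) (tensor_unit n k a b) = tensor_unit n k b a"
      if "a < k" "b < k" for a b
    proof -
      have "adjoint_mat (1\<^sub>m n) = 1\<^sub>m n" by (intro eq_matI) (auto simp: adjoint_mat_def)
      then show ?thesis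
        using that by (simp add: tensor_unit_def mat_tensor_adj kronecker_adjoint unit_mat_adjoint)
    qed
    show "(\<Oplus>\<^bsub>matrix_algebra (n * k) A N\<^esub>a\<in>{..<k}. tensor_unit n k a a) = \<one>\<^bsub>matrix_algebra (n * k) A N\<^esub>"
      (is "?s = _")
    proof (rule eq_matI)
      have s: "?s \<in> carrier_mat (n * k) (n * k)"
        using inM by (intro matrix_algebra_carrier_mat[of _ _ N] M.finsum_closed) auto
      show "dim_row ?s = dim_row \<one>\<^bsub>matrix_algebra (n * k) A N\<^esub>"
        "dim_col ?s = dim_col \<one>\<^bsub>matrix_algebra (n * k) A N\<^esub>"
        using s by (auto simp: matrix_algebra_simps)
      fix i j assume "i < dim_row \<one>\<^bsub>matrix_algebra (n * k) A N\<^esub>" "j < dim_col \<one>\<^bsub>matrix_algebra (n * k) A N\<^esub>"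
      then have ij: "i < n * k" "j < n * k" by (auto simp: matrix_algebra_simps)
      have "?s $$ (i, j) = (\<Oplus>a\<in>{..<k}. tensor_unit n k a a $$ (i, j))"
        using inM ij by (intro finsum_matrix_algebra M.abelian_monoid_axioms) auto
      also have "\<dots> = (\<Oplus>a\<in>{..<k}. (if i div k = j div k \<and> i mod k = a \<and> j mod k = a then 1 else 0) \<odot> \<one>)"
        using ij by (simp only: tensor_unit_index)
      also have "\<dots> = (\<Sum>a<k. if i div k = j div k \<and> i mod k = a \<and> j mod k = a then 1 else 0) \<odot> \<one>"
        by (rule finsum_smult) auto
      also have "(\<Sum>a<k. if i div k = j div k \<and> i mod k = a \<and> j mod k = a then 1 else 0 :: complex)
          = (\<Sum>a<k. if a = i mod k then (if i = j then 1 else 0) else 0)"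
      proof (intro sum.cong refl)
        have "i div k = j div k \<and> i mod k = j mod k \<longleftrightarrow> i = j" by (metis div_mult_mod_eq)
        then show "(if i div k = j div k \<and> i mod k = a \<and> j mod k = a then 1 else 0 :: complex)
          = (if a = i mod k then (if i = j then 1 else 0) else 0)" for a by auto
      qed
      also have "\<dots> = (if i = j then 1 else 0)"
        using div_mod_less[OF ij(1)] by simp
      finally show "?s $$ (i, j) = \<one>\<^bsub>matrix_algebra (n * k) A N\<^esub> $$ (i, j)"
        using ij by (simp add: matrix_algebra_simps)
    qed
  qed
qed

text \<open>Turns the abstract coefficients of the limit argument into explicit matrices, to which
  compression by the window applies.\<close>

lemma combination_tensor_unit:
  assumes M: "seminormed_star_algebra (matrix_algebra (n * k) A N)" and B: "B \<in> carrier_mat k k"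
  shows "matrix_units.combination (matrix_algebra (n * k) A N) k (tensor_unit n k) B
    = mat_tensor A (kronecker n k (1\<^sub>m n) B) \<one>" (is "?s = ?t")
proof -
  let ?M = "matrix_algebra (n * k) A N"
  interpret M: matrix_units ?M k "tensor_unit n k" by (rule matrix_units_tensor_unit[OF M])
  show ?thesis
  proof (rule eq_matI)
    have s: "?s \<in> carrier_mat (n * k) (n * k)"
      by (intro matrix_algebra_carrier_mat[of _ _ N] M.combination_closed)
    show "dim_row ?s = dim_row ?t" "dim_col ?s = dim_col ?t"
      using s by (auto simp: mat_tensor_def kronecker_def)
    fix i j assume "i < dim_row ?t" "j < dim_col ?t"
    then have ij: "i < n * k" "j < n * k" by (auto simp: mat_tensor_def kronecker_def)
    define \<delta> :: "nat \<Rightarrow> nat \<Rightarrow> complex" where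
      "\<delta> a b = (if i div k = j div k \<and> i mod k = a \<and> j mod k = b then 1 else 0)" for a b
    note [simp] = M.e_closed
    have entry: "(B $$ (a, b) \<odot>\<^bsub>?M\<^esub> tensor_unit n k a b) $$ (i, j) = (B $$ (a, b) * \<delta> a b) \<odot> \<one>"
      if "a < k" "b < k" for a b
      using ij that M.e_closed[OF that, THEN matrix_algebra_carrier_mat]
      by (simp add: matrix_algebra_simps(6) tensor_unit_index \<delta>_def smult_smult)
    have "?s $$ (i, j) = (\<Oplus>a\<in>{..<k}. (\<Oplus>\<^bsub>?M\<^esub>b\<in>{..<k}. B $$ (a, b) \<odot>\<^bsub>?M\<^esub> tensor_unit n k a b) $$ (i, j))"
      unfolding M.combination_def
      using ij by (intro finsum_matrix_algebra M.abelian_monoid_axioms) (auto intro!: M.finsum_closed)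
    also have "\<dots> = (\<Oplus>a\<in>{..<k}. \<Oplus>b\<in>{..<k}. (B $$ (a, b) \<odot>\<^bsub>?M\<^esub> tensor_unit n k a b) $$ (i, j))"
      using ij by (intro finsum_cong' refl finsum_matrix_algebra M.abelian_monoid_axioms)
        (auto simp: entry intro!: finsum_closed)
    also have "\<dots> = (\<Oplus>a\<in>{..<k}. (\<Sum>b<k. B $$ (a, b) * \<delta> a b) \<odot> \<one>)"
      by (intro finsum_cong' refl) (auto simp: entry finsum_smult[symmetric] intro!: finsum_cong')
    also have "\<dots> = (\<Sum>a<k. \<Sum>b<k. B $$ (a, b) * \<delta> a b) \<odot> \<one>"
      by (rule finsum_smult) auto
    also have "(\<Sum>a<k. \<Sum>b<k. B $$ (a, b) * \<delta> a b)
        = (\<Sum>a<k. \<Sum>b<k. if b = j mod k then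
            (if a = i mod k \<and> i div k = j div k then B $$ (a, b) else 0) else 0)"
      by (intro sum.cong refl) (auto simp: \<delta>_def)
    also have "\<dots> = (\<Sum>a<k. if a = i mod k then (if i div k = j div k then B $$ (a, j mod k) else 0) else 0)"
      using div_mod_less[OF ij(2)] by (intro sum.cong refl) simp
    also have "\<dots> = kronecker n k (1\<^sub>m n) B $$ (i, j)"
      using ij B by (simp add: kronecker_def div_mod_less)
    finally show "?s $$ (i, j) = ?t $$ (i, j)" using ij by (simp add: mat_tensor_def kronecker_def)
  qed
qed

end

section \<open>Clock and shift matrices\<close>

text \<open>This is the real part of \<open>cis c\<close> times the sum of all m-th roots of unity,
  a geometric sum that vanishes because the root \<omega> is not 1 for m >= 2.\<close>

lemma sum_cos_equidistributed:
  assumes "m \<ge> 2"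
  shows "(\<Sum>r<m. cos (2 * pi * real r / real m + c)) = 0"
proof -
  define \<omega> where "\<omega> = cis (2 * pi / real m)"
  have "cos (2 * pi / real m) < cos 0"
    using assms by (intro cos_monotone_0_pi) (auto simp: field_simps)
  then have "Re \<omega> \<noteq> Re 1" by (simp add: \<omega>_def)
  then have ne: "\<omega> \<noteq> 1" by metis
  have "\<omega> ^ m = 1" using assms by (simp add: \<omega>_def DeMoivre)
  then have "(\<Sum>r<m. \<omega> ^ r) = 0" using geometric_sum[OF ne, of m] by simp
  then have "0 = Re (cis c * (\<Sum>r<m. \<omega> ^ r))" by simp
  also have "\<dots> = (\<Sum>r<m. Re (cis c * \<omega> ^ r))" by (simp only: sum_distrib_left Re_sum)
  also have "\<dots> = (\<Sum>r<m. cos (2 * pi * real r / real m + c))"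
    by (intro sum.cong refl) (simp add: \<omega>_def DeMoivre cis_mult add.commute mult_ac)
  finally show ?thesis ..
qed

lemma cos_ge_one_minus_square: "1 - x\<^sup>2 / 2 \<le> cos x" for x :: real
proof -
  have "(sin (x/2))\<^sup>2 \<le> (x/2)\<^sup>2"
    using abs_sin_x_le_abs_x[of "x/2"] by (simp only: abs_le_square_iff)
  moreover have "cos x = 1 - 2 * (sin (x/2))\<^sup>2"
    using cos_double_sin[of "x/2"] by simp
  ultimately show ?thesis by (simp add: power_divide)
qed

text \<open>The ground state of the discrete Dirichlet Laplacian: on a window of width \<open>m\<close>, it is moved by
  a unit shift only by \<open>O(m\<^sup>-\<^sup>2)\<close> in the quadratic form.\<close>

definition sine_window :: "nat \<Rightarrow> nat \<Rightarrow> real" where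
  "sine_window m s = (if s < m then sqrt (2 / m) * sin (pi * s / m) else 0)"

text \<open>The formula persists at s = m because sin pi = 0. The endpoint is met as the successor
  of m - 1 and as the mirror image of 0.\<close>

lemma sine_window_le: "s \<le> m \<Longrightarrow> sine_window m s = sqrt (2 / m) * sin (pi * s / m)"
  by (cases "s = m"; cases "m = 0") (auto simp: sine_window_def)

lemma sine_window_prod:
  assumes "r \<le> m" "s \<le> m"
  shows "sine_window m r * sine_window m s = (cos (pi * (real r - real s) / m) - cos (pi * (real r + real s) / m)) / m"
proof -
  have "sine_window m r * sine_window m s = (sqrt (2 / m))\<^sup>2 * (sin (pi * r / m) * sin (pi * s / m))"
    unfolding sine_window_le[OF assms(1)] sine_window_le[OF assms(2)] by (simp only: power2_eq_square mult_ac)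
  also have "\<dots> = 2 / m * ((cos (pi * r / m - pi * s / m) - cos (pi * r / m + pi * s / m)) / 2)"
    by (simp add: sin_times_sin)
  also have "\<dots> = (cos (pi * (real r - real s) / m) - cos (pi * (real r + real s) / m)) / m"
    by (simp add: diff_divide_distrib add_divide_distrib right_diff_distrib distrib_left)
  finally show ?thesis .
qed

text \<open>By the product formula each summand is \<open>(1 - cos (2 pi s / m)) / m\<close>, and
  the cosines cancel over a full period. This is the origin of the factor
  \<open>sqrt (2 / m)\<close>.\<close>

lemma sum_sine_window_square:
  assumes "m \<ge> 2" "m \<le> n"
  shows "(\<Sum>s<n. sine_window m s * sine_window m s) = 1"
proof -
  have "(\<Sum>s<n. sine_window m s * sine_window m s) = (\<Sum>s<m. sine_window m s * sine_window m s)"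
    using assms by (intro sum.mono_neutral_right) (auto simp: sine_window_def)
  also have "\<dots> = (\<Sum>s<m. (1 - cos (2 * pi * real s / real m + 0)) / m)"
    by (intro sum.cong refl) (simp add: sine_window_prod mult_ac)
  also have "\<dots> = (\<Sum>s<m. 1 - cos (2 * pi * real s / real m + 0)) / m"
    by (simp only: sum_divide_distrib)
  also have "\<dots> = 1"
    unfolding sum_subtractf sum_cos_equidistributed[OF assms(1)] using assms by simp
  finally show ?thesis .
qed

text \<open>As m < n, the cyclic successor is the ordinary one on the support of the window. Each
  pair of neighbours contributes the constant \<open>cos (pi / m)\<close> and a cosine that cancels
  over a period.\<close>

lemma sum_sine_window_shift:
  assumes "m \<ge> 2" "m < n"
  shows "(\<Sum>r<n. sine_window m r * sine_window m (Suc r mod n)) = cos (pi / m)"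
proof -
  have "(\<Sum>r<n. sine_window m r * sine_window m (Suc r mod n))
      = (\<Sum>r<m. sine_window m r * sine_window m (Suc r mod n))"
    using assms by (intro sum.mono_neutral_right) (auto simp: sine_window_def)
  also have "\<dots> = (\<Sum>r<m. (cos (pi / m) - cos (2 * pi * real r / real m + pi / m)) / m)"
  proof (intro sum.cong refl)
    fix r assume "r \<in> {..<m}"
    then have "sine_window m r * sine_window m (Suc r mod n)
        = (cos (pi * (real r - real (Suc r)) / m) - cos (pi * (real r + real (Suc r)) / m)) / m"
      using assms by (subst mod_less) (auto intro!: sine_window_prod simp del: of_nat_Suc)
    moreover have "pi * (real r - real (Suc r)) / m = - (pi / m)" by simp
    moreover have "pi * (real r + real (Suc r)) / m = 2 * pi * real r / real m + pi / m"
      by (simp add: algebra_simps add_divide_distrib)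
    ultimately show "sine_window m r * sine_window m (Suc r mod n)
        = (cos (pi / m) - cos (2 * pi * real r / real m + pi / m)) / m"
      by (simp only: cos_minus)
  qed
  also have "\<dots> = (\<Sum>r<m. cos (pi / m) - cos (2 * pi * real r / real m + pi / m)) / m"
    by (simp only: sum_divide_distrib)
  also have "\<dots> = cos (pi / m)"
    unfolding sum_subtractf sum_cos_equidistributed[OF assms(1)] using assms by simp
  finally show ?thesis .
qed

text \<open>The phases are centred at the middle of the window, so that the expectation of the clock
  matrix is real and differs from 1 only to second order in \<open>\<delta> m\<close>.\<close>

lemma sum_sine_window_phase:
  assumes "m \<ge> 2" "m < n"
  shows "\<exists>c :: real. (\<Sum>s<n. complex_of_real (sine_window m s * sine_window m s) * cis (\<delta> * (real s - real m / 2)))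
      = of_real c \<and> \<bar>1 - c\<bar> \<le> \<delta>\<^sup>2 * (real m)\<^sup>2 / 8"
proof -
  define g where "g s = sine_window m s * sine_window m s" for s
  define x where "x s = \<delta> * (real s - real m / 2)" for s
  define c where "c = (\<Sum>s<n. g s * cos (x s))"
  have g0: "g s \<ge> 0" for s by (simp add: g_def)
  have g_sum: "(\<Sum>s<n. g s) = 1"
    using sum_sine_window_square[of m n] assms by (simp add: g_def)
  \<comment> \<open>The sum runs to m inclusive, where the window vanishes, so that the range is
    invariant under the reflection s -> m - s.\<close>
  have "(\<Sum>s<n. g s * sin (x s)) = (\<Sum>s\<in>{..m}. g s * sin (x s))"
    using assms by (intro sum.mono_neutral_right) (auto simp: g_def sine_window_def)
  \<comment> \<open>About m / 2 the squared window is even and the phase odd, so the sum equals its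
    negative.\<close>
  moreover have "(\<Sum>s\<in>{..m}. g s * sin (x s)) = - (\<Sum>s\<in>{..m}. g s * sin (x s))"
  proof -
    have g_refl: "g (m - s) = g s" if "s \<le> m" for s
    proof -
      have "pi * real (m - s) / m = pi - pi * s / m"
        using that assms by (simp add: of_nat_diff field_simps)
      then have "sin (pi * real (m - s) / m) = sin (pi * s / m)" by simp
      then show ?thesis using that by (simp only: g_def sine_window_le diff_le_self)
    qed
    have x_refl: "x (m - s) = - x s" if "s \<le> m" for s
      using that by (simp add: x_def of_nat_diff algebra_simps)
    have "(\<Sum>s\<in>{..m}. g s * sin (x s)) = (\<Sum>s\<in>{..m}. g (m - s) * sin (x (m - s)))"
      by (rule sum.reindex_bij_witness[of _ "\<lambda>s. m - s" "\<lambda>s. m - s"]) auto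
    also have "\<dots> = (\<Sum>s\<in>{..m}. - (g s * sin (x s)))"
      by (intro sum.cong refl) (simp add: g_refl x_refl)
    finally show ?thesis by (simp add: sum_negf)
  qed
  ultimately have im: "(\<Sum>s<n. g s * sin (x s)) = 0" by simp
  have "(\<Sum>s<n. complex_of_real (g s) * cis (x s)) = of_real c"
    by (rule complex_eqI) (simp_all add: c_def im)
  moreover have "c \<le> 1"
  proof -
    have "c \<le> (\<Sum>s<n. g s)" unfolding c_def
      by (intro sum_mono) (simp add: g0 mult_left_le)
    then show ?thesis by (simp add: g_sum)
  qed
  moreover have "1 - \<delta>\<^sup>2 * (real m)\<^sup>2 / 8 \<le> c"
  proof -
    have "1 - \<delta>\<^sup>2 * (real m)\<^sup>2 / 8 = (\<Sum>s<n. g s * (1 - \<delta>\<^sup>2 * (real m)\<^sup>2 / 8))"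
      by (simp add: g_sum flip: sum_distrib_right)
    also have "\<dots> \<le> c"
      unfolding c_def
    proof (rule sum_mono)
      fix s
      show "g s * (1 - \<delta>\<^sup>2 * (real m)\<^sup>2 / 8) \<le> g s * cos (x s)"
      proof (cases "s < m")
        case True
        \<comment> \<open>On the window the phase is at most \<open>|\<delta>| m / 2\<close>, and
          \<open>cos x >= 1 - x^2 / 2\<close> gives the constant 1/8.\<close>
        then have "\<bar>real s - real m / 2\<bar> \<le> \<bar>real m / 2\<bar>" by (auto simp: abs_if)
        then have "(real s - real m / 2)\<^sup>2 \<le> (real m / 2)\<^sup>2" by (simp only: abs_le_square_iff)
        then have "\<delta>\<^sup>2 * (real s - real m / 2)\<^sup>2 \<le> \<delta>\<^sup>2 * (real m / 2)\<^sup>2"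
          by (intro mult_left_mono) auto
        then have "(x s)\<^sup>2 \<le> \<delta>\<^sup>2 * (real m)\<^sup>2 / 4"
          by (simp add: x_def power_mult_distrib power_divide)
        then have "1 - \<delta>\<^sup>2 * (real m)\<^sup>2 / 8 \<le> cos (x s)"
          using cos_ge_one_minus_square[of "x s"] by linarith
        then show ?thesis using g0 by (intro mult_left_mono)
      qed (simp add: g_def sine_window_def)
    qed
    finally show ?thesis .
  qed
  ultimately show ?thesis
    unfolding g_def x_def by (intro exI[of _ c]) (auto simp: abs_if)
qed

section \<open>Clock, shift and window matrices\<close>

definition clock_mat :: "nat \<Rightarrow> nat \<Rightarrow> real \<Rightarrow> complex mat" where
  "clock_mat n m \<delta> = mat n n (\<lambda>(r, s). if r = s then cis (\<delta> * (real r - real m / 2)) else 0)"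

definition shift_mat :: "nat \<Rightarrow> complex mat" where
  "shift_mat n = mat n n (\<lambda>(r, s). if s = Suc r mod n then 1 else 0)"

text \<open>The vector \<xi> as the only nonzero column of a square matrix W: then
  \<open>W* X W\<close> is \<langle>X \<xi>, \<xi>\<rangle> times the elementary matrix at (0, 0),
  and no rectangular matrices appear.\<close>

definition window_mat :: "nat \<Rightarrow> nat \<Rightarrow> complex mat" where
  "window_mat n m = mat n n (\<lambda>(r, s). if s = 0 then of_real (sine_window m r) else 0)"

lemma window_clock_shift_carrier [simp]:
  "clock_mat n m \<delta> \<in> carrier_mat n n" "shift_mat n \<in> carrier_mat n n" "window_mat n m \<in> carrier_mat n n"
  by (simp_all add: clock_mat_def shift_mat_def window_mat_def)

lemma clock_mat_unitary:
  "adjoint_mat (clock_mat n m \<delta>) * clock_mat n m \<delta> = 1\<^sub>m n" (is "?Y * ?X = _")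
  "clock_mat n m \<delta> * adjoint_mat (clock_mat n m \<delta>) = 1\<^sub>m n"
proof -
  have *: "(?Y * ?X) $$ (i, j) = 1\<^sub>m n $$ (i, j)" "(?X * ?Y) $$ (i, j) = 1\<^sub>m n $$ (i, j)"
    if ij: "i < n" "j < n" for i j
  proof -
    have "(?Y * ?X) $$ (i, j) = (\<Sum>t<n. ?Y $$ (i, t) * ?X $$ (t, j))"
      "(?X * ?Y) $$ (i, j) = (\<Sum>t<n. ?X $$ (i, t) * ?Y $$ (t, j))"
      using ij by (intro index_mult_mat_sum; simp)+
    moreover have "(\<Sum>t<n. ?Y $$ (i, t) * ?X $$ (t, j)) = (\<Sum>t<n. if t = i then (if i = j then 1 else 0) else 0)"
      "(\<Sum>t<n. ?X $$ (i, t) * ?Y $$ (t, j)) = (\<Sum>t<n. if t = i then (if i = j then 1 else 0) else 0)"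
      using ij by (intro sum.cong refl; auto simp: clock_mat_def adjoint_mat_def cis_cnj cis_mult)+
    ultimately show "(?Y * ?X) $$ (i, j) = 1\<^sub>m n $$ (i, j)" "(?X * ?Y) $$ (i, j) = 1\<^sub>m n $$ (i, j)"
      using ij by simp_all
  qed
  have d: "dim_row ?X = n" "dim_col ?X = n" "dim_row ?Y = n" "dim_col ?Y = n"
    by (simp_all add: clock_mat_def adjoint_mat_def)
  show "?Y * ?X = 1\<^sub>m n" by (rule eq_matI) (simp_all add: * d del: index_mult_mat(1))
  show "?X * ?Y = 1\<^sub>m n" by (rule eq_matI) (simp_all add: * d del: index_mult_mat(1))
qed

lemma shift_mat_unitary:
  "adjoint_mat (shift_mat n) * shift_mat n = 1\<^sub>m n" (is "?Y * ?X = _")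
  "shift_mat n * adjoint_mat (shift_mat n) = 1\<^sub>m n"
proof -
  have *: "(?Y * ?X) $$ (i, j) = 1\<^sub>m n $$ (i, j)" "(?X * ?Y) $$ (i, j) = 1\<^sub>m n $$ (i, j)"
    if ij: "i < n" "j < n" for i j
  proof -
    \<comment> \<open>The cyclic predecessor of i: the only row in which column i of the shift has
      an entry.\<close>
    define p where "p = (if i = 0 then n - 1 else i - 1)"
    have p: "p < n" "t < n \<Longrightarrow> i = Suc t mod n \<longleftrightarrow> t = p" for t
      using ij by (auto simp: p_def mod_Suc split: if_splits)
    have inj: "Suc i mod n = Suc j mod n \<longleftrightarrow> i = j"
      using ij by (auto simp: mod_Suc split: if_splits)
    have "(?Y * ?X) $$ (i, j) = (\<Sum>t<n. ?Y $$ (i, t) * ?X $$ (t, j))"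
      "(?X * ?Y) $$ (i, j) = (\<Sum>t<n. ?X $$ (i, t) * ?Y $$ (t, j))"
      using ij by (intro index_mult_mat_sum; simp)+
    moreover have "(\<Sum>t<n. ?Y $$ (i, t) * ?X $$ (t, j)) = (\<Sum>t<n. if t = p then (if i = j then 1 else 0) else 0)"
      using ij p by (intro sum.cong refl) (auto simp: shift_mat_def adjoint_mat_def)
    moreover have "(\<Sum>t<n. ?X $$ (i, t) * ?Y $$ (t, j)) = (\<Sum>t<n. if t = Suc i mod n then (if i = j then 1 else 0) else 0)"
      using ij inj by (intro sum.cong refl) (auto simp: shift_mat_def adjoint_mat_def)
    ultimately show "(?Y * ?X) $$ (i, j) = 1\<^sub>m n $$ (i, j)" "(?X * ?Y) $$ (i, j) = 1\<^sub>m n $$ (i, j)"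
      using ij p by simp_all
  qed
  have d: "dim_row ?X = n" "dim_col ?X = n" "dim_row ?Y = n" "dim_col ?Y = n"
    by (simp_all add: shift_mat_def adjoint_mat_def)
  show "?Y * ?X = 1\<^sub>m n" by (rule eq_matI) (simp_all add: * d del: index_mult_mat(1))
  show "?X * ?Y = 1\<^sub>m n" by (rule eq_matI) (simp_all add: * d del: index_mult_mat(1))
qed

text \<open>From one site to the next the phase gains the factor \<open>cis \<delta>\<close>. The
  step from n - 1 back to 0 loses \<open>cis (\<delta> n)\<close> in addition, so this has to be 1.
  The centring is a constant factor on both sides.\<close>

lemma shift_clock_commutation:
  assumes "cis (\<delta> * real n) = 1"
  shows "shift_mat n * clock_mat n m \<delta> = cis \<delta> \<cdot>\<^sub>m (clock_mat n m \<delta> * shift_mat n)"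
proof (rule eq_matI)
  fix i j
  assume "i < dim_row (cis \<delta> \<cdot>\<^sub>m (clock_mat n m \<delta> * shift_mat n))"
    "j < dim_col (cis \<delta> \<cdot>\<^sub>m (clock_mat n m \<delta> * shift_mat n))"
  then have ij: "i < n" "j < n" by (auto simp: clock_mat_def shift_mat_def)
  have "(shift_mat n * clock_mat n m \<delta>) $$ (i, j) = (\<Sum>t<n. shift_mat n $$ (i, t) * clock_mat n m \<delta> $$ (t, j))"
    using ij by (intro index_mult_mat_sum) auto
  also have "\<dots> = (\<Sum>t<n. if t = j then (if j = Suc i mod n then cis (\<delta> * (real j - real m / 2)) else 0) else 0)"
    using ij by (intro sum.cong refl) (auto simp: clock_mat_def shift_mat_def)
  also have "\<dots> = (if j = Suc i mod n then cis (\<delta> * (real j - real m / 2)) else 0)"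
    using ij by simp
  finally have lhs: "(shift_mat n * clock_mat n m \<delta>) $$ (i, j) = \<dots>" .
  have "(clock_mat n m \<delta> * shift_mat n) $$ (i, j) = (\<Sum>t<n. clock_mat n m \<delta> $$ (i, t) * shift_mat n $$ (t, j))"
    using ij by (intro index_mult_mat_sum) auto
  also have "\<dots> = (\<Sum>t<n. if t = i then (if j = Suc i mod n then cis (\<delta> * (real i - real m / 2)) else 0) else 0)"
    using ij by (intro sum.cong refl) (auto simp: clock_mat_def shift_mat_def)
  also have "\<dots> = (if j = Suc i mod n then cis (\<delta> * (real i - real m / 2)) else 0)"
    using ij by simp
  finally have rhs: "(clock_mat n m \<delta> * shift_mat n) $$ (i, j) = \<dots>" .
  have "cis (\<delta> * (real (Suc i mod n) - real m / 2)) = cis \<delta> * cis (\<delta> * (real i - real m / 2))"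
  proof (cases "Suc i = n")
    case True
    have "cis \<delta> * cis (\<delta> * (real i - real m / 2)) = cis (\<delta> * real n) * cis (\<delta> * (- real m / 2))"
      using True by (simp add: cis_mult algebra_simps flip: True)
    then show ?thesis using True assms by simp
  next
    case False
    then show ?thesis using ij by (simp add: cis_mult algebra_simps)
  qed
  then show "(shift_mat n * clock_mat n m \<delta>) $$ (i, j) = (cis \<delta> \<cdot>\<^sub>m (clock_mat n m \<delta> * shift_mat n)) $$ (i, j)"
    using ij lhs rhs by (auto simp: clock_mat_def shift_mat_def simp del: index_mult_mat(1))
qed (auto simp: clock_mat_def shift_mat_def)

lemma window_mat_compress:
  assumes X: "X \<in> carrier_mat n n" and n: "n > 0"
  shows "adjoint_mat (window_mat n m) * X * window_mat n m
    = (\<Sum>s<n. \<Sum>r<n. of_real (sine_window m r) * X $$ (r, s) * of_real (sine_window m s)) \<cdot>\<^sub>m unit_mat n 0 0"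
    (is "?l = ?r")
proof (rule eq_matI)
  fix i j assume "i < dim_row ?r" "j < dim_col ?r"
  then have ij: "i < n" "j < n" by (auto simp: unit_mat_def)
  have "?l $$ (i, j) = (\<Sum>s<n. (adjoint_mat (window_mat n m) * X) $$ (i, s) * window_mat n m $$ (s, j))"
    by (rule index_mult_mat_sum[of _ n n _ n]) (use X ij in \<open>auto intro!: mult_carrier_mat[of _ n n]\<close>)
  also have "\<dots> = (\<Sum>s<n. (\<Sum>r<n. adjoint_mat (window_mat n m) $$ (i, r) * X $$ (r, s)) * window_mat n m $$ (s, j))"
    using X ij by (intro sum.cong refl arg_cong2[of _ _ _ _ "(*)"] index_mult_mat_sum) auto
  also have "\<dots> = (\<Sum>s<n. \<Sum>r<n. (of_real (sine_window m r) * X $$ (r, s) * of_real (sine_window m s))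
      * (if i = 0 \<and> j = 0 then 1 else 0))"
    unfolding sum_distrib_right
    using ij by (intro sum.cong refl) (auto simp: window_mat_def adjoint_mat_def)
  also have "\<dots> = ?r $$ (i, j)"
    using ij by (simp add: unit_mat_def flip: sum_distrib_right)
  finally show "?l $$ (i, j) = ?r $$ (i, j)" .
qed (use X in \<open>auto simp: unit_mat_def window_mat_def adjoint_mat_def\<close>)

lemma window_mat_isometry:
  assumes "m \<ge> 2" "m < n"
  shows "adjoint_mat (window_mat n m) * 1\<^sub>m n * window_mat n m = unit_mat n 0 0"
proof -
  have "(\<Sum>s<n. \<Sum>r<n. of_real (sine_window m r) * 1\<^sub>m n $$ (r, s) * of_real (sine_window m s))
      = (\<Sum>s<n. \<Sum>r<n. if r = s then complex_of_real (sine_window m s * sine_window m s) else 0)"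
    by (intro sum.cong refl) auto
  also have "\<dots> = complex_of_real (\<Sum>s<n. sine_window m s * sine_window m s)" by simp
  finally have "(\<Sum>s<n. \<Sum>r<n. of_real (sine_window m r) * 1\<^sub>m n $$ (r, s) * of_real (sine_window m s)) = (1 :: complex)"
    using sum_sine_window_square[of m n] assms by simp
  then have "adjoint_mat (window_mat n m) * 1\<^sub>m n * window_mat n m = 1 \<cdot>\<^sub>m unit_mat n 0 0"
    using window_mat_compress[of "1\<^sub>m n" n m] assms by simp
  also have "\<dots> = unit_mat n 0 0" by (intro eq_matI) auto
  finally show ?thesis .
qed

lemma window_mat_clock:
  assumes "m \<ge> 2" "m < n"
  shows "\<exists>c :: real. adjoint_mat (window_mat n m) * clock_mat n m \<delta> * window_mat n m = of_real c \<cdot>\<^sub>m unit_mat n 0 0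
    \<and> \<bar>1 - c\<bar> \<le> \<delta>\<^sup>2 * (real m)\<^sup>2 / 8"
proof -
  have "(\<Sum>s<n. \<Sum>r<n. of_real (sine_window m r) * clock_mat n m \<delta> $$ (r, s) * of_real (sine_window m s))
      = (\<Sum>s<n. \<Sum>r<n. if r = s then complex_of_real (sine_window m s * sine_window m s) * cis (\<delta> * (real s - real m / 2)) else 0)"
    by (intro sum.cong refl) (auto simp: clock_mat_def)
  also have "\<dots> = (\<Sum>s<n. complex_of_real (sine_window m s * sine_window m s) * cis (\<delta> * (real s - real m / 2)))"
    by simp
  finally have *: "(\<Sum>s<n. \<Sum>r<n. of_real (sine_window m r) * clock_mat n m \<delta> $$ (r, s) * of_real (sine_window m s)) = \<dots>" .
  obtain c :: real where "(\<Sum>s<n. complex_of_real (sine_window m s * sine_window m s) * cis (\<delta> * (real s - real m / 2))) = of_real c"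
    and "\<bar>1 - c\<bar> \<le> \<delta>\<^sup>2 * (real m)\<^sup>2 / 8"
    using sum_sine_window_phase[OF assms] by blast
  then show ?thesis
    using * assms window_mat_compress[of "clock_mat n m \<delta>" n m] by (intro exI[of _ c]) simp
qed

lemma window_mat_shift:
  assumes "m \<ge> 2" "m < n"
  shows "\<exists>c :: real. adjoint_mat (window_mat n m) * shift_mat n * window_mat n m = of_real c \<cdot>\<^sub>m unit_mat n 0 0
    \<and> \<bar>1 - c\<bar> \<le> pi\<^sup>2 / (2 * (real m)\<^sup>2)"
proof (intro exI conjI)
  have "(\<Sum>s<n. \<Sum>r<n. of_real (sine_window m r) * shift_mat n $$ (r, s) * of_real (sine_window m s))
      = (\<Sum>r<n. \<Sum>s<n. of_real (sine_window m r) * shift_mat n $$ (r, s) * of_real (sine_window m s))"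
    by (rule sum.swap)
  also have "\<dots> = (\<Sum>r<n. \<Sum>s<n. if s = Suc r mod n then complex_of_real (sine_window m r * sine_window m (Suc r mod n)) else 0)"
    by (intro sum.cong refl) (auto simp: shift_mat_def)
  also have "\<dots> = complex_of_real (\<Sum>r<n. sine_window m r * sine_window m (Suc r mod n))"
    using assms by simp
  also have "\<dots> = of_real (cos (pi / m))"
    by (simp only: sum_sine_window_shift[OF assms])
  finally show "adjoint_mat (window_mat n m) * shift_mat n * window_mat n m = of_real (cos (pi / m)) \<cdot>\<^sub>m unit_mat n 0 0"
    using assms by (simp add: window_mat_compress)
  show "\<bar>1 - cos (pi / m)\<bar> \<le> pi\<^sup>2 / (2 * (real m)\<^sup>2)"
    using cos_ge_one_minus_square[of "pi / m"] by (simp add: power_divide mult.commute)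
qed

section \<open>Corners of matrix algebras\<close>

lemma (in seminormed_star_algebra) seminormed_star_algebra_renorm:
  assumes "\<And>x. x \<in> carrier A \<Longrightarrow> 0 \<le> \<nu> x"
      "\<And>x y. x \<in> carrier A \<Longrightarrow> y \<in> carrier A \<Longrightarrow> \<nu> (x \<oplus> y) \<le> \<nu> x + \<nu> y"
      "\<And>c x. x \<in> carrier A \<Longrightarrow> \<nu> (c \<odot> x) = cmod c * \<nu> x"
      "\<And>x y. x \<in> carrier A \<Longrightarrow> y \<in> carrier A \<Longrightarrow> \<nu> (x \<otimes> y) \<le> \<nu> x * \<nu> y"
      "\<And>x. x \<in> carrier A \<Longrightarrow> \<nu> (adj A x \<otimes> x) = (\<nu> x)\<^sup>2"
  shows "seminormed_star_algebra (A\<lparr>cnorm := \<nu>\<rparr>)"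
  by (rule seminormed_star_algebraI)
    (auto simp: assms star_algebra_simps)

text \<open>For k <= m the embedding of X as a leading block with zeros around it. It preserves
  products and adjoints but in general not the unit, so contractivity of unital homomorphisms does
  not apply to it directly.\<close>

definition corner :: "'a cstar \<Rightarrow> nat \<Rightarrow> nat \<Rightarrow> 'a mat \<Rightarrow> 'a mat" where
  "corner A k m X = mat m m (\<lambda>(i, j). if i < k \<and> j < k then X $$ (i, j) else \<zero>\<^bsub>A\<^esub>)"

context seminormed_star_algebra
begin

lemma corner_closed:
  "X \<in> carrier (matrix_algebra k A N) \<Longrightarrow> corner A k m X \<in> carrier (matrix_algebra m A N')"
  by (auto simp: corner_def matrix_algebra_simps)

lemma corner_add:
  assumes "X \<in> carrier (matrix_algebra k A N)" "Y \<in> carrier (matrix_algebra k A N)"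
  shows "corner A k m (X \<oplus>\<^bsub>matrix_algebra k A N\<^esub> Y)
    = corner A k m X \<oplus>\<^bsub>matrix_algebra m A N'\<^esub> corner A k m Y"
  using assms by (intro eq_matI) (auto simp: corner_def matrix_algebra_simps)

lemma corner_smult:
  assumes "X \<in> carrier (matrix_algebra k A N)"
  shows "corner A k m (c \<odot>\<^bsub>matrix_algebra k A N\<^esub> X) = c \<odot>\<^bsub>matrix_algebra m A N'\<^esub> corner A k m X"
  using assms by (intro eq_matI) (auto simp: corner_def matrix_algebra_simps)

lemma corner_adj:
  assumes "X \<in> carrier (matrix_algebra k A N)"
  shows "corner A k m (adj (matrix_algebra k A N) X) = adj (matrix_algebra m A N') (corner A k m X)"
  using assms by (intro eq_matI) (auto simp: corner_def matrix_algebra_simps)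

lemma corner_mult:
  assumes X: "X \<in> carrier (matrix_algebra k A N)" and Y: "Y \<in> carrier (matrix_algebra k A N)" and km: "k \<le> m"
  shows "corner A k m (X \<otimes>\<^bsub>matrix_algebra k A N\<^esub> Y)
    = corner A k m X \<otimes>\<^bsub>matrix_algebra m A N'\<^esub> corner A k m Y"
proof (rule eq_matI)
  let ?K = "matrix_algebra k A N" and ?L = "matrix_algebra m A N'"
  show "dim_row (corner A k m (X \<otimes>\<^bsub>?K\<^esub> Y)) = dim_row (corner A k m X \<otimes>\<^bsub>?L\<^esub> corner A k m Y)"
    "dim_col (corner A k m (X \<otimes>\<^bsub>?K\<^esub> Y)) = dim_col (corner A k m X \<otimes>\<^bsub>?L\<^esub> corner A k m Y)"
    by (auto simp: corner_def matrix_algebra_simps)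
  fix i j assume "i < dim_row (corner A k m X \<otimes>\<^bsub>?L\<^esub> corner A k m Y)"
    "j < dim_col (corner A k m X \<otimes>\<^bsub>?L\<^esub> corner A k m Y)"
  then have ij: "i < m" "j < m" by (auto simp: matrix_algebra_simps)
  have e: "X $$ (a, b) \<in> carrier A" "Y $$ (a, b) \<in> carrier A" if "a < k" "b < k" for a b
    using X Y that by (auto simp: matrix_algebra_simps)
  have "(corner A k m X \<otimes>\<^bsub>?L\<^esub> corner A k m Y) $$ (i, j)
      = (\<Oplus>l\<in>{..<m}. corner A k m X $$ (i, l) \<otimes> corner A k m Y $$ (l, j))"
    using ij by (simp add: matrix_algebra_simps)
  also have "\<dots> = (\<Oplus>l\<in>{..<k}. if i < k \<and> j < k then X $$ (i, l) \<otimes> Y $$ (l, j) else \<zero>)"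
    using ij km by (intro add.finprod_mono_neutral_cong_right) (auto simp: corner_def e)
  also have "\<dots> = corner A k m (X \<otimes>\<^bsub>?K\<^esub> Y) $$ (i, j)"
    using ij by (cases "i < k \<and> j < k") (auto simp: corner_def matrix_algebra_simps)
  finally show "corner A k m (X \<otimes>\<^bsub>?K\<^esub> Y) $$ (i, j) = (corner A k m X \<otimes>\<^bsub>?L\<^esub> corner A k m Y) $$ (i, j)" ..
qed

text \<open>Cutting with the image of the unit brings any matrix back into the corner; this keeps
  limits of corner elements there.\<close>

lemma corner_compress:
  assumes Z: "Z \<in> carrier (matrix_algebra m A N')" and km: "k \<le> m"
  shows "corner A k m \<one>\<^bsub>matrix_algebra k A N\<^esub> \<otimes>\<^bsub>matrix_algebra m A N'\<^esub> Z
      \<otimes>\<^bsub>matrix_algebra m A N'\<^esub> corner A k m \<one>\<^bsub>matrix_algebra k A N\<^esub>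
    = corner A k m (mat k k (\<lambda>ij. Z $$ ij))" (is "?l = ?r")
proof (rule eq_matI)
  let ?L = "matrix_algebra m A N'"
  define Q where "Q = corner A k m \<one>\<^bsub>matrix_algebra k A N\<^esub>"
  have Z_closed: "Z $$ (a, b) \<in> carrier A" if "a < m" "b < m" for a b
    using Z that by (auto simp: matrix_algebra_simps)
  have Q: "Q $$ (a, b) = (if a = b then if a < k then \<one> else \<zero> else \<zero>)" if "a < m" "b < m" for a b
    using that by (auto simp: Q_def corner_def matrix_algebra_simps)
  have QZ: "(Q \<otimes>\<^bsub>?L\<^esub> Z) $$ (i, j) = (if i < k then Z $$ (i, j) else \<zero>)" if "i < m" "j < m" for i j
  proof -
    have "(Q \<otimes>\<^bsub>?L\<^esub> Z) $$ (i, j) = (\<Oplus>l\<in>{..<m}. Q $$ (i, l) \<otimes> Z $$ (l, j))"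
      using that by (simp add: matrix_algebra_simps)
    also have "\<dots> = (\<Oplus>l\<in>{..<m}. if i = l then (if i < k then Z $$ (i, j) else \<zero>) else \<zero>)"
      using that by (intro finsum_cong' refl) (auto simp: Q Z_closed)
    also have "\<dots> = (if i < k then Z $$ (i, j) else \<zero>)"
      using that by (intro finsum_delta) (auto simp: Z_closed)
    finally show ?thesis .
  qed
  show "dim_row ?l = dim_row ?r" "dim_col ?l = dim_col ?r"
    by (auto simp: corner_def matrix_algebra_simps)
  fix i j assume "i < dim_row ?r" "j < dim_col ?r"
  then have ij: "i < m" "j < m" by (auto simp: corner_def)
  have "?l $$ (i, j) = (\<Oplus>l\<in>{..<m}. (Q \<otimes>\<^bsub>?L\<^esub> Z) $$ (i, l) \<otimes> Q $$ (l, j))"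
    using ij by (subst matrix_algebra_simps(2)) (simp add: Q_def)
  also have "\<dots> = (\<Oplus>l\<in>{..<m}. if j = l then (if i < k \<and> j < k then Z $$ (i, j) else \<zero>) else \<zero>)"
    using ij by (intro finsum_cong' refl) (auto simp: Q QZ Z_closed)
  also have "\<dots> = (if i < k \<and> j < k then Z $$ (i, j) else \<zero>)"
    using ij by (intro finsum_delta) (auto simp: Z_closed)
  finally show "?l $$ (i, j) = ?r $$ (i, j)" using ij by (simp add: corner_def)
qed

end

text \<open>The right-hand side is a complete C*-norm on \<open>M\<^sub>k(A)\<close>, so the identity map is contractive.\<close>

lemma (in seminormed_star_algebra) cnorm_le_cnorm_corner:
  assumes K: "unital_cstar_algebra (matrix_algebra k A N)" and L: "unital_cstar_algebra (matrix_algebra m A N')"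
    and km: "k \<le> m" and Y: "Y \<in> carrier (matrix_algebra k A N)"
  shows "N Y \<le> N' (corner A k m Y)"
proof -
  let ?K = "matrix_algebra k A N" and ?L = "matrix_algebra m A N'" and ?\<kappa> = "corner A k m"
  define \<nu> where "\<nu> X = N' (?\<kappa> X)" for X
  let ?K' = "matrix_algebra k A \<nu>"
  interpret K: unital_cstar_algebra ?K by fact
  interpret L: unital_cstar_algebra ?L by fact
  have K'_eq: "?K' = ?K\<lparr>cnorm := \<nu>\<rparr>" by (simp add: matrix_algebra_def)
  have carrier_eq: "carrier ?K' = carrier ?K" by (simp add: matrix_algebra_simps)
  have \<nu>: "\<nu> X = cnorm ?L (?\<kappa> X)" for X by (simp add: \<nu>_def matrix_algebra_simps)
  note \<kappa> = corner_closed[where N = N and N' = N'] corner_add[where N = N and N' = N']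
    corner_smult[where N = N and N' = N'] corner_adj[where N = N and N' = N']
    corner_mult[where N = N and N' = N', OF _ _ km]
  have "seminormed_star_algebra ?K'"
    unfolding K'_eq
    by (rule K.seminormed_star_algebra_renorm)
      (auto simp: \<nu> \<kappa> L.cnorm_nonneg L.cnorm_triangle L.cnorm_smult L.cnorm_mult L.cnorm_adj_mult)
  then interpret K': seminormed_star_algebra ?K' .
  have \<kappa>_minus: "?\<kappa> (X \<ominus>\<^bsub>?K'\<^esub> Z) = ?\<kappa> X \<ominus>\<^bsub>?L\<^esub> ?\<kappa> Z" if "X \<in> carrier ?K'" "Z \<in> carrier ?K'" for X Z
    using that corner_closed[OF that(1), of m N'] corner_closed[OF that(2), of m N']
    by (simp add: K'.minus_eq L.minus_eq corner_add[where N' = N'] corner_smult[where N' = N']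
        flip: K'.smult_minus_one L.smult_minus_one)
  define Q where "Q = ?\<kappa> \<one>\<^bsub>?K\<^esub>"
  have Q: "Q \<in> carrier ?L" unfolding Q_def by (rule \<kappa>(1)) simp
  have "adj ?L Q \<otimes>\<^bsub>?L\<^esub> Q = Q"
    by (simp add: Q_def flip: \<kappa>)
  then have Q_le: "cnorm ?L Q \<le> 1" using Q by (rule L.cnorm_le_one_if_projection[rotated])
  \<comment> \<open>Contractivity asks for a complete domain, so the corner norm has to be complete
    before the identity map can be used.\<close>
  interpret K': seminormed_cstar_algebra ?K'
  proof (rule seminormed_cstar_algebra.intro[OF K'.seminormed_star_algebra_axioms],
      rule seminormed_cstar_algebra_axioms.intro)
    fix X :: "nat \<Rightarrow> 'a mat"
    assume X: "\<And>i. X i \<in> carrier ?K'"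
      and C: "\<And>e. e > 0 \<Longrightarrow> \<exists>n. \<forall>i\<ge>n. \<forall>j\<ge>n. cnorm ?K' (X i \<ominus>\<^bsub>?K'\<^esub> X j) < e"
    have cnorm_K': "cnorm ?K' Z = cnorm ?L (?\<kappa> Z)" for Z by (simp add: matrix_algebra_simps(8) \<nu>)
    have \<kappa>X: "?\<kappa> (X i) \<in> carrier ?L" for i by (rule corner_closed[OF X])
    have "\<exists>Z\<in>carrier ?L. (\<lambda>i. cnorm ?L (?\<kappa> (X i) \<ominus>\<^bsub>?L\<^esub> Z)) \<longlonglongrightarrow> 0"
      using C X by (intro L.seq_complete \<kappa>X) (simp add: cnorm_K' \<kappa>_minus)
    then obtain Z where Z: "Z \<in> carrier ?L" and lim: "(\<lambda>i. cnorm ?L (?\<kappa> (X i) \<ominus>\<^bsub>?L\<^esub> Z)) \<longlonglongrightarrow> 0" by blast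
    \<comment> \<open>The limit Z has to be put into the corner. Its cut by Q is a limit as well,
      because Q fixes the sequence and has norm at most 1.\<close>
    define W where "W = mat k k (\<lambda>ij. Z $$ ij)"
    have W: "W \<in> carrier ?K'" using Z km by (auto simp: W_def matrix_algebra_simps)
    have \<kappa>W: "?\<kappa> W = Q \<otimes>\<^bsub>?L\<^esub> Z \<otimes>\<^bsub>?L\<^esub> Q"
      unfolding W_def Q_def by (rule corner_compress[OF Z km, symmetric])
    have \<kappa>XQ: "?\<kappa> (X i) = Q \<otimes>\<^bsub>?L\<^esub> ?\<kappa> (X i) \<otimes>\<^bsub>?L\<^esub> Q" for i
      using X[of i] unfolding Q_def carrier_eq by (simp flip: \<kappa>)
    have le: "cnorm ?K' (X i \<ominus>\<^bsub>?K'\<^esub> W) \<le> cnorm ?L (?\<kappa> (X i) \<ominus>\<^bsub>?L\<^esub> Z)" for i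
    proof -
      have "?\<kappa> (X i \<ominus>\<^bsub>?K'\<^esub> W) = ?\<kappa> (X i) \<ominus>\<^bsub>?L\<^esub> ?\<kappa> W" by (rule \<kappa>_minus[OF X W])
      also have "\<dots> = Q \<otimes>\<^bsub>?L\<^esub> ?\<kappa> (X i) \<otimes>\<^bsub>?L\<^esub> Q \<ominus>\<^bsub>?L\<^esub> Q \<otimes>\<^bsub>?L\<^esub> Z \<otimes>\<^bsub>?L\<^esub> Q"
        using \<kappa>XQ[of i] by (simp add: \<kappa>W)
      also have "\<dots> = Q \<otimes>\<^bsub>?L\<^esub> (?\<kappa> (X i) \<ominus>\<^bsub>?L\<^esub> Z) \<otimes>\<^bsub>?L\<^esub> Q"
        using Q Z \<kappa>X[of i] by (simp add: L.minus_eq L.r_distr L.l_distr L.r_minus L.l_minus)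
      finally have "cnorm ?K' (X i \<ominus>\<^bsub>?K'\<^esub> W) = cnorm ?L (Q \<otimes>\<^bsub>?L\<^esub> (?\<kappa> (X i) \<ominus>\<^bsub>?L\<^esub> Z) \<otimes>\<^bsub>?L\<^esub> Q)"
        by (simp add: cnorm_K')
      also have "\<dots> \<le> 1 * cnorm ?L (?\<kappa> (X i) \<ominus>\<^bsub>?L\<^esub> Z) * 1"
        using Q Z \<kappa>X Q_le by (intro L.cnorm_mult_le) auto
      finally show ?thesis by simp
    qed
    have "(\<lambda>i. cnorm ?K' (X i \<ominus>\<^bsub>?K'\<^esub> W)) \<longlonglongrightarrow> 0"
      by (rule tendsto_sandwich[OF _ _ tendsto_const lim])
        (use le X W K'.cnorm_nonneg in auto)
    then show "\<exists>x\<in>carrier ?K'. (\<lambda>i. cnorm ?K' (X i \<ominus>\<^bsub>?K'\<^esub> x)) \<longlonglongrightarrow> 0" using W by blast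
  qed
  have "unital_cstar_algebra ?K'"
  proof (rule K'.unital_cstar_algebraI)
    fix X assume X: "X \<in> carrier ?K'" and "cnorm ?K' X = 0"
    then have 0: "?\<kappa> X = \<zero>\<^bsub>?L\<^esub>"
      using L.cnorm_eq_0[OF corner_closed[OF X]] by (simp add: matrix_algebra_simps(8) \<nu>)
    show "X = \<zero>\<^bsub>?K'\<^esub>"
    proof (rule eq_matI)
      fix i j assume "i < dim_row \<zero>\<^bsub>?K'\<^esub>" "j < dim_col \<zero>\<^bsub>?K'\<^esub>"
      then have ij: "i < k" "j < k" by (auto simp: matrix_algebra_simps)
      have "X $$ (i, j) = ?\<kappa> X $$ (i, j)" using ij km by (simp add: corner_def)
      then show "X $$ (i, j) = \<zero>\<^bsub>?K'\<^esub> $$ (i, j)" using ij km by (simp add: 0 matrix_algebra_simps)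
    qed (use X in \<open>auto simp: matrix_algebra_simps\<close>)
  qed
  moreover have "id \<in> star_hom ?K' ?K"
    by (rule star_homI) (auto simp: matrix_algebra_simps)
  ultimately have "cnorm ?K (id Y) \<le> cnorm ?K' Y"
    by (intro star_hom_contractive K.seminormed_star_algebra_axioms) (simp_all only: carrier_eq Y)
  then show ?thesis by (simp add: matrix_algebra_simps \<nu>_def)
qed

section \<open>Polynomials of degree one\<close>

lemma adjoint_mat_mult:
  assumes "X \<in> carrier_mat n n" "Y \<in> carrier_mat n n"
  shows "adjoint_mat (X * Y) = adjoint_mat Y * adjoint_mat X"
proof (rule eq_matI)
  fix i j assume "i < dim_row (adjoint_mat Y * adjoint_mat X)" "j < dim_col (adjoint_mat Y * adjoint_mat X)"
  then have ij: "i < n" "j < n" using assms by (auto simp: adjoint_mat_def)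
  have "adjoint_mat (X * Y) $$ (i, j) = cnj (\<Sum>t<n. X $$ (j, t) * Y $$ (t, i))"
    using assms ij adjoint_mat_index[OF mult_carrier_mat[OF assms] ij] by (simp only: index_mult_mat_sum)
  also have "\<dots> = (\<Sum>t<n. adjoint_mat Y $$ (i, t) * adjoint_mat X $$ (t, j))"
    unfolding cnj_sum using assms ij by (intro sum.cong) auto
  also have "\<dots> = (adjoint_mat Y * adjoint_mat X) $$ (i, j)"
    using assms ij by (intro index_mult_mat_sum[symmetric]) auto
  finally show "adjoint_mat (X * Y) $$ (i, j) = (adjoint_mat Y * adjoint_mat X) $$ (i, j)" .
qed (use assms in \<open>auto simp: adjoint_mat_def\<close>)

lemma adjoint_mat_adjoint: "adjoint_mat (adjoint_mat X) = X"
  by (intro eq_matI) (auto simp: adjoint_mat_def)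

lemma adjoint_mat_smult: "adjoint_mat (c \<cdot>\<^sub>m X) = cnj c \<cdot>\<^sub>m adjoint_mat X"
  by (intro eq_matI) (auto simp: adjoint_mat_def)

lemma adjoint_mat_one: "adjoint_mat (1\<^sub>m n) = 1\<^sub>m n"
  by (intro eq_matI) (auto simp: adjoint_mat_def)

text \<open>The adjoint of the hypothesis. A real c is unchanged by it, so u and its adjoint receive
  the same factor.\<close>

lemma compress_adjoint:
  assumes W: "W \<in> carrier_mat n n" and X: "X \<in> carrier_mat n n" and n: "n > 0"
    and eq: "adjoint_mat W * X * W = of_real c \<cdot>\<^sub>m unit_mat n 0 0"
  shows "adjoint_mat W * adjoint_mat X * W = of_real c \<cdot>\<^sub>m unit_mat n 0 0"
proof -
  note [simp] = W X
  have WX: "adjoint_mat W * X \<in> carrier_mat n n" by (rule mult_carrier_mat[of _ n n]) auto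
  have "adjoint_mat W * adjoint_mat X * W = adjoint_mat W * (adjoint_mat X * W)"
    by (rule assoc_mult_mat[of _ n n _ n _ n]) auto
  also have "\<dots> = adjoint_mat (adjoint_mat W * X * W)"
    using adjoint_mat_mult[OF WX W] adjoint_mat_mult[of "adjoint_mat W" n X] by (simp add: adjoint_mat_adjoint)
  also have "\<dots> = of_real c \<cdot>\<^sub>m unit_mat n 0 0"
    using n by (simp add: eq adjoint_mat_smult unit_mat_adjoint)
  finally show ?thesis .
qed

text \<open>A crude bound for the norm of \<open>B \<otimes> x\<close> with x unitary, since
  elementary matrices have norm at most 1. It makes the Lipschitz constant independent of the
  angle.\<close>

definition entry_sum :: "complex mat \<Rightarrow> real" where
  "entry_sum B = (\<Sum>i<dim_row B. \<Sum>j<dim_col B. cmod (B $$ (i, j)))"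

lemma entry_sum_nonneg: "0 \<le> entry_sum B"
  by (simp add: entry_sum_def sum_nonneg)

lemma entry_sum_smult: "entry_sum (c \<cdot>\<^sub>m B) = cmod c * entry_sum B"
  by (simp add: entry_sum_def sum_distrib_left norm_mult)

lemma (in seminormed_star_algebra) cnorm_finsum_le:
  "finite I \<Longrightarrow> f \<in> I \<rightarrow> carrier A \<Longrightarrow> cnorm A (finsum A f I) \<le> (\<Sum>i\<in>I. cnorm A (f i))"
proof (induction I rule: finite_induct)
  case (insert i I)
  then have "f i \<in> carrier A" "f \<in> I \<rightarrow> carrier A" by auto
  then show ?case
    using insert cnorm_triangle[of "f i" "finsum A f I"] by (simp add: finsum_closed)
qed simp

lemma (in matrix_units) cnorm_combination_le:
  assumes B: "B \<in> carrier_mat k k"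
  shows "cnorm C (combination B) \<le> entry_sum B"
proof -
  have le: "cnorm C (B $$ (a, b) \<odot> e a b) \<le> cmod (B $$ (a, b))" if "a < k" "b < k" for a b
    using cnorm_e_le[OF that] e_closed[OF that] by (simp add: cnorm_smult mult_left_le)
  have "cnorm C (combination B) \<le> (\<Sum>a<k. cnorm C (\<Oplus>b\<in>{..<k}. B $$ (a, b) \<odot> e a b))"
    unfolding combination_def by (intro cnorm_finsum_le) (auto simp: e_closed intro!: finsum_closed)
  also have "\<dots> \<le> (\<Sum>a<k. \<Sum>b<k. cnorm C (B $$ (a, b) \<odot> e a b))"
    by (intro sum_mono cnorm_finsum_le) (auto simp: e_closed)
  also have "\<dots> \<le> (\<Sum>a<k. \<Sum>b<k. cmod (B $$ (a, b)))"
    by (intro sum_mono le) auto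
  finally show ?thesis using B by (simp add: entry_sum_def)
qed

lemma (in seminormed_star_algebra) unitary_elem_mat_tensor:
  assumes X: "X \<in> carrier_mat k k" "adjoint_mat X * X = 1\<^sub>m k" "X * adjoint_mat X = 1\<^sub>m k"
    and x: "unitary_elem A x"
  shows "unitary_elem (matrix_algebra k A N) (mat_tensor A X x)"
  using assms
  by (simp add: unitary_elem_def mat_tensor_closed mat_tensor_adj mat_tensor_mult mat_tensor_one)

lemma (in seminormed_star_algebra) unitary_elem_adj: "unitary_elem A x \<Longrightarrow> unitary_elem A (adj A x)"
  by (simp add: unitary_elem_def adj_adj)

lemma (in seminormed_star_algebra) unitary_elem_one: "unitary_elem A \<one>"
  by (simp add: unitary_elem_def)

text \<open>\<open>B \<otimes> x\<close> is the product of \<open>B \<otimes> 1\<close> and the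
  unitary \<open>1 \<otimes> x\<close>. The first factor is a combination of the tensor units with
  outer size 1.\<close>

lemma (in seminormed_star_algebra) cnorm_mat_tensor_le:
  assumes M: "seminormed_star_algebra (matrix_algebra k A N)"
    and B: "B \<in> carrier_mat k k" and x: "unitary_elem A x"
  shows "N (mat_tensor A B x) \<le> entry_sum B"
proof -
  let ?M = "matrix_algebra k A N"
  interpret M: seminormed_star_algebra ?M by fact
  have M1: "seminormed_star_algebra (matrix_algebra (1 * k) A N)" using M by simp
  interpret M1: matrix_units "matrix_algebra (1 * k) A N" k "tensor_unit 1 k"
    by (rule matrix_units_tensor_unit[OF M1])
  have k1: "kronecker 1 k (1\<^sub>m 1) B = B"
    using B by (intro eq_matI) (auto simp: kronecker_def div_eq_0_iff)
  have "cnorm ?M (mat_tensor A B \<one>) \<le> entry_sum B"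
    using M1.cnorm_combination_le[OF B] combination_tensor_unit[OF M1 B] k1 by simp
  moreover have "unitary_elem ?M (mat_tensor A (1\<^sub>m k) x)"
    using x by (intro unitary_elem_mat_tensor) (auto simp: adjoint_mat_one)
  then have "cnorm ?M (mat_tensor A (1\<^sub>m k) x) \<le> 1" by (rule M.cnorm_unitary_le)
  ultimately have "cnorm ?M (mat_tensor A B \<one> \<otimes>\<^bsub>?M\<^esub> mat_tensor A (1\<^sub>m k) x) \<le> entry_sum B * 1"
    using B x by (intro M.cnorm_mult_le) (auto simp: unitary_elem_def mat_tensor_closed)
  then show ?thesis
    using B x by (simp add: mat_tensor_mult unitary_elem_def matrix_algebra_simps(8))
qed

text \<open>The first factor of \<open>kronecker\<close> carries the outer index, so its elementary
  matrix at (0, 0) selects the indices with \<open>i div k = 0\<close>: the leading k x k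
  block.\<close>

lemma (in seminormed_star_algebra) mat_tensor_corner:
  assumes B: "B \<in> carrier_mat k k" and x: "x \<in> carrier A" and n: "n > 0"
  shows "mat_tensor A (kronecker n k (unit_mat n 0 0) B) x = corner A k (n * k) (mat_tensor A B x)"
proof (rule eq_matI)
  fix i j assume "i < dim_row (corner A k (n * k) (mat_tensor A B x))" "j < dim_col (corner A k (n * k) (mat_tensor A B x))"
  then have ij: "i < n * k" "j < n * k" by (auto simp: corner_def)
  have "i div k = 0 \<longleftrightarrow> i < k" "j div k = 0 \<longleftrightarrow> j < k"
    using ij by (auto simp: div_eq_0_iff)
  then show "mat_tensor A (kronecker n k (unit_mat n 0 0) B) x $$ (i, j) = corner A k (n * k) (mat_tensor A B x) $$ (i, j)"
    using ij B x n div_mod_less[OF ij(1)] div_mod_less[OF ij(2)]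
    by (auto simp: mat_tensor_def kronecker_def corner_def unit_mat_def)
qed (auto simp: mat_tensor_def kronecker_def corner_def)

definition degree_one_poly :: "'a mat cstar \<Rightarrow> 'a cstar \<Rightarrow> complex mat \<Rightarrow> complex mat \<Rightarrow> complex mat
    \<Rightarrow> complex mat \<Rightarrow> complex mat \<Rightarrow> 'a \<Rightarrow> 'a \<Rightarrow> 'a mat" where
  "degree_one_poly M A B0 B1 B2 B3 B4 u v = mat_tensor A B0 \<one>\<^bsub>A\<^esub> \<oplus>\<^bsub>M\<^esub> mat_tensor A B1 u
    \<oplus>\<^bsub>M\<^esub> mat_tensor A B2 (adj A u) \<oplus>\<^bsub>M\<^esub> mat_tensor A B3 v \<oplus>\<^bsub>M\<^esub> mat_tensor A B4 (adj A v)"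

lemma (in seminormed_star_algebra) cnorm_degree_one_poly_le:
  assumes M: "seminormed_star_algebra (matrix_algebra k A N)"
    and B: "B0 \<in> carrier_mat k k" "B1 \<in> carrier_mat k k" "B2 \<in> carrier_mat k k"
      "B3 \<in> carrier_mat k k" "B4 \<in> carrier_mat k k"
    and uv: "unitary_elem A u" "unitary_elem A v"
  shows "N (degree_one_poly (matrix_algebra k A N) A B0 B1 B2 B3 B4 u v)
    \<le> entry_sum B0 + entry_sum B1 + entry_sum B2 + entry_sum B3 + entry_sum B4"
proof -
  let ?M = "matrix_algebra k A N"
  interpret M: seminormed_star_algebra ?M by fact
  have c: "\<one> \<in> carrier A" "u \<in> carrier A" "v \<in> carrier A" "adj A u \<in> carrier A" "adj A v \<in> carrier A"
    using uv by (auto simp: unitary_elem_def)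
  note [simp] = mat_tensor_closed[of _ k _ N]
  note le = cnorm_mat_tensor_le[OF M]
  have "cnorm ?M (degree_one_poly ?M A B0 B1 B2 B3 B4 u v)
      \<le> cnorm ?M (mat_tensor A B0 \<one>) + cnorm ?M (mat_tensor A B1 u) + cnorm ?M (mat_tensor A B2 (adj A u))
        + cnorm ?M (mat_tensor A B3 v) + cnorm ?M (mat_tensor A B4 (adj A v))"
    unfolding degree_one_poly_def
    by (intro order_trans[OF M.cnorm_triangle] add_mono order_refl) (use B c in auto)
  also have "\<dots> \<le> entry_sum B0 + entry_sum B1 + entry_sum B2 + entry_sum B3 + entry_sum B4"
    unfolding matrix_algebra_simps(8)
    by (intro add_mono le B uv unitary_elem_one unitary_elem_adj)
  finally show ?thesis by (simp only: matrix_algebra_simps(8))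
qed

text \<open>The difference of the two polynomials is again of degree one, without constant term and
  with coefficients \<open>(1 - c) B\<close> and \<open>(1 - d) B\<close>, and is bounded by entry
  sums.\<close>

lemma (in seminormed_star_algebra) cnorm_degree_one_poly_damped:
  fixes c d :: real
  assumes M: "seminormed_star_algebra (matrix_algebra k A N)"
    and B: "B0 \<in> carrier_mat k k" "B1 \<in> carrier_mat k k" "B2 \<in> carrier_mat k k"
      "B3 \<in> carrier_mat k k" "B4 \<in> carrier_mat k k"
    and uv: "unitary_elem A u" "unitary_elem A v"
  shows "N (degree_one_poly (matrix_algebra k A N) A B0 B1 B2 B3 B4 u v)
    \<le> N (degree_one_poly (matrix_algebra k A N) A B0 (of_real c \<cdot>\<^sub>m B1) (of_real c \<cdot>\<^sub>m B2)
          (of_real d \<cdot>\<^sub>m B3) (of_real d \<cdot>\<^sub>m B4) u v)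
      + (\<bar>1 - c\<bar> * (entry_sum B1 + entry_sum B2) + \<bar>1 - d\<bar> * (entry_sum B3 + entry_sum B4))"
proof -
  let ?M = "matrix_algebra k A N"
  interpret M: seminormed_star_algebra ?M by fact
  have c: "\<one> \<in> carrier A" "u \<in> carrier A" "v \<in> carrier A" "adj A u \<in> carrier A" "adj A v \<in> carrier A"
    using uv by (auto simp: unitary_elem_def)
  note [simp] = mat_tensor_closed[of _ k _ N]
  have split: "mat_tensor A B x = mat_tensor A (of_real c \<cdot>\<^sub>m B) x \<oplus>\<^bsub>?M\<^esub> mat_tensor A (of_real (1 - c) \<cdot>\<^sub>m B) x"
    if "B \<in> carrier_mat k k" "x \<in> carrier A" for B x and c :: real
  proof -
    have "of_real c \<cdot>\<^sub>m B + of_real (1 - c) \<cdot>\<^sub>m B = B"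
      using that by (intro eq_matI) (auto simp: algebra_simps)
    then show ?thesis using that by (simp add: mat_tensor_add)
  qed
  let ?p = "degree_one_poly ?M A B0 (of_real c \<cdot>\<^sub>m B1) (of_real c \<cdot>\<^sub>m B2) (of_real d \<cdot>\<^sub>m B3) (of_real d \<cdot>\<^sub>m B4) u v"
  let ?r = "degree_one_poly ?M A (0\<^sub>m k k) (of_real (1 - c) \<cdot>\<^sub>m B1) (of_real (1 - c) \<cdot>\<^sub>m B2)
    (of_real (1 - d) \<cdot>\<^sub>m B3) (of_real (1 - d) \<cdot>\<^sub>m B4) u v"
  have "degree_one_poly ?M A B0 B1 B2 B3 B4 u v = ?p \<oplus>\<^bsub>?M\<^esub> ?r"
    unfolding degree_one_poly_def
    unfolding split[OF B(2) c(2), of c] split[OF B(3) c(4), of c] split[OF B(4) c(3), of d] split[OF B(5) c(5), of d]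
    using B c by (simp add: M.a_ac mat_tensor_zero[where N = N])
  then have "cnorm ?M (degree_one_poly ?M A B0 B1 B2 B3 B4 u v) \<le> cnorm ?M ?p + cnorm ?M ?r"
    using B c by (simp only:) (intro M.cnorm_triangle; simp add: degree_one_poly_def)
  also have "cnorm ?M ?r \<le> \<bar>1 - c\<bar> * (entry_sum B1 + entry_sum B2) + \<bar>1 - d\<bar> * (entry_sum B3 + entry_sum B4)"
    using cnorm_degree_one_poly_le[OF M _ _ _ _ _ uv, of "0\<^sub>m k k" "of_real (1 - c) \<cdot>\<^sub>m B1" "of_real (1 - c) \<cdot>\<^sub>m B2"
        "of_real (1 - d) \<cdot>\<^sub>m B3" "of_real (1 - d) \<cdot>\<^sub>m B4"] B
    by (simp add: entry_sum_smult matrix_algebra_simps(8) algebra_simps entry_sum_def[of "0\<^sub>m k k"] del: of_real_diff)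
  finally show ?thesis by (simp add: matrix_algebra_simps(8))
qed

text \<open>Compression by \<open>S = W \<otimes> 1 \<otimes> 1\<close> replaces the slice by a
  vector state: it takes \<open>X \<otimes> B \<otimes> u\<close> to \<open>c B \<otimes> u\<close>
  in the leading corner. Norms do not grow, as S is a partial isometry, and the corner norm
  dominates the norm on M_k(A).\<close>

lemma (in seminormed_star_algebra) compress_degree_one_poly:
  fixes c d :: real
  assumes K: "unital_cstar_algebra (matrix_algebra k A N)" and L: "unital_cstar_algebra (matrix_algebra (n * k) A N')"
    and n: "n > 0"
    and B: "B0 \<in> carrier_mat k k" "B1 \<in> carrier_mat k k" "B2 \<in> carrier_mat k k"
      "B3 \<in> carrier_mat k k" "B4 \<in> carrier_mat k k"
    and uv: "unitary_elem A u" "unitary_elem A v"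
    and W: "W \<in> carrier_mat n n" "adjoint_mat W * 1\<^sub>m n * W = unit_mat n 0 0"
    and X: "X \<in> carrier_mat n n" "adjoint_mat W * X * W = of_real c \<cdot>\<^sub>m unit_mat n 0 0"
    and Y: "Y \<in> carrier_mat n n" "adjoint_mat W * Y * W = of_real d \<cdot>\<^sub>m unit_mat n 0 0"
  shows "N (degree_one_poly (matrix_algebra k A N) A B0 (of_real c \<cdot>\<^sub>m B1) (of_real c \<cdot>\<^sub>m B2)
          (of_real d \<cdot>\<^sub>m B3) (of_real d \<cdot>\<^sub>m B4) u v)
    \<le> N' (mat_tensor A (kronecker n k (1\<^sub>m n) B0) \<one>
        \<oplus>\<^bsub>matrix_algebra (n * k) A N'\<^esub> mat_tensor A (kronecker n k X B1) u
        \<oplus>\<^bsub>matrix_algebra (n * k) A N'\<^esub> mat_tensor A (kronecker n k (adjoint_mat X) B2) (adj A u)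
        \<oplus>\<^bsub>matrix_algebra (n * k) A N'\<^esub> mat_tensor A (kronecker n k Y B3) v
        \<oplus>\<^bsub>matrix_algebra (n * k) A N'\<^esub> mat_tensor A (kronecker n k (adjoint_mat Y) B4) (adj A v))"
    (is "N ?p \<le> N' ?q")
proof -
  let ?K = "matrix_algebra k A N" and ?L = "matrix_algebra (n * k) A N'"
  interpret K: unital_cstar_algebra ?K by fact
  interpret L: unital_cstar_algebra ?L by fact
  have uvc: "u \<in> carrier A" "v \<in> carrier A" "adj A u \<in> carrier A" "adj A v \<in> carrier A"
    using uv by (auto simp: unitary_elem_def)
  note [simp] = mat_tensor_closed[of _ k _ N] mat_tensor_closed[of _ "n * k" _ N']
  define S where "S = mat_tensor A (kronecker n k W (1\<^sub>m k)) \<one>"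
  have S: "S \<in> carrier ?L" by (simp add: S_def)
  have S_adj: "adj ?L S = mat_tensor A (kronecker n k (adjoint_mat W) (1\<^sub>m k)) \<one>"
    using W by (simp add: S_def mat_tensor_adj kronecker_adjoint adjoint_mat_one)
  have compress: "adj ?L S \<otimes>\<^bsub>?L\<^esub> mat_tensor A (kronecker n k T B) x \<otimes>\<^bsub>?L\<^esub> S = corner A k (n * k) (mat_tensor A (t \<cdot>\<^sub>m B) x)"
    if T: "T \<in> carrier_mat n n" "adjoint_mat W * T * W = t \<cdot>\<^sub>m unit_mat n 0 0"
      and Bx: "B \<in> carrier_mat k k" "x \<in> carrier A" for T B x t
  proof -
    have WT: "adjoint_mat W * T \<in> carrier_mat n n" using W T by (intro mult_carrier_mat[of _ n n]) auto
    have "adj ?L S \<otimes>\<^bsub>?L\<^esub> mat_tensor A (kronecker n k T B) x \<otimes>\<^bsub>?L\<^esub> S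
        = mat_tensor A (kronecker n k (adjoint_mat W * T * W) (1\<^sub>m k * B * 1\<^sub>m k)) x"
      unfolding S_adj unfolding S_def
      using W T Bx WT by (simp add: mat_tensor_mult kronecker_mult)
    also have "\<dots> = mat_tensor A (kronecker n k (unit_mat n 0 0) (t \<cdot>\<^sub>m B)) x"
      using Bx by (simp add: T(2) kronecker_smult_left)
    also have "\<dots> = corner A k (n * k) (mat_tensor A (t \<cdot>\<^sub>m B) x)"
      using Bx n by (intro mat_tensor_corner) auto
    finally show ?thesis .
  qed
  have S_le: "cnorm ?L S \<le> 1"
  proof (rule L.cnorm_le_one_if_isometry[OF S refl])
    let ?P = "mat_tensor A (kronecker n k (unit_mat n 0 0) (1\<^sub>m k)) \<one>"
    have W': "adjoint_mat W * W = unit_mat n 0 0"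
      using W right_mult_one_mat[OF adjoint_mat_carrier[OF W(1)]] by simp
    have "adj ?L S \<otimes>\<^bsub>?L\<^esub> S = ?P"
      unfolding S_adj unfolding S_def using W by (simp add: mat_tensor_mult kronecker_mult W')
    moreover have "adj ?L ?P \<otimes>\<^bsub>?L\<^esub> ?P = ?P"
      using n by (simp add: mat_tensor_adj kronecker_adjoint adjoint_mat_one unit_mat_adjoint
          mat_tensor_mult kronecker_mult unit_mat_mult)
    ultimately show "adj ?L (adj ?L S \<otimes>\<^bsub>?L\<^esub> S) \<otimes>\<^bsub>?L\<^esub> (adj ?L S \<otimes>\<^bsub>?L\<^esub> S) = adj ?L S \<otimes>\<^bsub>?L\<^esub> S" by simp
  qed
  note X' = compress_adjoint[OF W(1) X(1) n X(2)] and Y' = compress_adjoint[OF W(1) Y(1) n Y(2)]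
  have B0: "1 \<cdot>\<^sub>m B0 = B0" by (intro eq_matI) auto
  have W1: "adjoint_mat W * 1\<^sub>m n * W = 1 \<cdot>\<^sub>m unit_mat n 0 0" using W(2) by (intro eq_matI) auto
  have q: "?q \<in> carrier ?L" using uvc by simp
  have "corner A k (n * k) ?p = adj ?L S \<otimes>\<^bsub>?L\<^esub> ?q \<otimes>\<^bsub>?L\<^esub> S"
    using S uvc B X(1) Y(1)
    by (simp add: degree_one_poly_def corner_add[where N = N and N' = N'] L.l_distr L.r_distr
        compress[OF _ W1, of B0] B0 compress[OF X(1,2)] compress[OF Y(1,2)]
        compress[OF adjoint_mat_carrier[OF X(1)] X'] compress[OF adjoint_mat_carrier[OF Y(1)] Y'])
  then have "N' (corner A k (n * k) ?p) = cnorm ?L (adj ?L S \<otimes>\<^bsub>?L\<^esub> ?q \<otimes>\<^bsub>?L\<^esub> S)"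
    by (simp only: matrix_algebra_simps(8))
  also have "\<dots> \<le> 1 * cnorm ?L ?q * 1"
    using S q S_le by (intro L.cnorm_mult_le) auto
  finally have "N' (corner A k (n * k) ?p) \<le> N' ?q" by (simp add: matrix_algebra_simps(8))
  moreover have "N ?p \<le> N' (corner A k (n * k) ?p)"
    using n uvc B by (intro cnorm_le_cnorm_corner K L) (auto simp: degree_one_poly_def)
  ultimately show ?thesis by simp
qed

text \<open>The unitaries \<open>u \<otimes> U\<close> and \<open>v \<otimes> V\<close>, with clock and shift matrices \<open>U\<close>, \<open>V\<close> of angle
  \<open>\<delta>\<^sub>i \<longlonglongrightarrow> \<theta>' - \<theta>\<close>, form asymptotically a pair of angle \<open>\<theta>'\<close>; the window vector of width
  \<open>m \<approx> 2 \<bar>\<theta>' - \<theta>\<bar>\<^sup>-\<^sup>1\<^sup>/\<^sup>2\<close> compresses them to nearly \<open>u\<close> and \<open>v\<close>.\<close>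

lemma degree_one_poly_norm_step:
  fixes A :: "'a cstar" and A' :: "'b cstar" and \<theta> \<theta>' :: real
  assumes rot: "rotation_algebra \<theta> A u v" and rot': "rotation_algebra \<theta>' A' u' v'"
    and M: "\<And>k. unital_cstar_algebra (matrix_algebra k A (N k))"
    and M': "unital_cstar_algebra (matrix_algebra k A' N')"
    and B: "B0 \<in> carrier_mat k k" "B1 \<in> carrier_mat k k" "B2 \<in> carrier_mat k k"
      "B3 \<in> carrier_mat k k" "B4 \<in> carrier_mat k k"
    and \<theta>: "\<theta> \<noteq> \<theta>'" "\<bar>\<theta>' - \<theta>\<bar> \<le> 1"
  shows "N k (degree_one_poly (matrix_algebra k A (N k)) A B0 B1 B2 B3 B4 u v)
    \<le> N' (degree_one_poly (matrix_algebra k A' N') A' B0 B1 B2 B3 B4 u' v')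
      + 5 * \<bar>\<theta>' - \<theta>\<bar> * (entry_sum B1 + entry_sum B2 + entry_sum B3 + entry_sum B4)"
proof -
  interpret A: unital_cstar_algebra A using rot by (simp add: rotation_algebra_def)
  define \<delta> where "\<delta> = \<theta>' - \<theta>"
  have \<delta>: "\<delta> \<noteq> 0" "\<bar>\<delta>\<bar> \<le> 1" using \<theta> by (auto simp: \<delta>_def)
  \<comment> \<open>The errors \<open>\<delta>^2 m^2 / 8\<close> and \<open>pi^2 / (2 m^2)\<close>
    are both of order |\<delta>| for this m. The numerator 2 and |\<delta>| <= 1 ensure m >= 2, and
    rounding up costs at most a factor 3/2.\<close>
  define m where "m = nat \<lceil>2 / sqrt \<bar>\<delta>\<bar>\<rceil>"
  have sqrt_pos: "0 < sqrt \<bar>\<delta>\<bar>" "sqrt \<bar>\<delta>\<bar> \<le> 1" using \<delta> by auto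
  have m_ge: "2 / sqrt \<bar>\<delta>\<bar> \<le> real m" by (simp add: m_def real_nat_ceiling_ge)
  have two_le: "2 \<le> 2 / sqrt \<bar>\<delta>\<bar>" using sqrt_pos by (simp add: field_simps)
  then have m2: "m \<ge> 2" using m_ge by linarith
  have "real m < 2 / sqrt \<bar>\<delta>\<bar> + 1"
  proof -
    have "real m = of_int \<lceil>2 / sqrt \<bar>\<delta>\<bar>\<rceil>" using two_le unfolding m_def by (intro of_nat_nat) linarith
    then show ?thesis by linarith
  qed
  also have "1 \<le> 1 / sqrt \<bar>\<delta>\<bar>" using sqrt_pos by (simp add: field_simps)
  finally have m_le: "real m \<le> 3 / sqrt \<bar>\<delta>\<bar>" by (simp add: add_divide_distrib[symmetric])
  have m_sq_le: "(real m)\<^sup>2 \<le> 9 / \<bar>\<delta>\<bar>"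
  proof -
    have "(real m)\<^sup>2 \<le> (3 / sqrt \<bar>\<delta>\<bar>)\<^sup>2" using m_le by (intro power_mono) auto
    then show ?thesis by (simp add: power_divide)
  qed
  have m_sq_ge: "4 / \<bar>\<delta>\<bar> \<le> (real m)\<^sup>2"
  proof -
    have "(2 / sqrt \<bar>\<delta>\<bar>)\<^sup>2 \<le> (real m)\<^sup>2" using m_ge two_le by (intro power_mono) linarith+
    then show ?thesis by (simp add: power_divide)
  qed
  \<comment> \<open>The summand m + 1 keeps the window shorter than the cycle for every i.\<close>
  define n where "n i = i + m + 1" for i :: nat
  have n: "n i > 0" "m < n i" for i by (auto simp: n_def)
  \<comment> \<open>Rounding down to a multiple of \<open>2 pi / n\<close> closes the phase around
    the cycle and errs by at most \<open>2 pi / n\<close>.\<close>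
  define \<delta>' where "\<delta>' i = 2 * pi * \<lfloor>real (n i) * \<delta> / (2 * pi)\<rfloor> / real (n i)" for i
  have cis_n: "cis (\<delta>' i * real (n i)) = 1" for i
  proof -
    have "\<delta>' i * real (n i) = 2 * pi * of_int \<lfloor>real (n i) * \<delta> / (2 * pi)\<rfloor>"
      using n(1)[of i] by (simp add: \<delta>'_def)
    then show ?thesis by (simp add: cis_multiple_2pi)
  qed
  have \<delta>'_lim: "\<delta>' \<longlonglongrightarrow> \<delta>"
  proof (rule tendsto_sandwich[OF always_eventually always_eventually])
    show "\<forall>i. \<delta> - 2 * pi / real (n i) \<le> \<delta>' i"
    proof
      fix i
      have "real (n i) * \<delta> / (2 * pi) - 1 \<le> of_int \<lfloor>real (n i) * \<delta> / (2 * pi)\<rfloor>" by linarith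
      then have "2 * pi * (real (n i) * \<delta> / (2 * pi) - 1) \<le> 2 * pi * of_int \<lfloor>real (n i) * \<delta> / (2 * pi)\<rfloor>"
        by (intro mult_left_mono) auto
      also have "2 * pi * (real (n i) * \<delta> / (2 * pi) - 1) = real (n i) * \<delta> - 2 * pi"
        by (simp add: right_diff_distrib)
      finally have "(real (n i) * \<delta> - 2 * pi) / real (n i) \<le> \<delta>' i"
        unfolding \<delta>'_def by (intro divide_right_mono) auto
      then show "\<delta> - 2 * pi / real (n i) \<le> \<delta>' i"
        using n(1)[of i] by (simp add: diff_divide_distrib)
    qed
    show "\<forall>i. \<delta>' i \<le> \<delta>"
    proof
      fix i
      have "of_int \<lfloor>real (n i) * \<delta> / (2 * pi)\<rfloor> \<le> real (n i) * \<delta> / (2 * pi)" by linarith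
      then have "2 * pi * of_int \<lfloor>real (n i) * \<delta> / (2 * pi)\<rfloor> \<le> 2 * pi * (real (n i) * \<delta> / (2 * pi))"
        by (intro mult_left_mono) auto
      also have "\<dots> = real (n i) * \<delta>" by simp
      finally have "\<delta>' i \<le> real (n i) * \<delta> / real (n i)"
        unfolding \<delta>'_def by (intro divide_right_mono) auto
      then show "\<delta>' i \<le> \<delta>"
        using n(1)[of i] by simp
    qed
    have "filterlim (\<lambda>i. real (n i)) at_top sequentially"
      unfolding n_def
      by (rule filterlim_at_top_mono[OF filterlim_real_sequentially]) (auto intro: always_eventually)
    then have "(\<lambda>i. 2 * pi / real (n i)) \<longlonglongrightarrow> 0"
      by (intro tendsto_divide_0[OF tendsto_const] filterlim_at_top_imp_at_infinity)
    then show "(\<lambda>i. \<delta> - 2 * pi / real (n i)) \<longlonglongrightarrow> \<delta>"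
      using tendsto_diff[OF tendsto_const, of _ 0] by force
  qed simp
  \<comment> \<open>The algebras that receive the angle \<theta>' are matrices of growing size over
    the algebra of angle \<theta>.\<close>
  define D where "D i = matrix_algebra (n i * k) A (N (n i * k))" for i
  interpret D: cstar_sequence D
    by (rule cstar_sequence.intro) (simp add: D_def M)
  have D_eq: "D i = matrix_algebra (n i * k) A (N (n i * k))" for i by (simp add: D_def)
  have uv: "unitary_elem A u" "unitary_elem A v" and vu: "v \<otimes>\<^bsub>A\<^esub> u = cis \<theta> \<odot>\<^bsub>A\<^esub> (u \<otimes>\<^bsub>A\<^esub> v)"
    using rot by (auto simp: rotation_algebra_def rotation_pair_def cis_conv_exp)
  have uvc: "u \<in> carrier A" "v \<in> carrier A" using uv by (auto simp: unitary_elem_def)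
  define X Y where "X i = clock_mat (n i) m (\<delta>' i)" and "Y i = shift_mat (n i)" for i
  have XY: "X i \<in> carrier_mat (n i) (n i)" "Y i \<in> carrier_mat (n i) (n i)" for i
    by (simp_all add: X_def Y_def)
  define U V where "U i = mat_tensor A (kronecker (n i) k (X i) (1\<^sub>m k)) u"
    and "V i = mat_tensor A (kronecker (n i) k (Y i) (1\<^sub>m k)) v" for i
  have UV_unitary: "unitary_elem (D i) (U i)" "unitary_elem (D i) (V i)" for i
    unfolding U_def V_def D_eq using XY[of i]
    by (intro A.unitary_elem_mat_tensor uv kronecker_carrier;
        simp add: kronecker_adjoint kronecker_mult adjoint_mat_one X_def Y_def
          clock_mat_unitary shift_mat_unitary kronecker_one)+
  \<comment> \<open>The phases of the two tensor factors multiply: \<theta> from u and v,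
    \<open>\<delta>' i\<close> from the matrices.\<close>
  have VU: "V i \<otimes>\<^bsub>D i\<^esub> U i = cis (\<theta> + \<delta>' i) \<odot>\<^bsub>D i\<^esub> (U i \<otimes>\<^bsub>D i\<^esub> V i)" for i
  proof -
    have "V i \<otimes>\<^bsub>D i\<^esub> U i = mat_tensor A (kronecker (n i) k (Y i * X i) (1\<^sub>m k)) (v \<otimes>\<^bsub>A\<^esub> u)"
      unfolding U_def V_def D_eq using XY[of i] uvc by (simp add: A.mat_tensor_mult kronecker_mult)
    also have "Y i * X i = cis (\<delta>' i) \<cdot>\<^sub>m (X i * Y i)"
      unfolding X_def Y_def by (rule shift_clock_commutation[OF cis_n])
    also have "mat_tensor A (kronecker (n i) k (cis (\<delta>' i) \<cdot>\<^sub>m (X i * Y i)) (1\<^sub>m k)) (v \<otimes>\<^bsub>A\<^esub> u)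
        = cis \<theta> \<odot>\<^bsub>D i\<^esub> (cis (\<delta>' i) \<odot>\<^bsub>D i\<^esub> mat_tensor A (kronecker (n i) k (X i * Y i) (1\<^sub>m k)) (u \<otimes>\<^bsub>A\<^esub> v))"
      unfolding D_eq vu using XY[of i] uvc mult_carrier_mat[OF XY]
      by (simp add: kronecker_smult A.mat_tensor_smult A.mat_tensor_smult_right[where N = "N (n i * k)" and k = "n i * k"])
    also have "mat_tensor A (kronecker (n i) k (X i * Y i) (1\<^sub>m k)) (u \<otimes>\<^bsub>A\<^esub> v) = U i \<otimes>\<^bsub>D i\<^esub> V i"
      unfolding U_def V_def D_eq using XY[of i] uvc by (simp add: A.mat_tensor_mult kronecker_mult)
    finally show ?thesis
      using UV_unitary[of i] by (simp add: D.D.smult_smult unitary_elem_def cis_mult)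
  qed
  have UV_lim: "(\<lambda>i. cnorm (D i) (V i \<otimes>\<^bsub>D i\<^esub> U i \<ominus>\<^bsub>D i\<^esub> exp (\<i> * of_real \<theta>') \<odot>\<^bsub>D i\<^esub> (U i \<otimes>\<^bsub>D i\<^esub> V i))) \<longlonglongrightarrow> 0"
  proof (rule tendsto_sandwich[OF always_eventually always_eventually tendsto_const])
    have UVc: "U i \<otimes>\<^bsub>D i\<^esub> V i \<in> carrier (D i)" for i using UV_unitary[of i] by (simp add: unitary_elem_def)
    show "\<forall>i. 0 \<le> cnorm (D i) (V i \<otimes>\<^bsub>D i\<^esub> U i \<ominus>\<^bsub>D i\<^esub> exp (\<i> * of_real \<theta>') \<odot>\<^bsub>D i\<^esub> (U i \<otimes>\<^bsub>D i\<^esub> V i))"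
      using UVc by (simp add: VU D.D.cnorm_nonneg)
    show "\<forall>i. cnorm (D i) (V i \<otimes>\<^bsub>D i\<^esub> U i \<ominus>\<^bsub>D i\<^esub> exp (\<i> * of_real \<theta>') \<odot>\<^bsub>D i\<^esub> (U i \<otimes>\<^bsub>D i\<^esub> V i))
        \<le> cmod (cis (\<theta> + \<delta>' i) - cis \<theta>')"
    proof
      fix i
      have "cnorm (D i) (U i \<otimes>\<^bsub>D i\<^esub> V i) \<le> 1 * 1"
        using UV_unitary[of i] by (intro D.D.cnorm_mult_le D.D.cnorm_unitary_le) (auto simp: unitary_elem_def)
      then show "cnorm (D i) (V i \<otimes>\<^bsub>D i\<^esub> U i \<ominus>\<^bsub>D i\<^esub> exp (\<i> * of_real \<theta>') \<odot>\<^bsub>D i\<^esub> (U i \<otimes>\<^bsub>D i\<^esub> V i))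
          \<le> cmod (cis (\<theta> + \<delta>' i) - cis \<theta>')"
        using UVc by (simp add: VU D.D.smult_minus D.D.cnorm_smult mult_left_le flip: cis_conv_exp)
    qed
    have "(\<lambda>i. cis (\<theta> + \<delta>' i) - cis \<theta>') \<longlonglongrightarrow> cis (\<theta> + \<delta>) - cis \<theta>'"
      unfolding cis_conv_exp by (intro tendsto_intros \<delta>'_lim)
    then show "(\<lambda>i. cmod (cis (\<theta> + \<delta>' i) - cis \<theta>')) \<longlonglongrightarrow> 0"
      using tendsto_norm_zero by (fastforce simp: \<delta>_def)
  qed
  define E where "E i = A.tensor_unit (n i) k" for i
  define \<beta> where "\<beta> i = matrix_units.combination (D i) k (E i)" for i
  have E: "matrix_units (D i) k (E i)" for i
    unfolding D_eq E_def
    by (rule A.matrix_units_tensor_unit) (use D.D.seminormed_star_algebra_axioms D_eq in metis)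
  have \<beta>: "\<beta> i B = mat_tensor A (kronecker (n i) k (1\<^sub>m (n i)) B) \<one>\<^bsub>A\<^esub>" if "B \<in> carrier_mat k k" for i B
    unfolding \<beta>_def E_def D_eq
    by (rule A.combination_tensor_unit[OF _ that]) (use D.D.seminormed_star_algebra_axioms D_eq in metis)
  \<comment> \<open>The matrix units act on the factor M_k, where U and V have the identity.\<close>
  have comm: "E i a b \<otimes>\<^bsub>D i\<^esub> U i = U i \<otimes>\<^bsub>D i\<^esub> E i a b" "E i a b \<otimes>\<^bsub>D i\<^esub> V i = V i \<otimes>\<^bsub>D i\<^esub> E i a b" for i a b
    unfolding E_def A.tensor_unit_def U_def V_def D_eq
    using XY[of i] uvc by (simp_all add: A.mat_tensor_mult kronecker_mult
        right_mult_one_mat[OF unit_mat_carrier] left_mult_one_mat[OF unit_mat_carrier])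
  define x where "x i = \<beta> i B0 \<oplus>\<^bsub>D i\<^esub> \<beta> i B1 \<otimes>\<^bsub>D i\<^esub> U i \<oplus>\<^bsub>D i\<^esub> \<beta> i B2 \<otimes>\<^bsub>D i\<^esub> adj (D i) (U i)
        \<oplus>\<^bsub>D i\<^esub> \<beta> i B3 \<otimes>\<^bsub>D i\<^esub> V i \<oplus>\<^bsub>D i\<^esub> \<beta> i B4 \<otimes>\<^bsub>D i\<^esub> adj (D i) (V i)" for i
  let ?f = "N k (degree_one_poly (matrix_algebra k A (N k)) A B0 B1 B2 B3 B4 u v)"
  let ?f' = "N' (degree_one_poly (matrix_algebra k A' N') A' B0 B1 B2 B3 B4 u' v')"
  let ?s = "entry_sum B1 + entry_sum B2 + entry_sum B3 + entry_sum B4"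
  have step: "?f
      \<le> cnorm (D i) (x i)
        + 5 * \<bar>\<delta>\<bar> * ?s"
    if \<delta>'_le: "\<bar>\<delta>' i\<bar> \<le> 2 * \<bar>\<delta>\<bar>" for i
  proof -
    let ?n = "n i" and ?W = "window_mat (n i) m" and ?L = "matrix_algebra (n i * k) A (N (n i * k))"
    obtain c :: real where c: "adjoint_mat ?W * X i * ?W = of_real c \<cdot>\<^sub>m unit_mat ?n 0 0"
      and c_le: "\<bar>1 - c\<bar> \<le> (\<delta>' i)\<^sup>2 * (real m)\<^sup>2 / 8"
      using window_mat_clock[OF m2 n(2)] unfolding X_def by blast
    obtain d :: real where d: "adjoint_mat ?W * Y i * ?W = of_real d \<cdot>\<^sub>m unit_mat ?n 0 0"
      and d_le: "\<bar>1 - d\<bar> \<le> pi\<^sup>2 / (2 * (real m)\<^sup>2)"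
      using window_mat_shift[OF m2 n(2)] unfolding Y_def by blast
    have "\<bar>\<delta>' i\<bar>\<^sup>2 \<le> (2 * \<bar>\<delta>\<bar>)\<^sup>2" using \<delta>'_le by (intro power_mono) auto
    then have "(\<delta>' i)\<^sup>2 \<le> (2 * \<bar>\<delta>\<bar>)\<^sup>2" by simp
    \<comment> \<open>With \<open>|\<delta>' i| <= 2 |\<delta>|\<close> and
      \<open>m^2 <= 9 / |\<delta>|\<close> the clock error is at most
      \<open>36 |\<delta>| / 8\<close>; this is where the constant 5 comes from.\<close>
    then have le36: "(\<delta>' i)\<^sup>2 * (real m)\<^sup>2 \<le> (2 * \<bar>\<delta>\<bar>)\<^sup>2 * (9 / \<bar>\<delta>\<bar>)"
      using m_sq_le by (intro mult_mono) auto
    have "(2 * t)\<^sup>2 * (9 / t) = 36 * t" if "t > 0" for t :: real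
      using that by (simp add: power2_eq_square)
    from this[of "\<bar>\<delta>\<bar>"] have c5: "\<bar>1 - c\<bar> \<le> 5 * \<bar>\<delta>\<bar>" using \<delta>(1) c_le le36 by linarith
    have "pi\<^sup>2 \<le> 4\<^sup>2" using pi_less_4 by (intro power_mono) auto
    then have "pi\<^sup>2 / (2 * (real m)\<^sup>2) \<le> 16 / (2 * (4 / \<bar>\<delta>\<bar>))"
      using m_sq_ge \<delta>(1) by (intro frac_le) auto
    \<comment> \<open>The shift error is at most
      \<open>16 / (8 / |\<delta>|) = 2 |\<delta>|\<close>, within the same constant.\<close>
    then have d5: "\<bar>1 - d\<bar> \<le> 5 * \<bar>\<delta>\<bar>" using d_le by simp
    let ?p = "degree_one_poly (matrix_algebra k A (N k)) A B0 (of_real c \<cdot>\<^sub>m B1) (of_real c \<cdot>\<^sub>m B2)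
          (of_real d \<cdot>\<^sub>m B3) (of_real d \<cdot>\<^sub>m B4) u v"
    have "?f \<le> N k ?p
        + (\<bar>1 - c\<bar> * (entry_sum B1 + entry_sum B2) + \<bar>1 - d\<bar> * (entry_sum B3 + entry_sum B4))"
      by (intro A.cnorm_degree_one_poly_damped unital_cstar_algebra.seminormed_star_algebra M B uv)
    also have "\<bar>1 - c\<bar> * (entry_sum B1 + entry_sum B2) + \<bar>1 - d\<bar> * (entry_sum B3 + entry_sum B4)
      \<le> 5 * \<bar>\<delta>\<bar> * (entry_sum B1 + entry_sum B2) + 5 * \<bar>\<delta>\<bar> * (entry_sum B3 + entry_sum B4)"
      using c5 d5 by (intro add_mono mult_right_mono) (auto simp: entry_sum_nonneg add_nonneg_nonneg)
    also have "\<dots> = 5 * \<bar>\<delta>\<bar> * ?s"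
      by (simp add: algebra_simps)
    also have "N k ?p
      \<le> N (?n * k) (mat_tensor A (kronecker ?n k (1\<^sub>m ?n) B0) \<one>\<^bsub>A\<^esub>
        \<oplus>\<^bsub>?L\<^esub> mat_tensor A (kronecker ?n k (X i) B1) u
        \<oplus>\<^bsub>?L\<^esub> mat_tensor A (kronecker ?n k (adjoint_mat (X i)) B2) (adj A u)
        \<oplus>\<^bsub>?L\<^esub> mat_tensor A (kronecker ?n k (Y i) B3) v
        \<oplus>\<^bsub>?L\<^esub> mat_tensor A (kronecker ?n k (adjoint_mat (Y i)) B4) (adj A v))"
      by (intro A.compress_degree_one_poly[OF M M n(1) B uv _ window_mat_isometry[OF m2 n(2)] XY(1) c XY(2) d])
        simp
    also have "\<dots> = cnorm (D i) (x i)"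
      using B uvc XY[of i]
      by (simp add: x_def \<beta> U_def V_def D_eq A.mat_tensor_adj A.mat_tensor_mult kronecker_mult kronecker_adjoint
          adjoint_mat_one matrix_algebra_simps(8) left_mult_one_mat[OF adjoint_mat_carrier[OF XY(1)]]
          left_mult_one_mat[OF adjoint_mat_carrier[OF XY(2)]])
    finally show ?thesis by simp
  qed
  have ev: "\<forall>\<^sub>F i in sequentially. \<bar>\<delta>' i\<bar> \<le> 2 * \<bar>\<delta>\<bar>"
  proof -
    have "(\<lambda>i. \<bar>\<delta>' i\<bar>) \<longlonglongrightarrow> \<bar>\<delta>\<bar>" by (intro tendsto_rabs \<delta>'_lim)
    then have "\<forall>\<^sub>F i in sequentially. \<bar>\<delta>' i\<bar> < 2 * \<bar>\<delta>\<bar>" using \<delta>(1) by (intro order_tendstoD) auto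
    then show ?thesis by (auto elim: eventually_mono)
  qed
  show ?thesis
  proof (rule field_le_epsilon)
    fix \<epsilon> :: real assume "\<epsilon> > 0"
    note lim = D.amplified_norm_limit[OF rot' M' UV_unitary UV_lim E comm B this, folded \<beta>_def]
    \<comment> \<open>A single index at which both eventual statements hold suffices, since the
      claim does not mention it.\<close>
    obtain i where i: "\<bar>\<delta>' i\<bar> \<le> 2 * \<bar>\<delta>\<bar>"
      and "cnorm (D i) (x i)
        \<le> ?f' + \<epsilon>"
      using eventually_happens'[OF sequentially_bot eventually_conj[OF ev lim]]
      by (auto simp: x_def degree_one_poly_def matrix_algebra_simps(8))
    then show "?f
      \<le> ?f'
        + 5 * \<bar>\<theta>' - \<theta>\<bar> * ?s + \<epsilon>"
      using step[OF i] by (simp add: \<delta>_def)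
  qed
qed

text \<open>The step estimate covers distances up to 1 and is used with the two angles in either
  order. Beyond that, all values lie between 0 and K, so K times the distance already
  dominates.\<close>

lemma degree_one_poly_norm_lipschitz:
  fixes A :: "real \<Rightarrow> 'a cstar"
  assumes rot: "\<And>\<theta>. rotation_algebra \<theta> (A \<theta>) (u \<theta>) (v \<theta>)"
    and M: "\<And>\<theta> k. unital_cstar_algebra (matrix_algebra k (A \<theta>) (N \<theta> k))"
    and B: "B0 \<in> carrier_mat k k" "B1 \<in> carrier_mat k k" "B2 \<in> carrier_mat k k"
      "B3 \<in> carrier_mat k k" "B4 \<in> carrier_mat k k"
  shows "\<exists>L. L-lipschitz_on UNIV
    (\<lambda>\<theta>. N \<theta> k (degree_one_poly (matrix_algebra k (A \<theta>) (N \<theta> k)) (A \<theta>) B0 B1 B2 B3 B4 (u \<theta>) (v \<theta>)))"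
proof -
  define f where "f \<theta> = N \<theta> k (degree_one_poly (matrix_algebra k (A \<theta>) (N \<theta> k)) (A \<theta>) B0 B1 B2 B3 B4 (u \<theta>) (v \<theta>))" for \<theta>
  define s where "s = entry_sum B1 + entry_sum B2 + entry_sum B3 + entry_sum B4"
  define K where "K = entry_sum B0 + s"
  have s: "0 \<le> s" "s \<le> K" "0 \<le> K" by (simp_all add: s_def K_def entry_sum_nonneg)
  have f_bounds: "0 \<le> f \<theta>" "f \<theta> \<le> K" for \<theta>
  proof -
    interpret A: unital_cstar_algebra "A \<theta>" using rot by (simp add: rotation_algebra_def)
    interpret M: unital_cstar_algebra "matrix_algebra k (A \<theta>) (N \<theta> k)" by (rule M)
    have uv: "unitary_elem (A \<theta>) (u \<theta>)" "unitary_elem (A \<theta>) (v \<theta>)"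
      using rot[of \<theta>] by (auto simp: rotation_algebra_def rotation_pair_def)
    show "f \<theta> \<le> K"
      using A.cnorm_degree_one_poly_le[OF M.seminormed_star_algebra_axioms B uv] by (simp add: f_def K_def s_def)
    have "degree_one_poly (matrix_algebra k (A \<theta>) (N \<theta> k)) (A \<theta>) B0 B1 B2 B3 B4 (u \<theta>) (v \<theta>)
        \<in> carrier (matrix_algebra k (A \<theta>) (N \<theta> k))"
      using uv B by (simp add: degree_one_poly_def A.mat_tensor_closed unitary_elem_def)
    from M.cnorm_nonneg[OF this] show "0 \<le> f \<theta>" by (simp add: f_def matrix_algebra_simps(8))
  qed
  have le: "f x \<le> f y + 5 * K * \<bar>x - y\<bar>" for x y
  proof (cases "x = y \<or> \<bar>x - y\<bar> > 1")
    case True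
    then show ?thesis
    proof
      assume "\<bar>x - y\<bar> > 1"
      then have "K * 1 \<le> K * (5 * \<bar>x - y\<bar>)" using s by (intro mult_left_mono) auto
      then show ?thesis using f_bounds(2)[of x] f_bounds(1)[of y] by (simp add: mult_ac)
    qed simp
  next
    case False
    then have "f x \<le> f y + 5 * \<bar>y - x\<bar> * s"
      unfolding f_def s_def by (intro degree_one_poly_norm_step[OF rot rot M M B]) auto
    also have "5 * \<bar>y - x\<bar> * s \<le> 5 * \<bar>y - x\<bar> * K" using s by (intro mult_left_mono) auto
    finally show ?thesis by (simp add: abs_minus_commute mult_ac)
  qed
  have "(5 * K)-lipschitz_on UNIV f"
  proof (rule lipschitz_onI)
    show "dist (f x) (f y) \<le> 5 * K * dist x y" for x y
      using le[of x y] le[of y x] by (simp add: dist_real_def abs_minus_commute abs_le_iff)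
  qed (use s in simp)
  then show ?thesis unfolding f_def by blast
qed

text \<open>Forming the 1 x 1 matrix and reading off its entry are mutually inverse homomorphisms,
  and both are contractive.\<close>

lemma cnorm_matrix_algebra_1:
  assumes A: "unital_cstar_algebra A" and M: "unital_cstar_algebra (matrix_algebra 1 A N)"
    and x: "x \<in> carrier A"
  shows "N (mat_tensor A (1\<^sub>m 1) x) = cnorm A x"
proof -
  interpret A: unital_cstar_algebra A by fact
  interpret M: unital_cstar_algebra "matrix_algebra 1 A N" by fact
  let ?M = "matrix_algebra 1 A N"
  have "(\<lambda>x. mat_tensor A (1\<^sub>m 1) x) \<in> star_hom A ?M"
  proof (rule star_homI)
    show "mat_tensor A (1\<^sub>m 1) (x \<oplus>\<^bsub>A\<^esub> y) = mat_tensor A (1\<^sub>m 1) x \<oplus>\<^bsub>?M\<^esub> mat_tensor A (1\<^sub>m 1) y"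
      if "x \<in> carrier A" "y \<in> carrier A" for x y
      using that by (intro eq_matI) (auto simp: mat_tensor_def matrix_algebra_simps)
    show "mat_tensor A (1\<^sub>m 1) (c \<odot>\<^bsub>A\<^esub> x) = c \<odot>\<^bsub>?M\<^esub> mat_tensor A (1\<^sub>m 1) x" if "x \<in> carrier A" for c x
      using that by (intro A.mat_tensor_smult_right) auto
  qed (simp_all add: A.mat_tensor_closed A.mat_tensor_mult A.mat_tensor_adj A.mat_tensor_one adjoint_mat_one)
  then have "cnorm ?M (mat_tensor A (1\<^sub>m 1) x) \<le> cnorm A x"
    by (rule star_hom_contractive[OF A M.seminormed_star_algebra_axioms _ x])
  moreover have "(\<lambda>X. X $$ (0, 0)) \<in> star_hom ?M A"
    by (rule star_homI) (auto simp: matrix_algebra_simps lessThan_Suc)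
  then have "cnorm A (mat_tensor A (1\<^sub>m 1) x $$ (0, 0)) \<le> cnorm ?M (mat_tensor A (1\<^sub>m 1) x)"
    using x by (intro star_hom_contractive[OF M A.seminormed_star_algebra_axioms]) (auto intro: A.mat_tensor_closed)
  ultimately show ?thesis using x by (simp add: mat_tensor_def matrix_algebra_simps(8))
qed

theorem corollary3p3:
  fixes A :: "real \<Rightarrow> 'a cstar"
    and u v :: "real \<Rightarrow> 'a"
    and N :: "real \<Rightarrow> nat \<Rightarrow> 'a mat \<Rightarrow> real"
  assumes "\<And>\<theta>. rotation_algebra \<theta> (A \<theta>) (u \<theta>) (v \<theta>)"
    and "\<And>\<theta> k. unital_cstar_algebra (matrix_algebra k (A \<theta>) (N \<theta> k))"
  shows "(\<forall>k. \<forall>B0 \<in> carrier_mat k k. \<forall>B1 \<in> carrier_mat k k. \<forall>B2 \<in> carrier_mat k k.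
            \<forall>B3 \<in> carrier_mat k k. \<forall>B4 \<in> carrier_mat k k.
            \<exists>L. L-lipschitz_on UNIV (\<lambda>\<theta>.
              let M = matrix_algebra k (A \<theta>) (N \<theta> k) in
              cnorm M (mat_tensor (A \<theta>) B0 \<one>\<^bsub>A \<theta>\<^esub>
                \<oplus>\<^bsub>M\<^esub> mat_tensor (A \<theta>) B1 (u \<theta>)
                \<oplus>\<^bsub>M\<^esub> mat_tensor (A \<theta>) B2 (adj (A \<theta>) (u \<theta>))
                \<oplus>\<^bsub>M\<^esub> mat_tensor (A \<theta>) B3 (v \<theta>)
                \<oplus>\<^bsub>M\<^esub> mat_tensor (A \<theta>) B4 (adj (A \<theta>) (v \<theta>)))))
       \<and> (\<exists>L. L-lipschitz_on UNIV (\<lambda>\<theta>.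
              cnorm (A \<theta>) (u \<theta> \<oplus>\<^bsub>A \<theta>\<^esub> adj (A \<theta>) (u \<theta>)
                \<oplus>\<^bsub>A \<theta>\<^esub> v \<theta> \<oplus>\<^bsub>A \<theta>\<^esub> adj (A \<theta>) (v \<theta>))))"
proof (intro conjI allI ballI)
  fix k and B0 B1 B2 B3 B4 :: "complex mat"
  assume "B0 \<in> carrier_mat k k" "B1 \<in> carrier_mat k k" "B2 \<in> carrier_mat k k"
    "B3 \<in> carrier_mat k k" "B4 \<in> carrier_mat k k"
  from degree_one_poly_norm_lipschitz[of A u v N, OF assms this]
  show "\<exists>L. L-lipschitz_on UNIV (\<lambda>\<theta>.
      let M = matrix_algebra k (A \<theta>) (N \<theta> k) in
      cnorm M (mat_tensor (A \<theta>) B0 \<one>\<^bsub>A \<theta>\<^esub>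
        \<oplus>\<^bsub>M\<^esub> mat_tensor (A \<theta>) B1 (u \<theta>)
        \<oplus>\<^bsub>M\<^esub> mat_tensor (A \<theta>) B2 (adj (A \<theta>) (u \<theta>))
        \<oplus>\<^bsub>M\<^esub> mat_tensor (A \<theta>) B3 (v \<theta>)
        \<oplus>\<^bsub>M\<^esub> mat_tensor (A \<theta>) B4 (adj (A \<theta>) (v \<theta>))))"
    by (simp only: Let_def degree_one_poly_def matrix_algebra_simps(8))
next
  \<comment> \<open>The operator h is the case k = 1 with coefficients 0, 1, 1, 1, 1.\<close>
  have "N \<theta> 1 (degree_one_poly (matrix_algebra 1 (A \<theta>) (N \<theta> 1)) (A \<theta>) (0\<^sub>m 1 1) (1\<^sub>m 1) (1\<^sub>m 1) (1\<^sub>m 1) (1\<^sub>m 1) (u \<theta>) (v \<theta>))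
      = cnorm (A \<theta>) (u \<theta> \<oplus>\<^bsub>A \<theta>\<^esub> adj (A \<theta>) (u \<theta>) \<oplus>\<^bsub>A \<theta>\<^esub> v \<theta> \<oplus>\<^bsub>A \<theta>\<^esub> adj (A \<theta>) (v \<theta>))" for \<theta>
  proof -
    have A: "unital_cstar_algebra (A \<theta>)" using assms(1) by (simp add: rotation_algebra_def)
    interpret A: unital_cstar_algebra "A \<theta>" by (rule A)
    have uv: "u \<theta> \<in> carrier (A \<theta>)" "v \<theta> \<in> carrier (A \<theta>)"
      using assms(1)[of \<theta>] by (auto simp: rotation_algebra_def rotation_pair_def unitary_elem_def)
    have "degree_one_poly (matrix_algebra 1 (A \<theta>) (N \<theta> 1)) (A \<theta>) (0\<^sub>m 1 1) (1\<^sub>m 1) (1\<^sub>m 1) (1\<^sub>m 1) (1\<^sub>m 1) (u \<theta>) (v \<theta>)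
        = mat_tensor (A \<theta>) (1\<^sub>m 1) (u \<theta> \<oplus>\<^bsub>A \<theta>\<^esub> adj (A \<theta>) (u \<theta>) \<oplus>\<^bsub>A \<theta>\<^esub> v \<theta> \<oplus>\<^bsub>A \<theta>\<^esub> adj (A \<theta>) (v \<theta>))"
      using uv by (intro eq_matI) (auto simp: degree_one_poly_def mat_tensor_def matrix_algebra_simps)
    then show ?thesis
      using cnorm_matrix_algebra_1[OF A assms(2)] uv by simp
  qed
  then show "\<exists>L. L-lipschitz_on UNIV (\<lambda>\<theta>. cnorm (A \<theta>) (u \<theta> \<oplus>\<^bsub>A \<theta>\<^esub> adj (A \<theta>) (u \<theta>)
      \<oplus>\<^bsub>A \<theta>\<^esub> v \<theta> \<oplus>\<^bsub>A \<theta>\<^esub> adj (A \<theta>) (v \<theta>)))"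
    using degree_one_poly_norm_lipschitz[of A u v N "0\<^sub>m 1 1" 1 "1\<^sub>m 1" "1\<^sub>m 1" "1\<^sub>m 1" "1\<^sub>m 1", OF assms]
    by simp
qed

end
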